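(* For any bipartite state $\rho$ on a finite-dimensional space $A\otimes B$, $$E_R^\infty(\rho)\ge E_\eta(\rho).$$ Consequently, $E_{C,\mathrm{LOCC}}(\rho)\ge E_C(\rho)\ge E_\eta(\rho)$.
   Context: All Hilbert spaces are finite-dimensional and $\log=\log_2$. A state is a positive semidefinite operator of trace one. $T_B$ denotes partial transpose on Bob's system: $(|i_Aj_B\rangle\langle k_Al_B|)^{T_B}=|i_Al_B\rangle\langle k_Aj_B|$. For tensor powers, the bipartition is all of Alice's systems versus all of Bob's systems. $\|\cdot\|_1$ is the trace norm and $\|\cdot\|_\infty$ the operator norm. Definition of $E_\eta$: for a state $\rho$ on $A\otimes B$ with $P$ the orthogonal projection onto $\mathrm{supp}(\rho)$, $$E_\eta(\rho)=\max\{-\log\|Y^{T_B}\|_\infty:\ Y \text{ Hermitian on }A\otimes B,\ -Y\le P^{T_B}\le Y\}.$$ Relative entropy: $S(\rho\|\sigma)=\mathrm{Tr}(\rho\log\rho-\rho\log\sigma)$ ($+\infty$ if $\mathrm{supp}(\rho)\not\subseteq\mathrm{supp}(\sigma)$). PPT-relative entropy of entanglement: $E_R(\rho)=\min\{S(\rho\|\sigma):\sigma\ge0,\ \sigma^{T_B}\ge0,\ \mathrm{Tr}\,\sigma=1\}$, and its asymptotic version is $E_R^\infty(\rho)=\inf_{n\ge1}E_R(\rho^{\otimes n})/n$. PPT operations: a CPTP map $\Lambda:\mathcal{L}(A\otimes B)\to\mathcal{L}(A'\otimes B')$ is a PPT operation if $T_{B'}\circ\Lambda\circ T_B$ is completely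 positive. LOCC operations are those implementable by local operations and classical communication between Alice and Bob; every LOCC operation is a PPT operation. Let $\Phi=|\phi\rangle\langle\phi|$, $|\phi\rangle=\frac1{\sqrt2}(|00\rangle+|11\rangle)$. For $\Omega\in\{\mathrm{LOCC},\mathrm{PPT}\}$ the entanglement cost is $$E_{C,\Omega}(\rho)=\inf\Big\{r\ge0:\lim_{n\to\infty}\inf_{\Lambda\in\Omega}\|\rho^{\otimes n}-\Lambda(\Phi^{\otimes\lfloor rn\rfloor})\|_1=0\Big\},$$ and $E_C:=E_{C,\mathrm{PPT}}$. *)

theory Defs
  imports
    "Jordan_Normal_Form.Schur_Decomposition"
    "HOL-Library.Extended_Real"
begin

text \<open>
  Operators on a \<open>d\<close>-dimensional Hilbert space are complex \<open>d \<times> d\<close> matrices. The product basis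
  of \<open>A \<otimes> B\<close>, with dimensions \<open>a\<close> and \<open>b\<close>, is enumerated by \<open>|i j> \<mapsto> i * b + j\<close>
  for \<open>i < a\<close> and \<open>j < b\<close>.
\<close>

section \<open>Matrices\<close>

definition hermitian :: "complex mat \<Rightarrow> bool" where
  "hermitian A \<longleftrightarrow> mat_adjoint A = A"

definition unitary :: "nat \<Rightarrow> complex mat \<Rightarrow> bool" where
  "unitary n U \<longleftrightarrow> U \<in> carrier_mat n n \<and> mat_adjoint U * U = 1\<^sub>m n"

text \<open>
  The order on complex numbers is the one in which \<open>0 \<le> z\<close> means that \<open>z\<close> is real and
  nonnegative, so positive semidefinite matrices are automatically Hermitian.
\<close>

definition psd :: "nat \<Rightarrow> complex mat \<Rightarrow> bool" where
  "psd n A \<longleftrightarrow> A \<in> carrier_mat n n \<and> (\<forall>v \<in> carrier_vec n. 0 \<le> (A *\<^sub>v v) \<bullet>c v)"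

text \<open>The library's \<open>\<le>\<close> on matrices is entrywise and is not used for the operator order.\<close>

definition loewner_le :: "nat \<Rightarrow> complex mat \<Rightarrow> complex mat \<Rightarrow> bool" where
  "loewner_le n A B \<longleftrightarrow> A \<in> carrier_mat n n \<and> B \<in> carrier_mat n n \<and> psd n (B - A)"

definition mtrace :: "complex mat \<Rightarrow> complex" where
  "mtrace A = (\<Sum>i<dim_row A. A $$ (i, i))"

definition msum :: "nat \<Rightarrow> nat \<Rightarrow> (nat \<Rightarrow> complex mat) \<Rightarrow> nat \<Rightarrow> complex mat" where
  "msum nr nc F N = mat nr nc (\<lambda>ij. \<Sum>t<N. F t $$ ij)"

definition kron :: "complex mat \<Rightarrow> complex mat \<Rightarrow> complex mat" where
  "kron A B = mat (dim_row A * dim_row B) (dim_col A * dim_col B)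
     (\<lambda>(r, c). A $$ (r div dim_row B, c div dim_col B) * B $$ (r mod dim_row B, c mod dim_col B))"

text \<open>
  Functional calculus: \<open>f(A)\<close> for Hermitian \<open>A\<close>, read off from any unitary diagonalization
  (the result does not depend on which one).
\<close>

definition spec_fun :: "(real \<Rightarrow> real) \<Rightarrow> complex mat \<Rightarrow> complex mat" where
  "spec_fun f A = (THE B. \<exists>n U (d :: nat \<Rightarrow> real). unitary n U \<and>
     A = U * mat_diag n (\<lambda>i. complex_of_real (d i)) * mat_adjoint U \<and>
     B = U * mat_diag n (\<lambda>i. complex_of_real (f (d i))) * mat_adjoint U)"

definition trace_norm :: "complex mat \<Rightarrow> real" where
  "trace_norm A = Re (mtrace (spec_fun sqrt (mat_adjoint A * A)))"

definition vnorm :: "complex vec \<Rightarrow> real" where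
  "vnorm v = sqrt (Re (v \<bullet>c v))"

definition op_norm :: "complex mat \<Rightarrow> real" where
  "op_norm A = (SUP v \<in> {v \<in> carrier_vec (dim_col A). vnorm v \<le> 1}. vnorm (A *\<^sub>v v))"

text \<open>For Hermitian \<open>A\<close> the range is the orthogonal complement of the kernel.\<close>

definition supp :: "complex mat \<Rightarrow> complex vec set" where
  "supp A = (\<lambda>v. A *\<^sub>v v) ` carrier_vec (dim_col A)"

definition supp_proj :: "complex mat \<Rightarrow> complex mat" where
  "supp_proj A = (THE P. P \<in> carrier_mat (dim_row A) (dim_row A) \<and> hermitian P \<and> P * P = P \<and>
     supp P = supp A)"

definition state :: "nat \<Rightarrow> complex mat \<Rightarrow> bool" where
  "state n \<rho> \<longleftrightarrow> psd n \<rho> \<and> mtrace \<rho> = 1"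

section \<open>Bipartite operators\<close>

definition ptrans :: "nat \<Rightarrow> nat \<Rightarrow> complex mat \<Rightarrow> complex mat" where
  "ptrans a b X = mat (a * b) (a * b)
     (\<lambda>(r, c). X $$ ((r div b) * b + c mod b, (c div b) * b + r mod b))"

text \<open>
  The tensor product of an operator on \<open>A \<otimes> B\<close> and one on \<open>A' \<otimes> B'\<close>, reordered to an operator
  on \<open>(A \<otimes> A') \<otimes> (B \<otimes> B')\<close>. A row \<open>r\<close> splits as \<open>(i * a' + i') * (b * b') + (j * b' + j')\<close>
  with \<open>i < a\<close>, \<open>i' < a'\<close>, \<open>j < b\<close>, \<open>j' < b'\<close>.
\<close>

definition bip_tensor ::
  "nat \<Rightarrow> nat \<Rightarrow> nat \<Rightarrow> nat \<Rightarrow> complex mat \<Rightarrow> complex mat \<Rightarrow> complex mat" where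
  "bip_tensor a b a' b' X Y =
     (let L = (\<lambda>r. (r div (b * b') div a') * b + r mod (b * b') div b');
          R = (\<lambda>r. (r div (b * b') mod a') * b' + r mod (b * b') mod b')
      in mat ((a * a') * (b * b')) ((a * a') * (b * b'))
           (\<lambda>(r, c). X $$ (L r, L c) * Y $$ (R r, R c)))"

text \<open>\<open>tensor_pow a b X n\<close> acts on systems of dimensions \<open>a ^ n\<close> and \<open>b ^ n\<close>.\<close>

fun tensor_pow :: "nat \<Rightarrow> nat \<Rightarrow> complex mat \<Rightarrow> nat \<Rightarrow> complex mat" where
  "tensor_pow a b X 0 = 1\<^sub>m 1"
| "tensor_pow a b X (Suc n) = bip_tensor (a ^ n) (b ^ n) a b (tensor_pow a b X n) X"

definition phi_vec :: "complex vec" where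
  "phi_vec = vec (2 * 2) (\<lambda>i. if i = 0 * 2 + 0 \<or> i = 1 * 2 + 1 then 1 / complex_of_real (sqrt 2) else 0)"

definition Phi :: "complex mat" where
  "Phi = mat (2 * 2) (2 * 2) (\<lambda>(i, j). phi_vec $ i * cnj (phi_vec $ j))"

section \<open>Entanglement measures\<close>

text \<open>
  For states, the supremum in \<open>E_eta\<close> and the infimum in \<open>E_R\<close> are a maximum and a minimum.
\<close>

definition E_eta :: "nat \<Rightarrow> nat \<Rightarrow> complex mat \<Rightarrow> ereal" where
  "E_eta a b \<rho> =
     (SUP Y \<in> {Y. Y \<in> carrier_mat (a * b) (a * b) \<and> hermitian Y \<and>
                  loewner_le (a * b) (- Y) (ptrans a b (supp_proj \<rho>)) \<and>
                  loewner_le (a * b) (ptrans a b (supp_proj \<rho>)) Y}.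
        ereal (- log 2 (op_norm (ptrans a b Y))))"

text \<open>
  Since \<open>log 2 0 = 0\<close>, the matrix logarithm vanishes on the kernel of its argument, which
  implements the convention \<open>0 log 0 = 0\<close>.
\<close>

definition rel_entropy :: "complex mat \<Rightarrow> complex mat \<Rightarrow> ereal" where
  "rel_entropy \<rho> \<sigma> =
     (if supp \<rho> \<subseteq> supp \<sigma>
      then ereal (Re (mtrace (\<rho> * spec_fun (log 2) \<rho> - \<rho> * spec_fun (log 2) \<sigma>)))
      else \<infinity>)"

definition E_R :: "nat \<Rightarrow> nat \<Rightarrow> complex mat \<Rightarrow> ereal" where
  "E_R a b \<rho> =
     (INF \<sigma> \<in> {\<sigma>. psd (a * b) \<sigma> \<and> psd (a * b) (ptrans a b \<sigma>) \<and> mtrace \<sigma> = 1}. rel_entropy \<rho> \<sigma>)"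

definition E_R_inf :: "nat \<Rightarrow> nat \<Rightarrow> complex mat \<Rightarrow> ereal" where
  "E_R_inf a b \<rho> = (INF n \<in> {1..}. E_R (a ^ n) (b ^ n) (tensor_pow a b \<rho> n) / ereal (real n))"

section \<open>PPT and LOCC operations\<close>

definition linear_map :: "nat \<Rightarrow> nat \<Rightarrow> (complex mat \<Rightarrow> complex mat) \<Rightarrow> bool" where
  "linear_map m n \<Lambda> \<longleftrightarrow>
     (\<forall>X \<in> carrier_mat m m. \<Lambda> X \<in> carrier_mat n n) \<and>
     (\<forall>X \<in> carrier_mat m m. \<forall>Y \<in> carrier_mat m m. \<Lambda> (X + Y) = \<Lambda> X + \<Lambda> Y) \<and>
     (\<forall>c. \<forall>X \<in> carrier_mat m m. \<Lambda> (c \<cdot>\<^sub>m X) = c \<cdot>\<^sub>m \<Lambda> X)"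

text \<open>The map \<open>id\<^sub>k \<otimes> \<Lambda>\<close>, which applies \<open>\<Lambda>\<close> to each of the \<open>k \<times> k\<close> blocks of size \<open>m \<times> m\<close>.\<close>

definition ampliation ::
  "nat \<Rightarrow> nat \<Rightarrow> nat \<Rightarrow> (complex mat \<Rightarrow> complex mat) \<Rightarrow> complex mat \<Rightarrow> complex mat" where
  "ampliation k m n \<Lambda> X = mat (k * n) (k * n)
     (\<lambda>(r, c). \<Lambda> (mat m m (\<lambda>(i, j). X $$ ((r div n) * m + i, (c div n) * m + j)))
                  $$ (r mod n, c mod n))"

definition completely_positive :: "nat \<Rightarrow> nat \<Rightarrow> (complex mat \<Rightarrow> complex mat) \<Rightarrow> bool" where
  "completely_positive m n \<Lambda> \<longleftrightarrow> linear_map m n \<Lambda> \<and>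
     (\<forall>k X. psd (k * m) X \<longrightarrow> psd (k * n) (ampliation k m n \<Lambda> X))"

definition cptp :: "nat \<Rightarrow> nat \<Rightarrow> (complex mat \<Rightarrow> complex mat) \<Rightarrow> bool" where
  "cptp m n \<Lambda> \<longleftrightarrow> completely_positive m n \<Lambda> \<and>
     (\<forall>X \<in> carrier_mat m m. mtrace (\<Lambda> X) = mtrace X)"

definition PPT_op :: "nat \<Rightarrow> nat \<Rightarrow> nat \<Rightarrow> nat \<Rightarrow> (complex mat \<Rightarrow> complex mat) \<Rightarrow> bool" where
  "PPT_op a b a' b' \<Lambda> \<longleftrightarrow> cptp (a * b) (a' * b') \<Lambda> \<and>
     completely_positive (a * b) (a' * b') (\<lambda>X. ptrans a' b' (\<Lambda> (ptrans a b X)))"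

text \<open>
  A generalized measurement on a \<open>d\<close>-dimensional system with outcomes \<open>t < N\<close>. The dimension
  \<open>e t\<close> of the post-measurement system may depend on the outcome, so that adding and discarding
  local systems is included.
\<close>

definition measurement ::
  "nat \<Rightarrow> nat \<Rightarrow> (nat \<Rightarrow> nat) \<Rightarrow> (nat \<Rightarrow> complex mat) \<Rightarrow> bool" where
  "measurement d N e K \<longleftrightarrow> (\<forall>t<N. K t \<in> carrier_mat (e t) d) \<and>
     msum d d (\<lambda>t. mat_adjoint (K t) * K t) N = 1\<^sub>m d"

text \<open>
  LOCC operations from systems of dimensions \<open>a, b\<close> to systems of dimensions \<open>a', b'\<close>: protocols
  with finitely many rounds, in each of which one party measures and announces the outcome, on
  which the remainder of the protocol may depend. Local instruments with several Kraus operators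
  per outcome are covered, since the remainder \<open>L t\<close> need not make use of all of \<open>t\<close>.
\<close>

inductive LOCC_op :: "nat \<Rightarrow> nat \<Rightarrow> nat \<Rightarrow> nat \<Rightarrow> (complex mat \<Rightarrow> complex mat) \<Rightarrow> bool" where
  finish: "LOCC_op a b a b (\<lambda>X. X)"
| alice: "LOCC_op a b a' b' (\<lambda>X. msum (a' * b') (a' * b')
      (\<lambda>t. L t (kron (K t) (1\<^sub>m b) * X * mat_adjoint (kron (K t) (1\<^sub>m b)))) N)"
  if "measurement a N e K" "\<forall>t<N. LOCC_op (e t) b a' b' (L t)"
| bob: "LOCC_op a b a' b' (\<lambda>X. msum (a' * b') (a' * b')
      (\<lambda>t. L t (kron (1\<^sub>m a) (K t) * X * mat_adjoint (kron (1\<^sub>m a) (K t)))) N)"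
  if "measurement b N e K" "\<forall>t<N. LOCC_op a (e t) a' b' (L t)"

section \<open>Entanglement cost\<close>

definition ent_cost ::
  "(nat \<Rightarrow> nat \<Rightarrow> nat \<Rightarrow> nat \<Rightarrow> (complex mat \<Rightarrow> complex mat) \<Rightarrow> bool) \<Rightarrow>
   nat \<Rightarrow> nat \<Rightarrow> complex mat \<Rightarrow> ereal" where
  "ent_cost \<Omega> a b \<rho> = Inf {ereal r | r. 0 \<le> r \<and>
     ((\<lambda>n. let m = nat \<lfloor>r * real n\<rfloor> in
        INF \<Lambda> \<in> {\<Lambda>. \<Omega> (2 ^ m) (2 ^ m) (a ^ n) (b ^ n) \<Lambda>}.
          ereal (trace_norm (tensor_pow a b \<rho> n - \<Lambda> (tensor_pow 2 2 Phi m)))) \<longlonglongrightarrow> 0)}"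

definition E_C_LOCC :: "nat \<Rightarrow> nat \<Rightarrow> complex mat \<Rightarrow> ereal" where
  "E_C_LOCC = ent_cost LOCC_op"

definition E_C :: "nat \<Rightarrow> nat \<Rightarrow> complex mat \<Rightarrow> ereal" where
  "E_C = ent_cost PPT_op"

end

(*
  Let P be the support projection of rho, let -Y <= P^T <= Y and put y = ||Y^T||, where T is the
  partial transpose. If -Z <= sigma^T <= Z and Z^T >= 0, then
    Tr P sigma = Tr P^T sigma^T <= Tr Y Z = Tr Y^T Z^T <= y Tr Z,
  and since all hypotheses are stable under tensor powers, the same holds for rho^n with y^n.

  For E_R take Z = sigma^T, so that Tr P_n sigma <= y^n for PPT states sigma, and combine this with
  S(rho^n || sigma) >= - log Tr P_n sigma, which follows from concavity of the logarithm.

  The bound on E_C needs no continuity of E_R: for a PPT operation L and m maximally entangled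
  pairs Phi_m, the operator 2^m Phi_m^T is a swap, hence lies between -1 and 1. As T L T is
  positive, sigma = L(Phi_m) satisfies the hypotheses with Z = 2^(-m) T L T (1), whose trace is
  2^m. Hence Tr P_n sigma <= 2^m y^n, whereas Tr P_n rho^n = 1, so an approximation of rho^n with
  vanishing error forces the rate to be at least - log y.
*)
theory Submission
  imports Defs "Jordan_Normal_Form.Spectral_Radius"
begin

section \<open>Adjoints, traces and positive semidefinite matrices\<close>

text \<open>The matrices P^T and sigma^T need not be positive, and one-sided operator inequalities
  between such matrices are not preserved by tensor products. Two-sided bounds -Y \<le> X \<le> Y
  are, which is why every bound is kept in that form, including the one on the operator norm of Y^T.
  The operator Z bounds sigma^T from both sides, and its trace is the price for sigma not being PPT:
  it is 1 for a PPT state with Z = sigma^T and 2^m for the image of m pairs under a PPT operation.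
  One estimate therefore serves both E_R and E_C. Of P_n, the tensor power of P, only two facts are
  used: it is a projection and it fixes rho^n. It never has to be identified with the support
  projection of rho^n. The entropy inequality is classical at heart: in eigenbases of the two
  operators, squared overlaps turn all traces into sums over a joint probability distribution. The
  spectral theorem is thus the basis of everything, also for evaluating the definite descriptions
  behind matrix functions and support projections.\<close>

lemma mat_adjoint_dim [simp]:
  "dim_row (mat_adjoint A) = dim_col A" "dim_col (mat_adjoint A) = dim_row A"
  by (simp_all add: mat_adjoint_def)

lemma mat_adjoint_index [simp]:
  "i < dim_col A \<Longrightarrow> j < dim_row A \<Longrightarrow> mat_adjoint A $$ (i, j) = conjugate (A $$ (j, i))"
  by (simp add: mat_adjoint_def mat_of_rows_def)

lemma mat_adjoint_carrier [simp, intro]: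
  "A \<in> carrier_mat n m \<Longrightarrow> mat_adjoint A \<in> carrier_mat m n"
  by auto

lemma mat_adjoint_adjoint [simp]: "mat_adjoint (mat_adjoint A) = A"
  by (rule eq_matI) auto

lemma mat_adjoint_one [simp]: "mat_adjoint (1\<^sub>m n) = (1\<^sub>m n :: complex mat)"
  by (rule eq_matI) auto

lemma mult_index_sum:
  assumes "A \<in> carrier_mat n m" "B \<in> carrier_mat m k" "i < n" "j < k"
  shows "(A * B) $$ (i, j) = (\<Sum>l<m. A $$ (i, l) * B $$ (l, j))"
  using assms by (auto simp: scalar_prod_def atLeast0LessThan)

lemma mat_adjoint_mult:
  fixes A B :: "complex mat"
  assumes "A \<in> carrier_mat n m" "B \<in> carrier_mat m k"
  shows "mat_adjoint (A * B) = mat_adjoint B * mat_adjoint A"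
proof (rule eq_matI)
  fix i j assume "i < dim_row (mat_adjoint B * mat_adjoint A)"
    and "j < dim_col (mat_adjoint B * mat_adjoint A)"
  then have ij: "i < k" "j < n" using assms by auto
  have "(mat_adjoint B * mat_adjoint A) $$ (i, j)
      = (\<Sum>l<m. mat_adjoint B $$ (i, l) * mat_adjoint A $$ (l, j))"
    using assms ij by (intro mult_index_sum) auto
  also have "\<dots> = cnj ((A * B) $$ (j, i))"
    using assms ij by (subst mult_index_sum[OF assms]) (auto simp: mult.commute)
  also have "\<dots> = mat_adjoint (A * B) $$ (i, j)"
    using assms ij by simp
  finally show "mat_adjoint (A * B) $$ (i, j) = (mat_adjoint B * mat_adjoint A) $$ (i, j)" by simp
qed (use assms in auto)

lemma mat_diag_adjoint:
  "mat_adjoint (mat_diag n (\<lambda>i. complex_of_real (d i))) = mat_diag n (\<lambda>i. complex_of_real (d i))"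
  by (rule eq_matI) (auto simp: mat_diag_def)

lemma mtrace_eq: "A \<in> carrier_mat n m \<Longrightarrow> mtrace A = (\<Sum>i<n. A $$ (i, i))"
  by (simp add: mtrace_def)

lemma mtrace_add:
  "A \<in> carrier_mat n n \<Longrightarrow> B \<in> carrier_mat n n \<Longrightarrow> mtrace (A + B) = mtrace A + mtrace B"
  by (auto simp: mtrace_def sum.distrib)

lemma mtrace_minus:
  "A \<in> carrier_mat n n \<Longrightarrow> B \<in> carrier_mat n n \<Longrightarrow> mtrace (A - B) = mtrace A - mtrace B"
  by (auto simp: mtrace_def sum_subtractf)

lemma mtrace_smult: "A \<in> carrier_mat n n \<Longrightarrow> mtrace (c \<cdot>\<^sub>m A) = c * mtrace A"
  by (auto simp: mtrace_def sum_distrib_left)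

lemma mtrace_one [simp]: "mtrace (1\<^sub>m n) = of_nat n"
  by (simp add: mtrace_def)

lemma mtrace_mult:
  "A \<in> carrier_mat n m \<Longrightarrow> B \<in> carrier_mat m n \<Longrightarrow>
    mtrace (A * B) = (\<Sum>i<n. \<Sum>j<m. A $$ (i, j) * B $$ (j, i))"
  by (subst mtrace_eq[of _ n n]) (auto intro!: sum.cong simp: mult_index_sum[of _ n m _ n] simp del: index_mult_mat(1))

lemma mtrace_comm:
  assumes "A \<in> carrier_mat n m" "B \<in> carrier_mat m n"
  shows "mtrace (A * B) = mtrace (B * A)"
  unfolding mtrace_mult[OF assms] mtrace_mult[OF assms(2,1)]
  by (subst sum.swap) (simp add: mult.commute)

lemma cscalar_prod_eq:
  "dim_vec v = n \<Longrightarrow> dim_vec w = n \<Longrightarrow> v \<bullet>c w = (\<Sum>i<n. v $ i * cnj (w $ i))"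
  by (simp add: scalar_prod_def atLeast0LessThan)

lemma mult_mat_vec_index_sum:
  "A \<in> carrier_mat n m \<Longrightarrow> v \<in> carrier_vec m \<Longrightarrow> i < n \<Longrightarrow> (A *\<^sub>v v) $ i = (\<Sum>j<m. A $$ (i, j) * v $ j)"
  by (auto simp: scalar_prod_def atLeast0LessThan)

lemma cscalar_prod_adjoint:
  fixes A :: "complex mat"
  assumes "A \<in> carrier_mat n m" "v \<in> carrier_vec m" "w \<in> carrier_vec n"
  shows "(A *\<^sub>v v) \<bullet>c w = v \<bullet>c (mat_adjoint A *\<^sub>v w)"
proof -
  have "(A *\<^sub>v v) \<bullet>c w = (\<Sum>i<n. (\<Sum>j<m. A $$ (i, j) * v $ j) * cnj (w $ i))"
    using assms by (subst cscalar_prod_eq[of _ n])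
      (auto simp: mult_mat_vec_index_sum[OF assms(1,2)] simp del: index_mult_mat_vec)
  also have "\<dots> = (\<Sum>j<m. \<Sum>i<n. A $$ (i, j) * v $ j * cnj (w $ i))"
    by (subst sum.swap) (simp add: sum_distrib_right)
  also have "\<dots> = (\<Sum>j<m. v $ j * cnj (\<Sum>i<n. mat_adjoint A $$ (j, i) * w $ i))"
    using assms by (intro sum.cong) (auto simp: sum_distrib_left ac_simps)
  also have "\<dots> = v \<bullet>c (mat_adjoint A *\<^sub>v w)"
    using assms by (subst cscalar_prod_eq[of _ m])
      (auto simp: mult_mat_vec_index_sum[of "mat_adjoint A" m n] simp del: index_mult_mat_vec)
  finally show ?thesis .
qed

lemma psd_carrier: "psd n A \<Longrightarrow> A \<in> carrier_mat n n"
  by (simp add: psd_def)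

lemma psd_add:
  assumes "psd n A" "psd n B" shows "psd n (A + B)"
proof -
  have c: "A \<in> carrier_mat n n" "B \<in> carrier_mat n n" using assms by (auto simp: psd_def)
  have "((A + B) *\<^sub>v v) \<bullet>c v = (A *\<^sub>v v) \<bullet>c v + (B *\<^sub>v v) \<bullet>c v" if "v \<in> carrier_vec n" for v
    using c that by (subst add_mult_distrib_mat_vec[of _ n n]) (auto intro!: add_scalar_prod_distrib[of _ n])
  then show ?thesis using assms c by (auto simp: psd_def intro: add_nonneg_nonneg)
qed

lemma psd_smult:
  assumes "psd n A" "0 \<le> c" shows "psd n (c \<cdot>\<^sub>m A)"
proof -
  have "((c \<cdot>\<^sub>m A) *\<^sub>v v) \<bullet>c v = c * ((A *\<^sub>v v) \<bullet>c v)" if "v \<in> carrier_vec n" for v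
  proof -
    have A: "A \<in> carrier_mat n n" using assms by (simp add: psd_def)
    have "(c \<cdot>\<^sub>m A) *\<^sub>v v = c \<cdot>\<^sub>v (A *\<^sub>v v)" using A that by (intro eq_vecI) auto
    then show ?thesis using A that by simp
  qed
  then show ?thesis using assms by (auto simp: psd_def mult_nonneg_nonneg)
qed

text \<open>The quadratic form of the conjugated matrix at \<open>v\<close> is that of
  \<open>A\<close> at \<open>mat_adjoint B *\<^sub>v v\<close>. The factor \<open>B\<close> may be
  rectangular because Kraus operators change the dimension.\<close>

lemma psd_conj:
  assumes "psd m A" "B \<in> carrier_mat n m"
  shows "psd n (B * A * mat_adjoint B)"
proof -
  have A: "A \<in> carrier_mat m m" using assms by (simp add: psd_def)
  have "((B * A * mat_adjoint B) *\<^sub>v v) \<bullet>c v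
      = (A *\<^sub>v (mat_adjoint B *\<^sub>v v)) \<bullet>c (mat_adjoint B *\<^sub>v v)" if v: "v \<in> carrier_vec n" for v
  proof -
    have "(B * A * mat_adjoint B) *\<^sub>v v = B *\<^sub>v (A *\<^sub>v (mat_adjoint B *\<^sub>v v))"
    proof -
      have w: "mat_adjoint B *\<^sub>v v \<in> carrier_vec m"
        using assms(2) v by (intro mult_mat_vec_carrier) auto
      have "(B * A * mat_adjoint B) *\<^sub>v v = (B * A) *\<^sub>v (mat_adjoint B *\<^sub>v v)"
        using A assms(2) v by (intro assoc_mult_mat_vec[of _ n m _ n]) auto
      also have "\<dots> = B *\<^sub>v (A *\<^sub>v (mat_adjoint B *\<^sub>v v))"
        using A assms(2) w by (intro assoc_mult_mat_vec[of _ n m _ m]) auto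
      finally show ?thesis .
    qed
    moreover have "A *\<^sub>v (mat_adjoint B *\<^sub>v v) \<in> carrier_vec m"
      using A assms(2) v by (intro mult_mat_vec_carrier[of _ m m] mult_mat_vec_carrier[of _ m n]) auto
    ultimately show ?thesis using cscalar_prod_adjoint[OF assms(2) _ v] by simp
  qed
  then show ?thesis using A assms by (auto simp: psd_def intro!: mult_mat_vec_carrier[of _ m n])
qed

lemma psd_one [simp]: "psd n (1\<^sub>m n)"
  by (auto simp: psd_def)

lemma psd_zero [simp]: "psd n (0\<^sub>m n n)"
proof -
  have "0\<^sub>m n n *\<^sub>v v = 0\<^sub>v n" if "v \<in> carrier_vec n" for v :: "complex vec"
    using that by (intro eq_vecI) auto
  then show ?thesis by (auto simp: psd_def)
qed

lemma psd_adjoint_mult: "B \<in> carrier_mat n m \<Longrightarrow> psd m (mat_adjoint B * B)"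
  using psd_conj[OF psd_one, of "mat_adjoint B" m n] by simp

lemma psd_msum: "(\<And>t. t < N \<Longrightarrow> psd n (F t)) \<Longrightarrow> psd n (msum n n F N)"
proof (induction N)
  case 0
  have "msum n n F 0 = 0\<^sub>m n n" by (auto simp: msum_def intro!: eq_matI)
  then show ?case by simp
next
  case (Suc N)
  have "F N \<in> carrier_mat n n" using Suc by (auto simp: psd_def)
  then have "msum n n F (Suc N) = msum n n F N + F N" by (auto simp: msum_def intro!: eq_matI)
  then show ?case using Suc by (auto intro!: psd_add)
qed

lemma psd_diag_nonneg:
  assumes "psd n A" "i < n" shows "0 \<le> A $$ (i, i)"
proof -
  have A: "A \<in> carrier_mat n n" using assms by (simp add: psd_def)
  have "(A *\<^sub>v unit_vec n i) \<bullet>c unit_vec n i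
      = (\<Sum>k<n. (\<Sum>j<n. A $$ (k, j) * unit_vec n i $ j) * cnj (unit_vec n i $ k))"
    using A by (subst cscalar_prod_eq[of _ n])
      (auto simp: mult_mat_vec_index_sum[OF A] simp del: index_mult_mat_vec)
  also have "\<dots> = (\<Sum>k<n. if k = i then A $$ (i, i) else 0)"
    using assms(2) by (intro sum.cong) (auto simp: unit_vec_def if_distrib cong: if_cong)
  also have "\<dots> = A $$ (i, i)" using assms(2) by simp
  finally show ?thesis using assms by (metis psd_def unit_vec_carrier)
qed

text \<open>Polarization with the test vectors \<open>e\<^sub>i + c e\<^sub>j\<close>, \<open>c = 1\<close> and \<open>c = \<i>\<close>.\<close>

lemma hermitian_if_psd:
  assumes "psd n A" shows "hermitian A"
proof -
  have A: "A \<in> carrier_mat n n" using assms by (simp add: psd_def)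
  define q where "q i j c = A $$ (i, i) + c * A $$ (i, j) + cnj c * A $$ (j, i) + c * cnj c * A $$ (j, j)"
    for i j c
  have q: "q i j c \<in> \<real>" if ij: "i < n" "j < n" "i \<noteq> j" for i j c
  proof -
    define v where "v = unit_vec n i + c \<cdot>\<^sub>v (unit_vec n j :: complex vec)"
    have v: "v \<in> carrier_vec n" by (simp add: v_def)
    have vk: "v $ k = (if k = i then 1 else if k = j then c else 0)" if "k < n" for k
      using that ij by (auto simp: v_def unit_vec_def)
    have two: "(\<Sum>k<n. f k) = f i + f j" if "\<And>k. k < n \<Longrightarrow> k \<noteq> i \<Longrightarrow> k \<noteq> j \<Longrightarrow> f k = 0"
      for f :: "nat \<Rightarrow> complex"
    proof -
      have "(\<Sum>k<n. f k) = (\<Sum>k\<in>{i,j}. f k)"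
        using ij that by (intro sum.mono_neutral_right) auto
      then show ?thesis using ij by simp
    qed
    have Av: "(A *\<^sub>v v) $ k = A $$ (k, i) + c * A $$ (k, j)" if "k < n" for k
      unfolding mult_mat_vec_index_sum[OF A v that]
      by (subst two) (use ij in \<open>auto simp: vk\<close>)
    have "(A *\<^sub>v v) \<bullet>c v = (\<Sum>k<n. (A $$ (k, i) + c * A $$ (k, j)) * cnj (v $ k))"
      using A v by (subst cscalar_prod_eq[of _ n]) (auto simp: Av simp del: index_mult_mat_vec)
    also have "\<dots> = q i j c"
      by (subst two) (use ij in \<open>auto simp: vk q_def algebra_simps\<close>)
    finally have "0 \<le> q i j c" using assms v by (auto simp: psd_def)
    then show ?thesis by (simp add: less_eq_complex_def complex_is_Real_iff)
  qed
  have diag: "A $$ (i, i) \<in> \<real>" if "i < n" for i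
    using psd_diag_nonneg[OF assms that] by (simp add: less_eq_complex_def complex_is_Real_iff)
  have "cnj (A $$ (j, i)) = A $$ (i, j)" if ij: "i < n" "j < n" for i j
  proof (cases "i = j")
    case True
    then show ?thesis using diag ij by (metis Reals_cnj_iff)
  next
    case False
    have "Im (q i j 1) = 0" "Im (q i j \<i>) = 0" "Im (A $$ (i, i)) = 0" "Im (A $$ (j, j)) = 0"
      using q[OF ij False] diag ij by (auto simp: complex_is_Real_iff)
    then show ?thesis by (auto simp: q_def complex_eq_iff)
  qed
  then show ?thesis unfolding hermitian_def using A by (intro eq_matI) auto
qed

lemma psd_mtrace_nonneg: "psd n A \<Longrightarrow> 0 \<le> mtrace A"
  by (subst mtrace_eq[of _ n n]) (auto simp: psd_carrier intro!: sum_nonneg psd_diag_nonneg)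

section \<open>Spectral decomposition\<close>

text \<open>The inner dimensions of a matrix product occur only in the carrier premises of these
  rules. Fixing all of them to \<open>n\<close> lets the simplifier reassociate and cancel products
  of square matrices.\<close>

lemmas square_mat =
  assoc_mult_mat[of _ n n _ n _ n] mult_carrier_mat[of _ n n _ n] mat_diag_dim[of n]
  left_mult_one_mat[of _ n n] right_mult_one_mat[of _ n n] mat_adjoint_carrier[of _ n n]
  mat_adjoint_mult[of _ n n _ n] for n

text \<open>A left inverse of a square matrix is also a right inverse, which yields the third
  conclusion.\<close>

lemma unitaryD:
  assumes "unitary n U"
  shows "U \<in> carrier_mat n n" "mat_adjoint U * U = 1\<^sub>m n" "U * mat_adjoint U = 1\<^sub>m n"
  using assms mat_mult_left_right_inverse[of "mat_adjoint U" n U] by (auto simp: unitary_def)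

lemma unitary_mult:
  assumes "unitary n U" "unitary n V" shows "unitary n (U * V)"
proof -
  note U = unitaryD[OF assms(1)] and V = unitaryD[OF assms(2)]
  have "mat_adjoint (U * V) * (U * V) = mat_adjoint V * (mat_adjoint U * (U * V))"
    using U(1) V(1) by (simp add: mat_adjoint_mult[of _ n n] assoc_mult_mat[of _ n n _ n _ n])
  also have "mat_adjoint U * (U * V) = (mat_adjoint U * U) * V"
    using U(1) V(1) by (simp add: assoc_mult_mat[of _ n n _ n _ n])
  also have "mat_adjoint V * \<dots> = 1\<^sub>m n" using U V by simp
  finally show ?thesis using U(1) V(1) by (simp add: unitary_def)
qed

lemma unitary_conj_index:
  assumes "U \<in> carrier_mat n m" "i < n" "j < n"
  shows "(U * mat_diag m f * mat_adjoint U) $$ (i, j) = (\<Sum>k<m. U $$ (i, k) * f k * cnj (U $$ (j, k)))"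
proof -
  have "(U * mat_diag m f * mat_adjoint U) $$ (i, j)
      = (\<Sum>k<m. (U * mat_diag m f) $$ (i, k) * mat_adjoint U $$ (k, j))"
    using assms by (intro mult_index_sum[of _ n m]) auto
  also have "\<dots> = (\<Sum>k<m. U $$ (i, k) * f k * cnj (U $$ (j, k)))"
    using assms by (intro sum.cong) (auto simp: mat_diag_mult_right[OF assms(1)])
  finally show ?thesis .
qed

text \<open>An eigenvector of \<open>A\<close> is completed to a basis, which is then
  orthogonalized. Gram-Schmidt leaves the first vector untouched and normalizing only rescales it,
  so the first column is still an eigenvector.\<close>

lemma eigenvector_unitary:
  fixes A :: "complex mat"
  assumes A: "A \<in> carrier_mat n n" and n: "0 < n"
  obtains U e where "unitary n U" "A *\<^sub>v col U 0 = e \<cdot>\<^sub>v col U 0"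
proof -
  obtain e where "eigenvalue A e"
    using spectrum_non_empty[OF A n] by (auto simp: spectrum_def)
  then obtain v where v: "v \<in> carrier_vec n" "v \<noteq> 0\<^sub>v n" "A *\<^sub>v v = e \<cdot>\<^sub>v v"
    using A by (auto simp: eigenvalue_def eigenvector_def)
  interpret cof_vec_space n "TYPE(complex)" .
  define b where "b = basis_completion v"
  define ws where "ws = gram_schmidt n b"
  note bc = basis_completion[OF v(1,2), folded b_def]
  obtain vs where bv: "b = v # vs" using bc(6,7) n by (cases b) auto
  have ws: "set ws \<subseteq> carrier_vec n" "corthogonal ws" "length ws = n"
    using gram_schmidt_result[OF bc(2,4,5) refl, folded ws_def] bc(6) by auto
  have hd: "hd ws = v" using gram_schmidt_hd[OF v(1), of vs, folded bv] by (simp add: ws_def)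
  have wsc: "ws ! i \<in> carrier_vec n" if "i < n" for i using ws that by auto
  define s where "s i = Re (ws ! i \<bullet>c ws ! i)" for i
  have s: "ws ! i \<bullet>c ws ! i = complex_of_real (s i)" "0 < s i" if "i < n" for i
  proof -
    have "0 \<le> ws ! i \<bullet>c ws ! i" by auto
    moreover have "ws ! i \<bullet>c ws ! i \<noteq> 0" using corthogonalD[OF ws(2)] ws(3) that by auto
    ultimately show "ws ! i \<bullet>c ws ! i = complex_of_real (s i)" "0 < s i"
      by (auto simp: s_def less_eq_complex_def complex_eq_iff)
  qed
  define U where "U = mat n n (\<lambda>(i, j). ws ! j $ i / complex_of_real (sqrt (s j)))"
  have U: "U \<in> carrier_mat n n" by (simp add: U_def)
  have "mat_adjoint U * U = 1\<^sub>m n"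
  proof (rule eq_matI)
    fix i j assume "i < dim_row (1\<^sub>m n)" "j < dim_col (1\<^sub>m n)"
    then have ij: "i < n" "j < n" by auto
    have "(mat_adjoint U * U) $$ (i, j) = (\<Sum>k<n. mat_adjoint U $$ (i, k) * U $$ (k, j))"
      using U ij by (intro mult_index_sum) auto
    also have "\<dots> = (\<Sum>k<n. ws ! j $ k * cnj (ws ! i $ k)
        / (complex_of_real (sqrt (s i)) * complex_of_real (sqrt (s j))))"
      using ij by (intro sum.cong) (auto simp: U_def)
    also have "\<dots> = (ws ! j \<bullet>c ws ! i) / (complex_of_real (sqrt (s i)) * complex_of_real (sqrt (s j)))"
      using wsc ij by (subst cscalar_prod_eq[of _ n]) (auto simp: sum_divide_distrib)
    also have "\<dots> = 1\<^sub>m n $$ (i, j)"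
    proof (cases "i = j")
      case True
      then show ?thesis using s[OF ij(1)] ij by (simp flip: of_real_mult)
    next
      case False
      then have "ws ! j \<bullet>c ws ! i = 0" using corthogonalD[OF ws(2)] ws(3) ij by auto
      then show ?thesis using False ij by simp
    qed
    finally show "(mat_adjoint U * U) $$ (i, j) = 1\<^sub>m n $$ (i, j)" .
  qed (use U in auto)
  moreover have "A *\<^sub>v col U 0 = e \<cdot>\<^sub>v col U 0"
  proof -
    have "ws ! 0 = v" using hd ws(3) n by (metis hd_conv_nth length_0_conv less_irrefl)
    then have "col U 0 = (1 / complex_of_real (sqrt (s 0))) \<cdot>\<^sub>v v"
      using v n by (intro eq_vecI) (auto simp: U_def)
    then show ?thesis
      using A v by (simp add: mult_mat_vec smult_smult_assoc mult.commute)
  qed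
  ultimately show ?thesis using U that by (auto simp: unitary_def)
qed

lemma hermitian_index:
  "hermitian A \<Longrightarrow> A \<in> carrier_mat n n \<Longrightarrow> i < n \<Longrightarrow> j < n \<Longrightarrow> cnj (A $$ (i, j)) = A $$ (j, i)"
  by (metis carrier_matD conjugate_complex_def hermitian_def mat_adjoint_index)

text \<open>Deflation: after conjugation by a unitary whose first column is an eigenvector,
  Hermitian symmetry clears the first row along with the first column and makes \<open>e\<close>
  real, and the induction hypothesis diagonalizes the remaining block.\<close>

theorem hermitian_spectral:
  assumes "A \<in> carrier_mat n n" "hermitian A"
  shows "\<exists>U (d :: nat \<Rightarrow> real). unitary n U \<and>
    A = U * mat_diag n (\<lambda>i. complex_of_real (d i)) * mat_adjoint U"
  using assms
proof (induction n arbitrary: A)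
  case 0
  then have "unitary 0 (1\<^sub>m 0) \<and>
      A = 1\<^sub>m 0 * mat_diag 0 (\<lambda>i. complex_of_real 0) * mat_adjoint (1\<^sub>m 0)"
    by (auto simp: unitary_def intro!: eq_matI)
  then show ?case by (intro exI[of _ "1\<^sub>m 0"] exI[of _ "\<lambda>_. 0"]) simp
next
  case (Suc n)
  note A = Suc.prems(1)
  obtain U e where U: "unitary (Suc n) U" and e: "A *\<^sub>v col U 0 = e \<cdot>\<^sub>v col U 0"
    using eigenvector_unitary[OF A] by auto
  note Uc = unitaryD[OF U]
  define B where "B = mat_adjoint U * A * U"
  have B: "B \<in> carrier_mat (Suc n) (Suc n)" using A Uc by (auto simp: B_def)
  have hB: "hermitian B"
    using A Uc(1) Suc.prems(2)
    by (simp add: hermitian_def B_def square_mat[where n = "Suc n"])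
  have B0: "B $$ (i, 0) = (if i = 0 then e else 0)" if i: "i < Suc n" for i
  proof -
    have AU: "(A * U) $$ (k, 0) = e * U $$ (k, 0)" if "k < Suc n" for k
      using arg_cong[OF e, of "\<lambda>v. v $ k"] A Uc(1) that by auto
    have "B = mat_adjoint U * (A * U)"
      using A Uc(1) by (simp add: B_def square_mat[where n = "Suc n"])
    then have "B $$ (i, 0) = (\<Sum>k<Suc n. mat_adjoint U $$ (i, k) * (A * U) $$ (k, 0))"
      using A Uc(1) i by (simp add: mult_index_sum[of _ "Suc n" "Suc n" _ "Suc n"] del: index_mult_mat)
    also have "\<dots> = e * (\<Sum>k<Suc n. mat_adjoint U $$ (i, k) * U $$ (k, 0))"
      unfolding sum_distrib_left by (intro sum.cong refl) (simp add: AU del: index_mult_mat)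
    also have "(\<Sum>k<Suc n. mat_adjoint U $$ (i, k) * U $$ (k, 0)) = (mat_adjoint U * U) $$ (i, 0)"
      using Uc(1) i by (subst mult_index_sum[of _ "Suc n" "Suc n" _ "Suc n"]) auto
    finally show ?thesis using Uc(2) i by simp
  qed
  have B0': "B $$ (0, i) = (if i = 0 then e else 0)" if "i < Suc n" for i
    using hermitian_index[OF hB B that, of 0] B0[OF that] hermitian_index[OF hB B, of 0 0] B0[of 0]
    by (auto split: if_splits)
  have e_real: "e = complex_of_real (Re e)"
    using hermitian_index[OF hB B, of 0 0] B0[of 0] by (auto simp: complex_eq_iff)
  define B' where "B' = mat n n (\<lambda>(i, j). B $$ (Suc i, Suc j))"
  have "hermitian B'"
    using hermitian_index[OF hB B] unfolding hermitian_def by (intro eq_matI) (auto simp: B'_def)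
  moreover have "B' \<in> carrier_mat n n" by (simp add: B'_def)
  ultimately obtain V and d :: "nat \<Rightarrow> real" where V: "unitary n V"
    and B'V: "B' = V * mat_diag n (\<lambda>i. complex_of_real (d i)) * mat_adjoint V"
    using Suc.IH by blast
  note Vc = unitaryD[OF V]
  \<comment> \<open>The block sum of a one-dimensional identity and \<open>V\<close>; it
    diagonalizes \<open>B\<close>, which is the block sum of \<open>e\<close> and
    \<open>B'\<close>.\<close>
  define W where "W = mat (Suc n) (Suc n) (\<lambda>(i, j). case (i, j) of
    (0, 0) \<Rightarrow> 1 | (Suc i, Suc j) \<Rightarrow> V $$ (i, j) | _ \<Rightarrow> (0 :: complex))"
  define d' where "d' i = (case i of 0 \<Rightarrow> Re e | Suc i \<Rightarrow> d i)" for i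
  have W: "W \<in> carrier_mat (Suc n) (Suc n)" by (simp add: W_def)
  have "mat_adjoint W * W = 1\<^sub>m (Suc n)"
  proof (rule eq_matI)
    fix i j assume "i < dim_row (1\<^sub>m (Suc n))" "j < dim_col (1\<^sub>m (Suc n))"
    then have ij: "i < Suc n" "j < Suc n" by auto
    have VV: "(\<Sum>k<n. cnj (V $$ (k, i)) * V $$ (k, j)) = (if i = j then 1 else 0)"
      if "i < n" "j < n" for i j
      using that Vc(1) arg_cong[OF Vc(2), of "\<lambda>M. M $$ (i, j)"]
      by (subst (asm) mult_index_sum[of _ n n _ n]) auto
    have "(mat_adjoint W * W) $$ (i, j) = (\<Sum>k<Suc n. mat_adjoint W $$ (i, k) * W $$ (k, j))"
      using W ij by (intro mult_index_sum) auto
    also have "\<dots> = (\<Sum>k<Suc n. cnj (W $$ (k, i)) * W $$ (k, j))"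
      using W ij by (intro sum.cong) auto
    also have "\<dots> = 1\<^sub>m (Suc n) $$ (i, j)"
      unfolding sum.lessThan_Suc_shift using ij
      by (cases i; cases j) (auto simp: W_def VV)
    finally show "(mat_adjoint W * W) $$ (i, j) = 1\<^sub>m (Suc n) $$ (i, j)" .
  qed (use W in auto)
  then have Wu: "unitary (Suc n) W" using W by (simp add: unitary_def)
  have BW: "B = W * mat_diag (Suc n) (\<lambda>i. complex_of_real (d' i)) * mat_adjoint W"
  proof (rule eq_matI)
    fix i j assume "i < dim_row (W * mat_diag (Suc n) (\<lambda>i. complex_of_real (d' i)) * mat_adjoint W)"
      and "j < dim_col (W * mat_diag (Suc n) (\<lambda>i. complex_of_real (d' i)) * mat_adjoint W)"
    then have ij: "i < Suc n" "j < Suc n" using W by auto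
    have BV: "B $$ (Suc i, Suc j) = (\<Sum>k<n. V $$ (i, k) * complex_of_real (d k) * cnj (V $$ (j, k)))"
      if "i < n" "j < n" for i j
      using that arg_cong[OF B'V, of "\<lambda>M. M $$ (i, j)"]
      unfolding unitary_conj_index[OF Vc(1) that] by (simp add: B'_def)
    show "B $$ (i, j) = (W * mat_diag (Suc n) (\<lambda>i. complex_of_real (d' i)) * mat_adjoint W) $$ (i, j)"
      unfolding unitary_conj_index[OF W ij] sum.lessThan_Suc_shift
      using ij B0[of i] B0'[of j] e_real
      by (cases i; cases j) (auto simp: W_def d'_def BV)
  qed (use W B in auto)
  have "U * B * mat_adjoint U = (U * mat_adjoint U) * A * (U * mat_adjoint U)"
    using A Uc(1) by (simp add: B_def square_mat[where n = "Suc n"])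
  then have "A = U * B * mat_adjoint U" using A Uc(3) by simp
  also have "\<dots> = (U * W) * mat_diag (Suc n) (\<lambda>i. complex_of_real (d' i)) * mat_adjoint (U * W)"
    using Uc(1) W
    by (simp add: BW square_mat[where n = "Suc n"])
  finally show ?case using unitary_mult[OF U Wu] by blast
qed

section \<open>Matrices that are diagonal in a common orthonormal basis\<close>

lemma unitary_conj_mult:
  assumes "unitary n U"
  shows "(U * mat_diag n f * mat_adjoint U) * (U * mat_diag n g * mat_adjoint U)
    = U * mat_diag n (\<lambda>i. f i * g i) * mat_adjoint U"
proof -
  note U = unitaryD[OF assms] and [simp] = mat_diag_dim[of n]
  have "(U * mat_diag n f * mat_adjoint U) * (U * mat_diag n g * mat_adjoint U)
      = U * mat_diag n f * ((mat_adjoint U * U) * (mat_diag n g * mat_adjoint U))"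
    using U(1) by (simp add: square_mat[where n = n])
  also have "\<dots> = U * (mat_diag n f * mat_diag n g) * mat_adjoint U"
    unfolding U(2) using U(1) by (simp add: square_mat[where n = n] del: mat_diag_diag)
  finally show ?thesis by simp
qed

lemma unitary_conj_mtrace:
  assumes "unitary n U"
  shows "mtrace (U * mat_diag n f * mat_adjoint U) = (\<Sum>i<n. f i)"
proof -
  note U = unitaryD[OF assms] and [simp] = mat_diag_dim[of n]
  have "mtrace (U * mat_diag n f * mat_adjoint U) = mtrace (mat_adjoint U * (U * mat_diag n f))"
    using U(1) by (intro mtrace_comm[of _ n n]) auto
  also have "mat_adjoint U * (U * mat_diag n f) = mat_diag n f"
    using U(1,2) assoc_mult_mat[of "mat_adjoint U" n n U n "mat_diag n f" n]
    by (simp add: square_mat[where n = n])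
  finally show ?thesis by (simp add: mtrace_def mat_diag_def)
qed

lemma unitary_conj_adjoint:
  assumes "unitary n U"
  shows "mat_adjoint (U * mat_diag n (\<lambda>i. complex_of_real (d i)) * mat_adjoint U)
    = U * mat_diag n (\<lambda>i. complex_of_real (d i)) * mat_adjoint U"
  using unitaryD(1)[OF assms] mat_diag_dim[of n "\<lambda>i. complex_of_real (d i)"]
  by (simp add: mat_diag_adjoint square_mat[where n = n])

lemma unitary_conj_carrier:
  "unitary n U \<Longrightarrow> U * mat_diag n f * mat_adjoint U \<in> carrier_mat n n"
  using unitaryD(1)[of n U] mat_diag_dim[of n f] by auto

text \<open>The matrix with eigenvalues \<open>sqrt (d i)\<close> in the same basis is Hermitian,
  and its square is of the form \<open>mat_adjoint R * R\<close>.\<close>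

lemma unitary_conj_psd:
  assumes "unitary n U" "\<And>i. i < n \<Longrightarrow> 0 \<le> d i"
  shows "psd n (U * mat_diag n (\<lambda>i. complex_of_real (d i)) * mat_adjoint U)"
proof -
  define R where "R = U * mat_diag n (\<lambda>i. complex_of_real (sqrt (d i))) * mat_adjoint U"
  have "mat_diag n (\<lambda>i. complex_of_real (sqrt (d i)) * complex_of_real (sqrt (d i)))
      = mat_diag n (\<lambda>i. complex_of_real (d i))"
    using assms(2) by (auto simp: mat_diag_def simp flip: of_real_mult intro!: eq_matI)
  then have "mat_adjoint R * R = U * mat_diag n (\<lambda>i. complex_of_real (d i)) * mat_adjoint U"
    unfolding R_def unitary_conj_adjoint[OF assms(1)] unitary_conj_mult[OF assms(1)] by simp
  moreover have "R \<in> carrier_mat n n"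
    unfolding R_def by (rule unitary_conj_carrier[OF assms(1)])
  ultimately show ?thesis using psd_adjoint_mult[of R n n] by simp
qed

lemma unitary_conj_smult_one:
  assumes "unitary n U"
  shows "U * mat_diag n (\<lambda>i. c) * mat_adjoint U = c \<cdot>\<^sub>m 1\<^sub>m n"
proof -
  note U = unitaryD[OF assms]
  have "mat_diag n (\<lambda>i. c) = c \<cdot>\<^sub>m 1\<^sub>m n" by (auto simp: mat_diag_def intro!: eq_matI)
  then show ?thesis
    using U by (simp add: mult_smult_distrib[of _ n n _ n] mult_smult_assoc_mat[of _ n n _ n])
qed

lemma unitary_conj_linear:
  assumes "unitary n U"
  shows "U * mat_diag n f * mat_adjoint U + U * mat_diag n g * mat_adjoint U
      = U * mat_diag n (\<lambda>i. f i + g i) * mat_adjoint U"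
    and "U * mat_diag n f * mat_adjoint U - U * mat_diag n g * mat_adjoint U
      = U * mat_diag n (\<lambda>i. f i - g i) * mat_adjoint U"
proof -
  note U = unitaryD(1)[OF assms] and [simp] = mat_diag_dim[of n]
  have ix: "(U * mat_diag n f * mat_adjoint U) $$ (i, j) = (\<Sum>k<n. U $$ (i, k) * f k * cnj (U $$ (j, k)))"
    if "i < n" "j < n" for i j f using unitary_conj_index[OF U that] .
  show "U * mat_diag n f * mat_adjoint U + U * mat_diag n g * mat_adjoint U
      = U * mat_diag n (\<lambda>i. f i + g i) * mat_adjoint U"
    using U by (intro eq_matI) (auto simp: ix sum.distrib algebra_simps simp del: index_mult_mat(1))
  show "U * mat_diag n f * mat_adjoint U - U * mat_diag n g * mat_adjoint U
      = U * mat_diag n (\<lambda>i. f i - g i) * mat_adjoint U"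
    using U by (intro eq_matI) (auto simp: ix sum_subtractf algebra_simps simp del: index_mult_mat(1))
qed

lemma psd_eigenvalue_nonneg:
  assumes "psd n (U * mat_diag n (\<lambda>i. complex_of_real (d i)) * mat_adjoint U)"
    and U: "unitary n U" and i: "i < n"
  shows "0 \<le> d i"
proof -
  note Uc = unitaryD[OF U] and [simp] = mat_diag_dim[of n]
  have "mat_adjoint U * (U * mat_diag n (\<lambda>i. complex_of_real (d i)) * mat_adjoint U)
      * mat_adjoint (mat_adjoint U)
      = (mat_adjoint U * U) * mat_diag n (\<lambda>i. complex_of_real (d i)) * (mat_adjoint U * U)"
    using Uc(1) by (simp add: square_mat[where n = n])
  also have "\<dots> = mat_diag n (\<lambda>i. complex_of_real (d i))"
    using Uc(2) by (simp add: square_mat[where n = n])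
  finally have "psd n (mat_diag n (\<lambda>i. complex_of_real (d i)))"
    using psd_conj[OF assms(1), of "mat_adjoint U" n] Uc(1) by simp
  from psd_diag_nonneg[OF this i] i show ?thesis
    by (simp add: mat_diag_def less_eq_complex_def)
qed

section \<open>Factorization and trace pairing of positive matrices\<close>

lemma psd_spectral:
  assumes "psd n A"
  shows "\<exists>U (d :: nat \<Rightarrow> real). unitary n U \<and> (\<forall>i<n. 0 \<le> d i) \<and>
    A = U * mat_diag n (\<lambda>i. complex_of_real (d i)) * mat_adjoint U"
  using hermitian_spectral[OF psd_carrier[OF assms] hermitian_if_psd[OF assms]]
    psd_eigenvalue_nonneg assms by blast

text \<open>The factorization turns positivity into an algebraic identity, to which multiplicativity
  of tensor products and cyclicity of the trace apply.\<close>

lemma psd_factor: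
  assumes "psd n A"
  obtains B where "B \<in> carrier_mat n n" "A = mat_adjoint B * B"
proof -
  obtain U and d :: "nat \<Rightarrow> real" where U: "unitary n U" and d: "\<forall>i<n. 0 \<le> d i"
    and A: "A = U * mat_diag n (\<lambda>i. complex_of_real (d i)) * mat_adjoint U"
    using psd_spectral[OF assms] by blast
  have "mat_diag n (\<lambda>i. complex_of_real (sqrt (d i)) * complex_of_real (sqrt (d i)))
      = mat_diag n (\<lambda>i. complex_of_real (d i))"
    using d by (auto simp: mat_diag_def simp flip: of_real_mult intro!: eq_matI)
  then have "A = mat_adjoint (U * mat_diag n (\<lambda>i. complex_of_real (sqrt (d i))) * mat_adjoint U)
      * (U * mat_diag n (\<lambda>i. complex_of_real (sqrt (d i))) * mat_adjoint U)"
    unfolding unitary_conj_adjoint[OF U] unitary_conj_mult[OF U] A by simp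
  then show ?thesis using that unitary_conj_carrier[OF U] by blast
qed

text \<open>The product \<open>A * B\<close> need not be Hermitian, but cyclicity of the trace
  replaces it by the positive matrix \<open>C * B * mat_adjoint C\<close>.\<close>

lemma psd_mtrace_mult_nonneg:
  assumes "psd n A" "psd n B" shows "0 \<le> mtrace (A * B)"
proof -
  obtain C where C: "C \<in> carrier_mat n n" "A = mat_adjoint C * C" using psd_factor[OF assms(1)] .
  note B = psd_carrier[OF assms(2)]
  have "mtrace (A * B) = mtrace (mat_adjoint C * (C * B))"
    using B C by (simp add: square_mat[where n = n])
  also have "\<dots> = mtrace (C * B * mat_adjoint C)"
    using B C by (intro mtrace_comm[of _ n n]) auto
  also have "0 \<le> \<dots>" using psd_mtrace_nonneg psd_conj[OF assms(2) C(1)] by blast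
  finally show ?thesis .
qed

text \<open>
  If \<open>V\<^sup>* U\<close> intertwines the diagonal matrices of two diagonalizations of \<open>A\<close>, then its entry
  \<open>(i, j)\<close> vanishes unless the eigenvalues \<open>e i\<close> and \<open>d j\<close> agree, so it intertwines the images
  under \<open>f\<close> as well.
\<close>

lemma spec_fun_unitary_conj:
  assumes U: "unitary n U"
  shows "spec_fun f (U * mat_diag n (\<lambda>i. complex_of_real (d i)) * mat_adjoint U)
    = U * mat_diag n (\<lambda>i. complex_of_real (f (d i))) * mat_adjoint U" (is "spec_fun f ?A = ?B")
  unfolding spec_fun_def
proof (rule the_equality)
  show "\<exists>m V (e :: nat \<Rightarrow> real). unitary m V \<and>
      ?A = V * mat_diag m (\<lambda>i. complex_of_real (e i)) * mat_adjoint V \<and>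
      ?B = V * mat_diag m (\<lambda>i. complex_of_real (f (e i))) * mat_adjoint V"
    using U by blast
next
  fix B assume "\<exists>m V (e :: nat \<Rightarrow> real). unitary m V \<and>
      ?A = V * mat_diag m (\<lambda>i. complex_of_real (e i)) * mat_adjoint V \<and>
      B = V * mat_diag m (\<lambda>i. complex_of_real (f (e i))) * mat_adjoint V"
  then obtain m V and e :: "nat \<Rightarrow> real" where V: "unitary m V"
    and A: "?A = V * mat_diag m (\<lambda>i. complex_of_real (e i)) * mat_adjoint V"
    and B: "B = V * mat_diag m (\<lambda>i. complex_of_real (f (e i))) * mat_adjoint V" by blast
  \<comment> \<open>The description in \<open>spec_fun\<close> also quantifies over the dimension,
    which the number of rows of the argument determines.\<close>
  have "dim_row ?A = n" "dim_row (V * mat_diag m (\<lambda>i. complex_of_real (e i)) * mat_adjoint V) = m"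
    using unitaryD(1)[OF U] unitaryD(1)[OF V] by auto
  then have mn: "m = n" using A by simp
  note Uc = unitaryD[OF U] and Vc = unitaryD[OF V, unfolded mn] and [simp] = mat_diag_dim[of n]
  define W where "W = mat_adjoint V * U"
  have W: "W \<in> carrier_mat n n" using Uc Vc by (auto simp: W_def)
  have "W * mat_diag n (\<lambda>i. complex_of_real (d i)) = mat_adjoint V * (?A * U)"
    using Uc Vc by (simp add: W_def square_mat[where n = n])
  also have "\<dots> = (mat_adjoint V * V) * mat_diag n (\<lambda>i. complex_of_real (e i)) * W"
    using Uc(1) Vc(1) unfolding A mn by (simp add: W_def square_mat[where n = n])
  also have "\<dots> = mat_diag n (\<lambda>i. complex_of_real (e i)) * W" using Vc W by (simp add: square_mat[where n = n])
  finally have WW: "W * mat_diag n (\<lambda>i. complex_of_real (d i))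
    = mat_diag n (\<lambda>i. complex_of_real (e i)) * W" .
  have ent: "W $$ (i, j) * complex_of_real (d j) = complex_of_real (e i) * W $$ (i, j)"
    if "i < n" "j < n" for i j
    using arg_cong[OF WW, of "\<lambda>M. M $$ (i, j)"] that W
    by (simp add: mat_diag_mult_left[OF W] mat_diag_mult_right[OF W])
  have fWW: "W * mat_diag n (\<lambda>i. complex_of_real (f (d i)))
    = mat_diag n (\<lambda>i. complex_of_real (f (e i))) * W"
    unfolding mat_diag_mult_left[OF W] mat_diag_mult_right[OF W]
  proof (rule eq_matI)
    fix i j assume "i < dim_row (mat n n (\<lambda>(i, j). complex_of_real (f (e i)) * W $$ (i, j)))"
      and "j < dim_col (mat n n (\<lambda>(i, j). complex_of_real (f (e i)) * W $$ (i, j)))"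
    then have ij: "i < n" "j < n" by auto
    show "mat n n (\<lambda>(i, j). W $$ (i, j) * complex_of_real (f (d j))) $$ (i, j)
        = mat n n (\<lambda>(i, j). complex_of_real (f (e i)) * W $$ (i, j)) $$ (i, j)"
      using ent[OF ij] ij by (cases "W $$ (i, j) = 0") auto
  qed auto
  have VW: "V * W = U"
    using Uc Vc assoc_mult_mat[of V n n "mat_adjoint V" n U n]
    by (simp add: W_def square_mat[where n = n])
  have "?B = V * (W * mat_diag n (\<lambda>i. complex_of_real (f (d i)))) * mat_adjoint U"
    using Vc W by (simp add: square_mat[where n = n] flip: VW)
  also have "\<dots> = V * mat_diag n (\<lambda>i. complex_of_real (f (e i))) * (W * mat_adjoint U)"
    using Uc Vc W by (simp add: fWW square_mat[where n = n])
  also have "W * mat_adjoint U = mat_adjoint V"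
    using Uc Vc by (simp add: W_def square_mat[where n = n])
  finally show "B = ?B" by (simp add: B mn)
qed

section \<open>Partial transpose and tensor products\<close>

lemma mult_add_less: "i * b + j < a * b" if "i < a" "j < b" for a b i j :: nat
proof -
  have "i * b + j < (i + 1) * b" using that by simp
  also have "\<dots> \<le> a * b" using that by (intro mult_le_mono1) simp
  finally show ?thesis .
qed

lemma div_mod_less: "r < a * b \<Longrightarrow> r div b < a \<and> r mod b < b" for a b r :: nat
  by (metis gr_implies_not0 less_mult_imp_div_less mod_less_divisor mult_0_right neq0_conv)

lemma div_mod_mult_add: "j < m \<Longrightarrow> (i * m + j) div m = i \<and> (i * m + j) mod m = j" for i j m :: nat
  by simp

lemma pt_index_less: "r < a * b \<Longrightarrow> c < a * b \<Longrightarrow> r div b * b + c mod b < a * b" for a b r c :: nat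
  using div_mod_less mult_add_less by blast

lemma ptrans_carrier [simp]: "ptrans a b X \<in> carrier_mat (a * b) (a * b)"
  by (simp add: ptrans_def)

lemma ptrans_dim [simp]: "dim_row (ptrans a b X) = a * b" "dim_col (ptrans a b X) = a * b"
  by (simp_all add: ptrans_def)

lemma ptrans_index [simp]:
  "r < a * b \<Longrightarrow> c < a * b \<Longrightarrow>
    ptrans a b X $$ (r, c) = X $$ (r div b * b + c mod b, c div b * b + r mod b)"
  by (simp add: ptrans_def)

lemma ptrans_ptrans [simp]:
  assumes "X \<in> carrier_mat (a * b) (a * b)" shows "ptrans a b (ptrans a b X) = X"
proof (rule eq_matI)
  fix r c assume "r < dim_row X" "c < dim_col X"
  then have rc: "r < a * b" "c < a * b" using assms by auto
  have b: "0 < b" using rc by (cases b) auto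
  show "ptrans a b (ptrans a b X) $$ (r, c) = X $$ (r, c)"
    using rc b by (simp add: pt_index_less)
qed (use assms in auto)

lemma ptrans_smult:
  "X \<in> carrier_mat (a * b) (a * b) \<Longrightarrow> ptrans a b (c \<cdot>\<^sub>m X) = c \<cdot>\<^sub>m ptrans a b X"
  by (rule eq_matI) (auto simp: pt_index_less)

lemma ptrans_adjoint:
  "X \<in> carrier_mat (a * b) (a * b) \<Longrightarrow> mat_adjoint (ptrans a b X) = ptrans a b (mat_adjoint X)"
  by (rule eq_matI) (auto simp: pt_index_less)

lemma ptrans_one [simp]: "ptrans a b (1\<^sub>m (a * b)) = 1\<^sub>m (a * b)"
proof (rule eq_matI)
  fix r c assume "r < dim_row (1\<^sub>m (a * b))" "c < dim_col (1\<^sub>m (a * b))"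
  then have rc: "r < a * b" "c < a * b" by auto
  have "r div b * b + c mod b = c div b * b + r mod b \<longleftrightarrow> r = c"
  proof
    assume e: "r div b * b + c mod b = c div b * b + r mod b"
    have "0 < b" using rc by (cases b) auto
    then have "r div b = c div b" "r mod b = c mod b"
      using arg_cong[OF e, of "\<lambda>x. x div b"] arg_cong[OF e, of "\<lambda>x. x mod b"] by auto
    then show "r = c" by (metis div_mult_mod_eq)
  qed simp
  then show "ptrans a b (1\<^sub>m (a * b)) $$ (r, c) = 1\<^sub>m (a * b) $$ (r, c)"
    using rc by (simp add: pt_index_less)
qed auto

text \<open>Partial transposition moves the entry at \<open>(r, c)\<close> by an involution of the
  index pairs that commutes with exchanging row and column. The double sum of
  \<open>X $$ (r, c) * Y $$ (c, r)\<close> is therefore only reindexed.\<close>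

lemma mtrace_ptrans_mult:
  assumes X: "X \<in> carrier_mat (a * b) (a * b)" and Y: "Y \<in> carrier_mat (a * b) (a * b)"
  shows "mtrace (ptrans a b X * ptrans a b Y) = mtrace (X * Y)"
proof -
  define s where "s r c = r div b * b + c mod b" for r c
  have s_less: "s r c < a * b" if "r < a * b" "c < a * b" for r c
    using that by (simp add: s_def pt_index_less)
  have s_s: "s (s r c) (s c r) = r" if "r < a * b" for r c
  proof -
    have "0 < b" using that by (cases b) auto
    then show ?thesis by (simp add: s_def)
  qed
  let ?N = "{..<a * b} \<times> {..<a * b}"
  have "mtrace (ptrans a b X * ptrans a b Y)
      = (\<Sum>r<a * b. \<Sum>c<a * b. X $$ (s r c, s c r) * Y $$ (s c r, s r c))"
    unfolding mtrace_mult[OF ptrans_carrier ptrans_carrier] by (intro sum.cong refl) (auto simp: s_def)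
  also have "\<dots> = (\<Sum>(r, c)\<in>?N. X $$ (s r c, s c r) * Y $$ (s c r, s r c))"
    by (simp add: sum.cartesian_product)
  also have "\<dots> = (\<Sum>(r, c)\<in>?N. X $$ (r, c) * Y $$ (c, r))"
    by (rule sum.reindex_bij_witness[of _ "\<lambda>(r, c). (s r c, s c r)" "\<lambda>(r, c). (s r c, s c r)"])
      (auto simp: s_s s_less)
  also have "\<dots> = mtrace (X * Y)"
    by (simp add: mtrace_mult[OF X Y] sum.cartesian_product)
  finally show ?thesis .
qed

lemma mtrace_ptrans:
  assumes "X \<in> carrier_mat (a * b) (a * b)" shows "mtrace (ptrans a b X) = mtrace X"
  using mtrace_ptrans_mult[OF assms one_carrier_mat] assms
  by (simp add: right_mult_one_mat[OF ptrans_carrier])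

text \<open>\<open>bip_left\<close> and \<open>bip_right\<close> are the local index functions
  \<open>L\<close> and \<open>R\<close> in the body of \<open>bip_tensor\<close>. Naming them keeps
  nested divisions out of the calculations.\<close>

definition bip_left :: "nat \<Rightarrow> nat \<Rightarrow> nat \<Rightarrow> nat \<Rightarrow> nat" where
  "bip_left b a' b' r = (r div (b * b') div a') * b + r mod (b * b') div b'"

definition bip_right :: "nat \<Rightarrow> nat \<Rightarrow> nat \<Rightarrow> nat \<Rightarrow> nat" where
  "bip_right b a' b' r = (r div (b * b') mod a') * b' + r mod (b * b') mod b'"

text \<open>The inverse of \<open>bip_left\<close> and \<open>bip_right\<close> taken together:
  \<open>l div b\<close> and \<open>k div b'\<close> are the indices of Alice's two systems,
  \<open>l mod b\<close> and \<open>k mod b'\<close> those of Bob's.\<close>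

definition bip_join :: "nat \<Rightarrow> nat \<Rightarrow> nat \<Rightarrow> nat \<Rightarrow> nat \<Rightarrow> nat" where
  "bip_join b a' b' l k = (l div b * a' + k div b') * (b * b') + (l mod b * b' + k mod b')"

lemma bip_split:
  assumes r: "r < (a * a') * (b * b')"
  shows "bip_left b a' b' r < a * b" "bip_right b a' b' r < a' * b'"
    and "bip_left b a' b' r div b = r div (b * b') div a'"
    and "bip_left b a' b' r mod b = r mod (b * b') div b'"
    and "bip_right b a' b' r div b' = r div (b * b') mod a'"
    and "bip_right b a' b' r mod b' = r mod (b * b') mod b'"
    and "bip_join b a' b' (bip_left b a' b' r) (bip_right b a' b' r) = r"
proof -
  have 1: "r div (b * b') < a * a'" "r mod (b * b') < b * b'" using div_mod_less[OF r] by auto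
  then have 2: "r div (b * b') div a' < a" "r div (b * b') mod a' < a'"
    "r mod (b * b') div b' < b" "r mod (b * b') mod b' < b'"
    using div_mod_less by blast+
  show "bip_left b a' b' r < a * b" "bip_right b a' b' r < a' * b'"
    unfolding bip_left_def bip_right_def using 2 by (auto intro!: mult_add_less)
  show 3: "bip_left b a' b' r div b = r div (b * b') div a'"
    "bip_left b a' b' r mod b = r mod (b * b') div b'"
    "bip_right b a' b' r div b' = r div (b * b') mod a'"
    "bip_right b a' b' r mod b' = r mod (b * b') mod b'"
    using 2 by (auto simp: bip_left_def bip_right_def)
  show "bip_join b a' b' (bip_left b a' b' r) (bip_right b a' b' r) = r"
    unfolding bip_join_def 3 by (simp only: div_mult_mod_eq)
qed

lemma bip_join:
  assumes l: "l < a * b" and k: "k < a' * b'"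
  shows "bip_join b a' b' l k < (a * a') * (b * b')"
    and "bip_left b a' b' (bip_join b a' b' l k) = l"
    and "bip_right b a' b' (bip_join b a' b' l k) = k"
proof -
  note 1 = div_mod_less[OF l] div_mod_less[OF k]
  have 2: "l mod b * b' + k mod b' < b * b'" using 1 mult_add_less by blast
  have 3: "l div b * a' + k div b' < a * a'" using 1 mult_add_less by blast
  show "bip_join b a' b' l k < (a * a') * (b * b')"
    unfolding bip_join_def using 2 3 mult_add_less by blast
  have d: "bip_join b a' b' l k div (b * b') = l div b * a' + k div b'"
    "bip_join b a' b' l k mod (b * b') = l mod b * b' + k mod b'"
    unfolding bip_join_def using div_mod_mult_add[OF 2] by blast+
  show "bip_left b a' b' (bip_join b a' b' l k) = l" "bip_right b a' b' (bip_join b a' b' l k) = k"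
    unfolding bip_left_def bip_right_def d using 1 by auto
qed

text \<open>Composite indices correspond bijectively to pairs of indices of the two factors. This is
  what makes products and traces of tensor products factorize.\<close>

lemma sum_bip_split:
  "(\<Sum>r<(a * a') * (b * b'). f (bip_left b a' b' r) (bip_right b a' b' r))
    = (\<Sum>l<a * b. \<Sum>k<a' * b'. f l k)"
  unfolding sum.cartesian_product
  by (rule sum.reindex_bij_witness[of _ "\<lambda>(l, k). bip_join b a' b' l k"
        "\<lambda>r. (bip_left b a' b' r, bip_right b a' b' r)"])
    (auto simp: bip_split bip_join)

section \<open>Algebra, positivity and partial transpose of bipartite tensor products\<close>

lemma bip_tensor_dim [simp]:
  "bip_tensor a b a' b' X Y \<in> carrier_mat ((a * a') * (b * b')) ((a * a') * (b * b'))"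
  "dim_row (bip_tensor a b a' b' X Y) = (a * a') * (b * b')"
  "dim_col (bip_tensor a b a' b' X Y) = (a * a') * (b * b')"
  by (simp_all add: bip_tensor_def Let_def)

lemma bip_tensor_index:
  "r < (a * a') * (b * b') \<Longrightarrow> c < (a * a') * (b * b') \<Longrightarrow>
    bip_tensor a b a' b' X Y $$ (r, c)
    = X $$ (bip_left b a' b' r, bip_left b a' b' c) * Y $$ (bip_right b a' b' r, bip_right b a' b' c)"
  by (simp add: bip_tensor_def Let_def bip_left_def bip_right_def)

context
  fixes a b a' b' :: nat and n n' :: nat
  defines "n \<equiv> a * b" and "n' \<equiv> a' * b'"
begin

lemma bip_tensor_smult:
  "X \<in> carrier_mat n n \<Longrightarrow> Y \<in> carrier_mat n' n' \<Longrightarrow>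
    bip_tensor a b a' b' (c \<cdot>\<^sub>m X) (d \<cdot>\<^sub>m Y) = (c * d) \<cdot>\<^sub>m bip_tensor a b a' b' X Y"
  by (rule eq_matI) (auto simp: bip_tensor_index bip_split n_def n'_def)

lemma bip_tensor_adjoint:
  "X \<in> carrier_mat n n \<Longrightarrow> Y \<in> carrier_mat n' n' \<Longrightarrow>
    mat_adjoint (bip_tensor a b a' b' X Y) = bip_tensor a b a' b' (mat_adjoint X) (mat_adjoint Y)"
  by (rule eq_matI) (auto simp: bip_tensor_index bip_split n_def n'_def)

lemma bip_tensor_mult:
  assumes "X \<in> carrier_mat n n" "X' \<in> carrier_mat n n" "Y \<in> carrier_mat n' n'" "Y' \<in> carrier_mat n' n'"
  shows "bip_tensor a b a' b' X Y * bip_tensor a b a' b' X' Y' = bip_tensor a b a' b' (X * X') (Y * Y')"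
    (is "?M * ?M' = ?R")
proof (rule eq_matI)
  let ?N = "(a * a') * (b * b')"
  let ?L = "bip_left b a' b'" and ?R = "bip_right b a' b'"
  fix r c assume "r < dim_row (bip_tensor a b a' b' (X * X') (Y * Y'))"
    and "c < dim_col (bip_tensor a b a' b' (X * X') (Y * Y'))"
  then have rc: "r < ?N" "c < ?N" by auto
  have "(?M * ?M') $$ (r, c) = (\<Sum>k<?N. ?M $$ (r, k) * ?M' $$ (k, c))"
    using rc by (intro mult_index_sum) auto
  also have "\<dots> = (\<Sum>k<?N. (X $$ (?L r, ?L k) * X' $$ (?L k, ?L c))
      * (Y $$ (?R r, ?R k) * Y' $$ (?R k, ?R c)))"
    using rc by (intro sum.cong) (auto simp: bip_tensor_index)
  also have "\<dots> = (\<Sum>l<a * b. \<Sum>k<a' * b'. (X $$ (?L r, l) * X' $$ (l, ?L c))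
      * (Y $$ (?R r, k) * Y' $$ (k, ?R c)))"
    by (rule sum_bip_split)
  also have "\<dots> = (X * X') $$ (?L r, ?L c) * (Y * Y') $$ (?R r, ?R c)"
    using assms rc bip_split[of r a a' b b'] bip_split[of c a a' b b']
    by (simp add: mult_index_sum[of _ n n _ n] mult_index_sum[of _ n' n' _ n'] sum_product n_def n'_def
        del: index_mult_mat(1))
  finally show "(?M * ?M') $$ (r, c) = bip_tensor a b a' b' (X * X') (Y * Y') $$ (r, c)"
    using rc by (simp add: bip_tensor_index)
qed auto

lemma mtrace_bip_tensor:
  assumes "X \<in> carrier_mat n n" "Y \<in> carrier_mat n' n'"
  shows "mtrace (bip_tensor a b a' b' X Y) = mtrace X * mtrace Y"
proof -
  have "mtrace (bip_tensor a b a' b' X Y) = (\<Sum>r<(a * a') * (b * b').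
      X $$ (bip_left b a' b' r, bip_left b a' b' r) * Y $$ (bip_right b a' b' r, bip_right b a' b' r))"
    by (subst mtrace_eq[OF bip_tensor_dim(1)]) (auto simp: bip_tensor_index)
  also have "\<dots> = (\<Sum>l<a * b. \<Sum>k<a' * b'. X $$ (l, l) * Y $$ (k, k))"
    by (rule sum_bip_split)
  also have "\<dots> = mtrace X * mtrace Y"
    using assms by (simp add: mtrace_eq sum_product n_def n'_def)
  finally show ?thesis .
qed

lemma bip_tensor_one: "bip_tensor a b a' b' (1\<^sub>m n) (1\<^sub>m n') = 1\<^sub>m ((a * a') * (b * b'))"
proof (rule eq_matI)
  fix r c assume "r < dim_row (1\<^sub>m ((a * a') * (b * b')))" "c < dim_col (1\<^sub>m ((a * a') * (b * b')))"
  then have rc: "r < (a * a') * (b * b')" "c < (a * a') * (b * b')" by auto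
  show "bip_tensor a b a' b' (1\<^sub>m n) (1\<^sub>m n') $$ (r, c) = 1\<^sub>m ((a * a') * (b * b')) $$ (r, c)"
    using rc bip_split(7)[OF rc(1)] bip_split(7)[OF rc(2)] bip_split(1,2)[OF rc(1)] bip_split(1,2)[OF rc(2)]
    by (cases "r = c") (auto simp: bip_tensor_index n_def n'_def)
qed auto

lemma bip_tensor_psd:
  assumes "psd n X" "psd n' Y" shows "psd ((a * a') * (b * b')) (bip_tensor a b a' b' X Y)"
proof -
  obtain C where C: "C \<in> carrier_mat n n" "X = mat_adjoint C * C" using psd_factor[OF assms(1)] .
  obtain D where D: "D \<in> carrier_mat n' n'" "Y = mat_adjoint D * D" using psd_factor[OF assms(2)] .
  have "bip_tensor a b a' b' X Y = mat_adjoint (bip_tensor a b a' b' C D) * bip_tensor a b a' b' C D"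
    using C D by (simp add: bip_tensor_adjoint bip_tensor_mult)
  then show ?thesis using psd_adjoint_mult[OF bip_tensor_dim(1)] by simp
qed

text \<open>Exchanging the joint Bob index of row and column exchanges the Bob index of each of the
  two factors.\<close>

lemma ptrans_bip_tensor:
  "ptrans (a * a') (b * b') (bip_tensor a b a' b' X Y)
    = bip_tensor a b a' b' (ptrans a b X) (ptrans a' b' Y)"
proof (rule eq_matI)
  let ?N = "(a * a') * (b * b')"
  fix r c assume "r < dim_row (bip_tensor a b a' b' (ptrans a b X) (ptrans a' b' Y))"
    and "c < dim_col (bip_tensor a b a' b' (ptrans a b X) (ptrans a' b' Y))"
  then have rc: "r < ?N" "c < ?N" by auto
  \<comment> \<open>Alice's part of \<open>u\<close> joined with Bob's part of \<open>v\<close>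
    splits into the same combination in each of the two factors.\<close>
  have swap: "bip_left b a' b' (u div (b * b') * (b * b') + v mod (b * b'))
      = bip_left b a' b' u div b * b + bip_left b a' b' v mod b"
    "bip_right b a' b' (u div (b * b') * (b * b') + v mod (b * b'))
      = bip_right b a' b' u div b' * b' + bip_right b a' b' v mod b'"
    if "u < ?N" "v < ?N" for u v
  proof -
    have "v mod (b * b') < b * b'" using div_mod_less[OF that(2)] by simp
    then have "(u div (b * b') * (b * b') + v mod (b * b')) div (b * b') = u div (b * b')"
      "(u div (b * b') * (b * b') + v mod (b * b')) mod (b * b') = v mod (b * b')"
      using div_mod_mult_add by blast+
    then show "bip_left b a' b' (u div (b * b') * (b * b') + v mod (b * b'))
        = bip_left b a' b' u div b * b + bip_left b a' b' v mod b"
      "bip_right b a' b' (u div (b * b') * (b * b') + v mod (b * b'))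
        = bip_right b a' b' u div b' * b' + bip_right b a' b' v mod b'"
      using bip_split(3-6)[OF that(1)] bip_split(3-6)[OF that(2)]
      by (simp_all only: bip_left_def[of b a' b' "u div (b * b') * (b * b') + v mod (b * b')"]
          bip_right_def[of b a' b' "u div (b * b') * (b * b') + v mod (b * b')"])
  qed
  show "ptrans (a * a') (b * b') (bip_tensor a b a' b' X Y) $$ (r, c)
      = bip_tensor a b a' b' (ptrans a b X) (ptrans a' b' Y) $$ (r, c)"
    using rc pt_index_less[OF rc] pt_index_less[OF rc(2,1)]
    by (simp only: ptrans_index bip_tensor_index swap bip_split(1,2))
qed auto

end

text \<open>The relation -Y \<le> X \<le> Y, written as two positive matrices. It expresses the
  constraint in \<open>E_eta\<close> and, when \<open>Y\<close> is a multiple of the identity, a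
  bound on the operator norm of a Hermitian \<open>X\<close>.\<close>

definition sandwich :: "nat \<Rightarrow> complex mat \<Rightarrow> complex mat \<Rightarrow> bool" where
  "sandwich n X Y \<longleftrightarrow> X \<in> carrier_mat n n \<and> Y \<in> carrier_mat n n \<and> psd n (Y - X) \<and> psd n (Y + X)"

text \<open>Half of (Y - X) \<otimes> (Y' + X') + (Y + X) \<otimes> (Y' - X') equals Y \<otimes> Y'
  - X \<otimes> X', and half of (Y - X) \<otimes> (Y' - X') + (Y + X) \<otimes> (Y' + X') equals Y
  \<otimes> Y' + X \<otimes> X'. Each summand is a tensor product of positive matrices.\<close>

lemma bip_tensor_sandwich:
  assumes "sandwich (a * b) X Y" "sandwich (a' * b') X' Y'"
  shows "sandwich ((a * a') * (b * b')) (bip_tensor a b a' b' X X') (bip_tensor a b a' b' Y Y')"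
proof -
  let ?T = "bip_tensor a b a' b'" and ?N = "(a * a') * (b * b')"
  note c = assms[unfolded sandwich_def]
  have h: "0 \<le> (1/2 :: complex)" by (simp add: less_eq_complex_def)
  have "psd ?N ((1/2) \<cdot>\<^sub>m (?T (Y - X) (Y' + X') + ?T (Y + X) (Y' - X')))"
    "psd ?N ((1/2) \<cdot>\<^sub>m (?T (Y - X) (Y' - X') + ?T (Y + X) (Y' + X')))"
    using c by (auto intro!: psd_smult[OF _ h] psd_add bip_tensor_psd)
  moreover have half: "(1/2) * ((y - x) * (y' + x') + (y + x) * (y' - x')) = y * y' - x * x'"
    "(1/2) * ((y - x) * (y' - x') + (y + x) * (y' + x')) = y * y' + x * x'" for x y x' y' :: complex
    by (simp_all add: field_simps)
  have "(1/2) \<cdot>\<^sub>m (?T (Y - X) (Y' + X') + ?T (Y + X) (Y' - X')) = ?T Y Y' - ?T X X'"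
    using c half(1) by (intro eq_matI) (auto simp: bip_tensor_index bip_split)
  moreover have "(1/2) \<cdot>\<^sub>m (?T (Y - X) (Y' - X') + ?T (Y + X) (Y' + X')) = ?T Y Y' + ?T X X'"
    using c half(2) by (intro eq_matI) (auto simp: bip_tensor_index bip_split)
  ultimately show ?thesis by (simp add: sandwich_def)
qed

section \<open>Tensor powers\<close>

lemma tensor_pow_carrier [simp]: "tensor_pow a b X n \<in> carrier_mat (a ^ n * b ^ n) (a ^ n * b ^ n)"
  using bip_tensor_dim(1)[of "a ^ (n - 1)" "b ^ (n - 1)" a b]
  by (cases n) (auto simp: mult.commute)

text \<open>The property takes the two local dimensions as arguments, since every further factor
  multiplies them by \<open>a\<close> and \<open>b\<close>.\<close>

lemma tensor_pow_rule:
  assumes "X \<in> carrier_mat (a * b) (a * b)" and "P 1 1 (1\<^sub>m 1)"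
    and "\<And>c d M. M \<in> carrier_mat (c * d) (c * d) \<Longrightarrow> P c d M \<Longrightarrow> P (c * a) (d * b) (bip_tensor c d a b M X)"
  shows "P (a ^ n) (b ^ n) (tensor_pow a b X n)"
proof (induction n)
  case (Suc n)
  then show ?case using assms(3)[OF tensor_pow_carrier Suc] by (simp add: mult.commute)
qed (use assms in simp)

lemma tensor_pow_psd: "psd (a * b) X \<Longrightarrow> psd (a ^ n * b ^ n) (tensor_pow a b X n)"
  by (rule tensor_pow_rule[where P = "\<lambda>a b X. psd (a * b) X"]) (auto simp: psd_carrier intro: bip_tensor_psd)

lemma mtrace_tensor_pow:
  assumes "X \<in> carrier_mat (a * b) (a * b)" shows "mtrace (tensor_pow a b X n) = mtrace X ^ n"
  by (induction n) (use assms in \<open>auto simp: mtrace_bip_tensor\<close>)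

lemma tensor_pow_adjoint:
  assumes "X \<in> carrier_mat (a * b) (a * b)"
  shows "mat_adjoint (tensor_pow a b X n) = tensor_pow a b (mat_adjoint X) n"
  by (induction n) (use assms in \<open>auto simp: bip_tensor_adjoint\<close>)

lemma tensor_pow_mult:
  assumes "X \<in> carrier_mat (a * b) (a * b)" "Y \<in> carrier_mat (a * b) (a * b)"
  shows "tensor_pow a b X n * tensor_pow a b Y n = tensor_pow a b (X * Y) n"
  by (induction n) (use assms in \<open>auto simp: bip_tensor_mult\<close>)

lemma ptrans_tensor_pow:
  "ptrans (a ^ n) (b ^ n) (tensor_pow a b X n) = tensor_pow a b (ptrans a b X) n"
proof (induction n)
  case 0
  show ?case using ptrans_one[of 1 1] by simp
next
  case (Suc n)
  then show ?case using ptrans_bip_tensor[of "a ^ n" a "b ^ n" b] by (simp add: mult.commute)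
qed

lemma tensor_pow_sandwich:
  assumes "sandwich (a * b) X Y"
  shows "sandwich (a ^ n * b ^ n) (tensor_pow a b X n) (tensor_pow a b Y n)"
proof (induction n)
  case 0
  have "1\<^sub>m 1 - 1\<^sub>m 1 = (0\<^sub>m 1 1 :: complex mat)" by (intro eq_matI) auto
  then have "psd 1 (1\<^sub>m 1 - 1\<^sub>m 1)" by (simp only: psd_zero)
  then show ?case by (auto simp: sandwich_def intro: psd_add)
next
  case (Suc n)
  then show ?case using bip_tensor_sandwich[OF Suc assms] by (simp add: mult.commute)
qed

lemma tensor_pow_smult_one:
  "tensor_pow a b (c \<cdot>\<^sub>m 1\<^sub>m (a * b)) n = c ^ n \<cdot>\<^sub>m 1\<^sub>m (a ^ n * b ^ n)"
proof (induction n)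
  case 0
  show ?case by (intro eq_matI) auto
next
  case (Suc n)
  then show ?case using bip_tensor_one[of "a ^ n" "b ^ n" a b]
    by (simp add: bip_tensor_smult mult.commute)
qed

section \<open>Support projections and norms\<close>

lemma supp_mult_subset:
  assumes "A \<in> carrier_mat n m" "B \<in> carrier_mat m k" shows "supp (A * B) \<subseteq> supp A"
proof
  fix w assume "w \<in> supp (A * B)"
  then obtain v where v: "v \<in> carrier_vec k" "w = (A * B) *\<^sub>v v" using assms by (auto simp: supp_def)
  then have "w = A *\<^sub>v (B *\<^sub>v v)" "B *\<^sub>v v \<in> carrier_vec m"
    using assms assoc_mult_mat_vec[OF assms v(1)] mult_mat_vec_carrier[OF assms(2) v(1)] by auto
  then show "w \<in> supp A" using assms by (auto simp: supp_def)
qed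

text \<open>An idempotent matrix fixes its range pointwise, and the columns of \<open>Q\<close> lie
  in that range as images of unit vectors.\<close>

lemma idempotent_mult_absorb:
  assumes "P \<in> carrier_mat n n" "P * P = P" "Q \<in> carrier_mat n n" "supp Q \<subseteq> supp P"
  shows "P * Q = Q"
proof (rule mat_col_eqI)
  fix j assume "j < dim_col Q"
  then have j: "j < n" using assms by simp
  have "Q *\<^sub>v unit_vec n j = col Q j" using assms(3) j by (intro eq_vecI) auto
  then have "col Q j \<in> supp Q" using assms(3) by (auto simp: supp_def intro!: rev_image_eqI[of "unit_vec n j"])
  then have "col Q j \<in> supp P" using assms(4) by auto
  then obtain v where v: "v \<in> carrier_vec n" "col Q j = P *\<^sub>v v" using assms(1) by (auto simp: supp_def)
  have "col (P * Q) j = P *\<^sub>v (P *\<^sub>v v)" unfolding col_mult2[OF assms(1,3) j] v(2) ..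
  also have "\<dots> = col Q j" using assoc_mult_mat_vec[OF assms(1,1) v(1)] assms(2) v(2) by simp
  finally show "col (P * Q) j = col Q j" .
qed (use assms in auto)

definition projection :: "nat \<Rightarrow> complex mat \<Rightarrow> bool" where
  "projection n P \<longleftrightarrow> P \<in> carrier_mat n n \<and> hermitian P \<and> P * P = P"

lemma projection_psd:
  assumes "projection n P" shows "psd n P" "psd n (1\<^sub>m n - P)"
proof -
  have P: "P \<in> carrier_mat n n" "mat_adjoint P = P" "P * P = P"
    using assms by (auto simp: projection_def hermitian_def)
  show "psd n P" using psd_adjoint_mult[OF P(1)] P by simp
  have "mat_adjoint (1\<^sub>m n - P) = 1\<^sub>m n - P"
  proof (rule eq_matI)
    fix i j assume "i < dim_row (1\<^sub>m n - P)" "j < dim_col (1\<^sub>m n - P)"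
    then have ij: "i < n" "j < n" using P(1) by auto
    have "cnj (P $$ (j, i)) = P $$ (i, j)"
      using hermitian_index[OF _ P(1) ij(2,1)] P(2) by (simp add: hermitian_def)
    then show "mat_adjoint (1\<^sub>m n - P) $$ (i, j) = (1\<^sub>m n - P) $$ (i, j)" using ij P(1) by simp
  qed (use P in auto)
  moreover have "(1\<^sub>m n - P) * (1\<^sub>m n - P) = 1\<^sub>m n - P"
  proof -
    have "(1\<^sub>m n - P) * (1\<^sub>m n - P) = 1\<^sub>m n * (1\<^sub>m n - P) - P * (1\<^sub>m n - P)"
      using P(1) by (intro minus_mult_distrib_mat[of _ n n _ _ n]) auto
    also have "P * (1\<^sub>m n - P) = P * 1\<^sub>m n - P * P"
      using P(1) by (intro mult_minus_distrib_mat[of _ n n _ n]) auto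
    also have "1\<^sub>m n * (1\<^sub>m n - P) - (P * 1\<^sub>m n - P * P) = 1\<^sub>m n - P"
      using P by (intro eq_matI) auto
    finally show ?thesis .
  qed
  ultimately show "psd n (1\<^sub>m n - P)"
    using psd_adjoint_mult[OF minus_carrier_mat[OF P(1)], of "1\<^sub>m n"] by simp
qed

text \<open>The definite description in \<open>supp_proj\<close> is evaluated by exhibiting the
  spectral projection onto the nonzero eigenvalues and showing that a projection is determined by
  its range.\<close>

lemma supp_proj_unitary_conj:
  fixes d :: "nat \<Rightarrow> real"
  assumes U: "unitary n U" and A: "A = U * mat_diag n (\<lambda>i. complex_of_real (d i)) * mat_adjoint U"
  defines "P \<equiv> U * mat_diag n (\<lambda>i. complex_of_real (of_bool (d i \<noteq> 0))) * mat_adjoint U"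
  shows "supp_proj A = P" "projection n P" "supp P = supp A"
proof -
  have Ac: "A \<in> carrier_mat n n" unfolding A by (rule unitary_conj_carrier[OF U])
  have Pc: "P \<in> carrier_mat n n" unfolding P_def by (rule unitary_conj_carrier[OF U])
  have PP: "P * P = P"
  proof -
    have "complex_of_real (of_bool (d i \<noteq> 0)) * complex_of_real (of_bool (d i \<noteq> 0))
        = complex_of_real (of_bool (d i \<noteq> 0))" for i
      by simp
    then show ?thesis unfolding P_def unitary_conj_mult[OF U] by (simp only:)
  qed
  have Ph: "hermitian P" unfolding P_def hermitian_def by (rule unitary_conj_adjoint[OF U])
  show proj: "projection n P" using Pc PP Ph by (simp add: projection_def)
  \<comment> \<open>Since \<open>1 / 0 = 0\<close>, this is the pseudoinverse of \<open>A\<close>.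
    From \<open>A * ?R = P\<close> and \<open>P * A = A\<close> each of the two ranges contains the
    other.\<close>
  let ?R = "U * mat_diag n (\<lambda>i. complex_of_real (1 / d i)) * mat_adjoint U"
  have R: "?R \<in> carrier_mat n n" by (rule unitary_conj_carrier[OF U])
  have "A * ?R = P"
  proof -
    have "complex_of_real (d i) * complex_of_real (1 / d i) = complex_of_real (of_bool (d i \<noteq> 0))" for i
      by simp
    then show ?thesis unfolding A P_def unitary_conj_mult[OF U] by (simp only:)
  qed
  moreover have "P * A = A"
  proof -
    have "complex_of_real (of_bool (d i \<noteq> 0)) * complex_of_real (d i) = complex_of_real (d i)" for i
      by simp
    then show ?thesis unfolding A P_def unitary_conj_mult[OF U] by (simp only:)
  qed
  ultimately show supp: "supp P = supp A"
    using supp_mult_subset[OF Ac R] supp_mult_subset[OF Pc Ac] by auto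
  show "supp_proj A = P"
    unfolding supp_proj_def
  proof (rule the_equality)
    show "P \<in> carrier_mat (dim_row A) (dim_row A) \<and> hermitian P \<and> P * P = P \<and> supp P = supp A"
      using Ac Pc PP Ph supp by simp
  next
    fix Q assume "Q \<in> carrier_mat (dim_row A) (dim_row A) \<and> hermitian Q \<and> Q * Q = Q \<and> supp Q = supp A"
    then have Q: "Q \<in> carrier_mat n n" "mat_adjoint Q = Q" "Q * Q = Q" "supp Q = supp P"
      using Ac supp by (auto simp: hermitian_def)
    \<comment> \<open>Equal ranges give both \<open>P * Q = Q\<close> and \<open>Q * P = P\<close>,
      and taking adjoints turns the first product into the second.\<close>
    have "Q = mat_adjoint (P * Q)"
      using idempotent_mult_absorb[OF Pc PP Q(1)] Q by simp
    also have "\<dots> = Q * P"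
      using mat_adjoint_mult[OF Pc Q(1)] Q(2) Ph by (simp add: hermitian_def)
    also have "\<dots> = P" using idempotent_mult_absorb[OF Q(1,3) Pc] Q(4) by simp
    finally show "Q = P" .
  qed
qed

lemma supp_proj_psd:
  assumes "psd n A"
  shows "projection n (supp_proj A)" "supp (supp_proj A) = supp A" "supp_proj A * A = A"
proof -
  obtain U and d :: "nat \<Rightarrow> real" where U: "unitary n U"
    and A: "A = U * mat_diag n (\<lambda>i. complex_of_real (d i)) * mat_adjoint U"
    using psd_spectral[OF assms] by blast
  note * = supp_proj_unitary_conj[OF U A]
  show P: "projection n (supp_proj A)" "supp (supp_proj A) = supp A"
    unfolding *(1) by (fact *(2), fact *(3))
  then show "supp_proj A * A = A"
    using psd_carrier[OF assms] by (subst idempotent_mult_absorb[of _ n]) (auto simp: projection_def)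
qed

section \<open>Trace norm, operator norm and the overlap estimate\<close>

lemma trace_norm_nonneg:
  assumes "A \<in> carrier_mat n m" shows "0 \<le> trace_norm A"
proof -
  obtain U and d :: "nat \<Rightarrow> real" where U: "unitary m U" and d: "\<forall>i<m. 0 \<le> d i"
    and A: "mat_adjoint A * A = U * mat_diag m (\<lambda>i. complex_of_real (d i)) * mat_adjoint U"
    using psd_spectral[OF psd_adjoint_mult[OF assms]] by blast
  show ?thesis
    unfolding trace_norm_def A spec_fun_unitary_conj[OF U] unitary_conj_mtrace[OF U]
    using d by (auto intro: sum_nonneg)
qed

lemma mtrace_mult_minus_left:
  "A \<in> carrier_mat n n \<Longrightarrow> B \<in> carrier_mat n n \<Longrightarrow> C \<in> carrier_mat n n \<Longrightarrow>
    mtrace ((A - B) * C) = mtrace (A * C) - mtrace (B * C)"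
  by (subst minus_mult_distrib_mat[of _ n n _ _ n]) (auto intro!: mtrace_minus[of _ n])

lemma mtrace_mult_minus_right:
  "A \<in> carrier_mat n n \<Longrightarrow> B \<in> carrier_mat n n \<Longrightarrow> C \<in> carrier_mat n n \<Longrightarrow>
    mtrace (A * (B - C)) = mtrace (A * B) - mtrace (A * C)"
  by (subst mult_minus_distrib_mat[of _ n n _ n]) (auto intro!: mtrace_minus[of _ n])

lemma mtrace_mult_add_left:
  "A \<in> carrier_mat n n \<Longrightarrow> B \<in> carrier_mat n n \<Longrightarrow> C \<in> carrier_mat n n \<Longrightarrow>
    mtrace ((A + B) * C) = mtrace (A * C) + mtrace (B * C)"
  by (subst add_mult_distrib_mat[of _ n n _ _ n]) (auto intro!: mtrace_add[of _ n])

lemma mtrace_mult_add_right: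
  "A \<in> carrier_mat n n \<Longrightarrow> B \<in> carrier_mat n n \<Longrightarrow> C \<in> carrier_mat n n \<Longrightarrow>
    mtrace (A * (B + C)) = mtrace (A * B) + mtrace (A * C)"
  by (subst mult_add_distrib_mat[of _ n n _ n]) (auto intro!: mtrace_add[of _ n])

text \<open>With \<open>B\<close> the absolute value of \<open>A\<close>, the bounds A \<le> B and P
  \<le> 1 give Tr P A \<le> Tr P B \<le> Tr B, and Tr B is the trace norm.\<close>

lemma mtrace_projection_le_trace_norm:
  assumes A: "A \<in> carrier_mat n n" "hermitian A" and P: "projection n P"
  shows "Re (mtrace (P * A)) \<le> trace_norm A"
proof -
  obtain U and d :: "nat \<Rightarrow> real" where U: "unitary n U"
    and AU: "A = U * mat_diag n (\<lambda>i. complex_of_real (d i)) * mat_adjoint U"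
    using hermitian_spectral[OF A] by blast
  define B where "B = U * mat_diag n (\<lambda>i. complex_of_real \<bar>d i\<bar>) * mat_adjoint U"
  have B: "psd n B" unfolding B_def by (rule unitary_conj_psd[OF U]) simp
  have Bc: "B \<in> carrier_mat n n" using B by (rule psd_carrier)
  have BA: "psd n (B - A)"
    unfolding B_def AU unitary_conj_linear[OF U] of_real_diff[symmetric]
    by (rule unitary_conj_psd[OF U]) simp
  have "mat_adjoint A * A = U * mat_diag n (\<lambda>i. complex_of_real (d i * d i)) * mat_adjoint U"
    unfolding AU unitary_conj_adjoint[OF U] unitary_conj_mult[OF U] by simp
  then have norm: "trace_norm A = Re (mtrace B)"
    unfolding trace_norm_def B_def by (simp only: spec_fun_unitary_conj[OF U] real_sqrt_abs2)
  note Pc = psd_carrier[OF projection_psd(1)[OF P]]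
  have "0 \<le> mtrace (P * (B - A))" "0 \<le> mtrace ((1\<^sub>m n - P) * B)"
    using psd_mtrace_mult_nonneg projection_psd[OF P] B BA by auto
  then have "0 \<le> mtrace (P * B) - mtrace (P * A)" "0 \<le> mtrace B - mtrace (P * B)"
    using A(1) Bc Pc by (simp_all add: mtrace_mult_minus_left[of _ n] mtrace_mult_minus_right[of _ n])
  then show ?thesis by (simp add: norm less_eq_complex_def)
qed

lemma vnorm_smult: "v \<in> carrier_vec n \<Longrightarrow> vnorm (complex_of_real c \<cdot>\<^sub>v v) = \<bar>c\<bar> * vnorm v"
proof -
  assume v: "v \<in> carrier_vec n"
  have "(complex_of_real c \<cdot>\<^sub>v v) \<bullet>c (complex_of_real c \<cdot>\<^sub>v v) = complex_of_real (c * c) * (v \<bullet>c v)"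
    using v by (simp add: cscalar_prod_eq[of _ n] sum_distrib_left ac_simps)
  then have "Re ((complex_of_real c \<cdot>\<^sub>v v) \<bullet>c (complex_of_real c \<cdot>\<^sub>v v)) = (c * c) * Re (v \<bullet>c v)"
    by (simp only: Re_complex_of_real times_complex.sel Im_complex_of_real mult_zero_left diff_zero)
  then show ?thesis by (simp only: vnorm_def real_sqrt_mult[of "c * c"] real_sqrt_abs2)
qed

text \<open>\<open>op_norm\<close> is a supremum of reals, and comparing it with a single member of
  the set requires the set to be bounded.\<close>

lemma bdd_above_op_norm:
  assumes A: "A \<in> carrier_mat n n" "hermitian A"
  shows "bdd_above ((\<lambda>v. vnorm (A *\<^sub>v v)) ` {v \<in> carrier_vec (dim_col A). vnorm v \<le> 1})"
proof -
  obtain U and d :: "nat \<Rightarrow> real" where U: "unitary n U"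
    and AU: "A = U * mat_diag n (\<lambda>i. complex_of_real (d i)) * mat_adjoint U"
    using hermitian_spectral[OF A] by blast
  \<comment> \<open>Any bound on the squared eigenvalues serves; their sum avoids a maximum over a
    possibly empty index range.\<close>
  define M where "M = (\<Sum>i<n. d i * d i)"
  have M: "0 \<le> M" by (auto simp: M_def intro: sum_nonneg)
  have "d i * d i \<le> M" if "i < n" for i
    unfolding M_def using that by (intro member_le_sum) auto
  then have "psd n (U * mat_diag n (\<lambda>i. complex_of_real (M - d i * d i)) * mat_adjoint U)"
    by (intro unitary_conj_psd[OF U]) simp
  moreover have "mat_adjoint A * A = U * mat_diag n (\<lambda>i. complex_of_real (d i * d i)) * mat_adjoint U"
    unfolding AU unitary_conj_adjoint[OF U] unitary_conj_mult[OF U] by simp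
  ultimately have le: "psd n (complex_of_real M \<cdot>\<^sub>m 1\<^sub>m n - mat_adjoint A * A)"
    by (simp add: unitary_conj_linear[OF U] flip: unitary_conj_smult_one[OF U])
  have "vnorm (A *\<^sub>v v) \<le> sqrt M" if v: "v \<in> carrier_vec n" "vnorm v \<le> 1" for v
  proof -
    have Av: "A *\<^sub>v v \<in> carrier_vec n" using A(1) v(1) by (rule mult_mat_vec_carrier)
    have "(complex_of_real M \<cdot>\<^sub>m 1\<^sub>m n - mat_adjoint A * A) *\<^sub>v v
        = complex_of_real M \<cdot>\<^sub>v v - mat_adjoint A *\<^sub>v (A *\<^sub>v v)"
    proof -
      have "(complex_of_real M \<cdot>\<^sub>m 1\<^sub>m n - mat_adjoint A * A) *\<^sub>v v
          = (complex_of_real M \<cdot>\<^sub>m 1\<^sub>m n) *\<^sub>v v - (mat_adjoint A * A) *\<^sub>v v"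
        using A(1) v(1) by (intro minus_mult_distrib_mat_vec[of _ n n]) auto
      also have "(complex_of_real M \<cdot>\<^sub>m 1\<^sub>m n) *\<^sub>v v = complex_of_real M \<cdot>\<^sub>v v"
        using v(1) by (intro eq_vecI) auto
      also have "(mat_adjoint A * A) *\<^sub>v v = mat_adjoint A *\<^sub>v (A *\<^sub>v v)"
        using A(1) v(1) by (intro assoc_mult_mat_vec[of _ n n _ n]) auto
      finally show ?thesis .
    qed
    then have "((complex_of_real M \<cdot>\<^sub>m 1\<^sub>m n - mat_adjoint A * A) *\<^sub>v v) \<bullet>c v
        = complex_of_real M * (v \<bullet>c v) - (mat_adjoint A *\<^sub>v (A *\<^sub>v v)) \<bullet>c v"
      using A(1) v(1) Av mult_mat_vec_carrier[OF mat_adjoint_carrier[OF A(1)] Av]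
      by (simp add: minus_scalar_prod_distrib[of _ n])
    also have "(mat_adjoint A *\<^sub>v (A *\<^sub>v v)) \<bullet>c v = (A *\<^sub>v v) \<bullet>c (A *\<^sub>v v)"
      using cscalar_prod_adjoint[OF mat_adjoint_carrier[OF A(1)] Av v(1)] by simp
    finally have "Re ((A *\<^sub>v v) \<bullet>c (A *\<^sub>v v)) \<le> M * Re (v \<bullet>c v)"
      using le v(1) by (auto simp: psd_def less_eq_complex_def dest!: bspec[of _ _ v])
    also have "\<dots> \<le> M"
      using v(2) M by (simp add: vnorm_def mult_left_le)
    finally show ?thesis by (simp add: vnorm_def)
  qed
  then show ?thesis using A(1) by (intro bdd_aboveI2[of _ _ "sqrt M"]) auto
qed

text \<open>The columns of \<open>U\<close> are unit eigenvectors, so each \<open>|d i|\<close>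
  occurs among the values under the supremum.\<close>

lemma sandwich_op_norm:
  assumes A: "A \<in> carrier_mat n n" "hermitian A"
  shows "sandwich n A (complex_of_real (op_norm A) \<cdot>\<^sub>m 1\<^sub>m n)"
proof -
  obtain U and d :: "nat \<Rightarrow> real" where U: "unitary n U"
    and AU: "A = U * mat_diag n (\<lambda>i. complex_of_real (d i)) * mat_adjoint U"
    using hermitian_spectral[OF A] by blast
  note Uc = unitaryD[OF U]
  have d: "\<bar>d i\<bar> \<le> op_norm A" if i: "i < n" for i
  proof -
    have u: "col U i \<in> carrier_vec n" using Uc(1) i by auto
    have "(mat_adjoint U * U) $$ (i, i) = (\<Sum>k<n. U $$ (k, i) * cnj (U $$ (k, i)))"
      using Uc(1) i by (subst mult_index_sum[of _ n n _ n]) (auto simp: mult.commute)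
    also have "\<dots> = col U i \<bullet>c col U i"
      using Uc(1) i by (subst cscalar_prod_eq[of _ n]) auto
    finally have norm: "vnorm (col U i) = 1" using Uc(2) i by (simp add: vnorm_def)
    have "A * U = U * mat_diag n (\<lambda>i. complex_of_real (d i))"
      using Uc by (simp add: AU square_mat[where n = n])
    then have "A *\<^sub>v col U i = col (U * mat_diag n (\<lambda>i. complex_of_real (d i))) i"
      using A(1) Uc(1) i by (metis carrier_matD(2) col_mult2)
    also have "\<dots> = complex_of_real (d i) \<cdot>\<^sub>v col U i"
      using Uc(1) i by (intro eq_vecI) (auto simp: mat_diag_mult_right[OF Uc(1)])
    finally have "vnorm (A *\<^sub>v col U i) = \<bar>d i\<bar>" using vnorm_smult[OF u] norm by simp
    moreover have "vnorm (A *\<^sub>v col U i) \<le> op_norm A"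
      unfolding op_norm_def using A(1) u norm
      by (intro cSUP_upper[OF _ bdd_above_op_norm[OF A]]) auto
    ultimately show ?thesis by simp
  qed
  have "psd n (U * mat_diag n (\<lambda>i. complex_of_real (op_norm A - d i)) * mat_adjoint U)"
    "psd n (U * mat_diag n (\<lambda>i. complex_of_real (op_norm A + d i)) * mat_adjoint U)"
    using d by (force intro!: unitary_conj_psd[OF U])+
  then show ?thesis
    using A(1) AU unitary_conj_carrier[OF U]
    by (simp add: sandwich_def unitary_conj_linear[OF U] flip: unitary_conj_smult_one[OF U])
qed

text \<open>
  The two sandwiches combine to \<open>Tr (Y - P\<^sup>T) (Z + \<sigma>\<^sup>T) + Tr (Y + P\<^sup>T) (Z - \<sigma>\<^sup>T) \<ge> 0\<close>, in which
  the mixed terms cancel.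
\<close>

lemma overlap_bound:
  assumes P: "P \<in> carrier_mat (a * b) (a * b)" and \<sigma>: "\<sigma> \<in> carrier_mat (a * b) (a * b)"
    and PY: "sandwich (a * b) (ptrans a b P) Y"
    and Y: "sandwich (a * b) (ptrans a b Y) (complex_of_real y \<cdot>\<^sub>m 1\<^sub>m (a * b))"
    and \<sigma>Z: "sandwich (a * b) (ptrans a b \<sigma>) Z" and Z: "psd (a * b) (ptrans a b Z)"
  shows "Re (mtrace (P * \<sigma>)) \<le> y * Re (mtrace Z)"
proof -
  define n where "n = a * b"
  define Q S where "Q = ptrans a b P" and "S = ptrans a b \<sigma>"
  have c: "Q \<in> carrier_mat n n" "S \<in> carrier_mat n n" "Y \<in> carrier_mat n n" "Z \<in> carrier_mat n n"
    using PY \<sigma>Z by (auto simp: sandwich_def n_def Q_def S_def)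
  have "0 \<le> mtrace ((Y - Q) * (Z + S)) + mtrace ((Y + Q) * (Z - S))"
    using PY \<sigma>Z by (auto simp: sandwich_def n_def Q_def S_def intro!: add_nonneg_nonneg psd_mtrace_mult_nonneg)
  also have "\<dots> = 2 * (mtrace (Y * Z) - mtrace (Q * S))"
    using c by (simp add: mtrace_mult_minus_left[of _ n] mtrace_mult_minus_right[of _ n]
        mtrace_mult_add_left[of _ n] mtrace_mult_add_right[of _ n])
  finally have "Re (mtrace (Q * S)) \<le> Re (mtrace (Y * Z))" by (simp add: less_eq_complex_def)
  moreover have "mtrace (Q * S) = mtrace (P * \<sigma>)"
    using mtrace_ptrans_mult[OF P \<sigma>] by (simp add: Q_def S_def)
  moreover have "Re (mtrace (Y * Z)) \<le> y * Re (mtrace Z)"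
  proof -
    have "0 \<le> mtrace ((complex_of_real y \<cdot>\<^sub>m 1\<^sub>m (a * b) - ptrans a b Y) * ptrans a b Z)"
      using Y Z by (auto simp: sandwich_def intro!: psd_mtrace_mult_nonneg)
    also have "\<dots> = mtrace ((complex_of_real y \<cdot>\<^sub>m 1\<^sub>m (a * b)) * ptrans a b Z) - mtrace (ptrans a b Y * ptrans a b Z)"
      by (intro mtrace_mult_minus_left[of _ "a * b"]) auto
    also have "(complex_of_real y \<cdot>\<^sub>m 1\<^sub>m (a * b)) * ptrans a b Z = complex_of_real y \<cdot>\<^sub>m ptrans a b Z"
      using mult_smult_assoc_mat[of "1\<^sub>m (a * b)" "a * b" "a * b" "ptrans a b Z" "a * b"]
      by (simp add: left_mult_one_mat[OF ptrans_carrier])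
    also have "mtrace \<dots> = complex_of_real y * mtrace (ptrans a b Z)"
      by (rule mtrace_smult) (rule ptrans_carrier)
    finally show ?thesis
      using mtrace_ptrans_mult[of Y a b Z] mtrace_ptrans[of Z a b] c
      by (simp add: less_eq_complex_def n_def)
  qed
  ultimately show ?thesis by simp
qed

section \<open>A lower bound on the relative entropy\<close>

text \<open>The entry \<open>(i, j)\<close> of \<open>mat_adjoint U * V\<close> is the overlap of an
  eigenvector of the first matrix with one of the second. The trace thereby becomes a classical
  double sum over eigenvalues.\<close>

lemma mtrace_unitary_conj_mult:
  assumes U: "unitary n U" and V: "unitary n V"
  shows "mtrace (U * mat_diag n (\<lambda>i. complex_of_real (f i)) * mat_adjoint U
      * (V * mat_diag n (\<lambda>j. complex_of_real (g j)) * mat_adjoint V))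
    = complex_of_real (\<Sum>i<n. \<Sum>j<n. f i * g j * (cmod ((mat_adjoint U * V) $$ (i, j)))\<^sup>2)"
proof -
  note Uc = unitaryD(1)[OF U] and Vc = unitaryD(1)[OF V]
  define W where "W = mat_adjoint U * V"
  let ?F = "mat_diag n (\<lambda>i. complex_of_real (f i))" and ?G = "mat_diag n (\<lambda>j. complex_of_real (g j))"
  have W: "W \<in> carrier_mat n n" and W': "mat_adjoint W \<in> carrier_mat n n"
    using Uc Vc by (auto simp: W_def)
  have "mtrace (U * ?F * mat_adjoint U * (V * ?G * mat_adjoint V))
      = mtrace (U * (?F * W * (?G * mat_adjoint V)))"
    using Uc Vc by (simp add: W_def square_mat[where n = n])
  also have "\<dots> = mtrace (?F * W * (?G * mat_adjoint V) * U)"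
    using Uc Vc W by (intro mtrace_comm[of _ n n]) (auto simp: square_mat[where n = n])
  also have "?F * W * (?G * mat_adjoint V) * U = (?F * W) * (?G * mat_adjoint W)"
    using Uc Vc by (simp add: W_def square_mat[where n = n])
  also have "mtrace \<dots> = (\<Sum>i<n. \<Sum>j<n. complex_of_real (f i) * W $$ (i, j)
      * (complex_of_real (g j) * cnj (W $$ (i, j))))"
    using W W' by (subst mtrace_mult[of _ n n])
      (auto simp: mat_diag_mult_left[OF W] mat_diag_mult_left[OF W'])
  also have "\<dots> = complex_of_real (\<Sum>i<n. \<Sum>j<n. f i * g j * (cmod (W $$ (i, j)))\<^sup>2)"
    by (simp add: complex_norm_square ac_simps del: of_real_power)
  finally show ?thesis unfolding W_def .
qed

text \<open>The squared overlaps of one eigenvector with an orthonormal eigenbasis of another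
  operator thus form a probability distribution.\<close>

lemma unitary_row_norm:
  assumes "unitary n W" "i < n" shows "(\<Sum>j<n. (cmod (W $$ (i, j)))\<^sup>2) = 1"
proof -
  note W = unitaryD[OF assms(1)]
  have "1 = (W * mat_adjoint W) $$ (i, i)" using W(3) assms(2) by simp
  also have "\<dots> = (\<Sum>j<n. W $$ (i, j) * mat_adjoint W $$ (j, i))"
    using W(1) assms(2) by (intro mult_index_sum) auto
  also have "\<dots> = (\<Sum>j<n. W $$ (i, j) * cnj (W $$ (i, j)))"
    using W(1) assms(2) by (intro sum.cong) auto
  also have "\<dots> = complex_of_real (\<Sum>j<n. (cmod (W $$ (i, j)))\<^sup>2)"
    by (simp add: complex_norm_square del: of_real_power)
  finally show ?thesis by (metis of_real_eq_1_iff)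
qed

text \<open>
  The weights \<open>p i * w i j\<close> form a probability distribution, and concavity of the logarithm is
  applied to the quotients \<open>q j / p i\<close>.
\<close>

lemma gibbs_inequality:
  fixes p q :: "nat \<Rightarrow> real" and w :: "nat \<Rightarrow> nat \<Rightarrow> real"
  assumes p: "\<And>i. i < n \<Longrightarrow> 0 \<le> p i" "(\<Sum>i<n. p i) = 1"
    and q: "\<And>j. j < n \<Longrightarrow> 0 \<le> q j"
    and w: "\<And>i j. 0 \<le> w i j" "\<And>i. i < n \<Longrightarrow> (\<Sum>j<n. w i j) = 1"
    and zero: "\<And>i j. i < n \<Longrightarrow> j < n \<Longrightarrow> 0 < p i \<Longrightarrow> q j = 0 \<Longrightarrow> w i j = 0"
    and T: "(\<Sum>i<n. \<Sum>j<n. of_bool (p i \<noteq> 0) * q j * w i j) \<le> T"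
  shows "0 < T" "(\<Sum>i<n. \<Sum>j<n. p i * log 2 (q j) * w i j) - (\<Sum>i<n. p i * log 2 (p i)) \<le> log 2 T"
proof -
  \<comment> \<open>\<open>T0\<close> is the exact mean of the quotients \<open>q j / p i\<close>.
    The inequality is proved for it, and monotonicity of the logarithm passes to
    \<open>T\<close>.\<close>
  define T0 where "T0 = (\<Sum>i<n. \<Sum>j<n. of_bool (p i \<noteq> 0) * q j * w i j)"
  \<comment> \<open>One positive summand makes \<open>T0\<close> positive: some \<open>p i0\<close>
    and some weight in its row are positive, and then \<open>zero\<close> excludes
    \<open>q j0 = 0\<close>.\<close>
  have "\<not> (\<forall>i<n. p i = 0)" using p(2) by (metis lessThan_iff sum.neutral zero_neq_one)
  then obtain i0 where i0: "i0 < n" "0 < p i0" using p(1) by force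
  have "\<not> (\<forall>j<n. w i0 j = 0)" using w(2)[OF i0(1)] by (metis lessThan_iff sum.neutral zero_neq_one)
  then obtain j0 where j0: "j0 < n" "0 < w i0 j0" using w(1)[of i0] by (metis less_eq_real_def)
  have nonneg: "0 \<le> of_bool (p i \<noteq> 0) * q j * w i j" if "i < n" "j < n" for i j
    using q w(1) that by simp
  have "0 < of_bool (p i0 \<noteq> 0) * q j0 * w i0 j0"
    using i0 j0 zero[OF i0(1) j0(1) i0(2)] q[OF j0(1)] by (auto simp: less_eq_real_def)
  also have "\<dots> \<le> (\<Sum>j<n. of_bool (p i0 \<noteq> 0) * q j * w i0 j)"
    using q w(1) i0 j0 by (intro member_le_sum) auto
  also have "\<dots> \<le> T0"
    unfolding T0_def
    by (rule member_le_sum[of i0 _ "\<lambda>i. \<Sum>j<n. of_bool (p i \<noteq> 0) * q j * w i j"])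
      (use q w(1) i0 in \<open>auto intro!: sum_nonneg\<close>)
  finally have T0: "0 < T0" .
  then show Tpos: "0 < T" using T by (simp add: T0_def)
  \<comment> \<open>When \<open>p i\<close> or \<open>w i j\<close> vanishes, both sides are 0;
    otherwise \<open>zero\<close> makes \<open>q j\<close> positive. The value of \<open>ln\<close>
    at 0 never enters.\<close>
  have gap: "p i * ln (q j) * w i j - p i * ln (p i) * w i j
      \<le> of_bool (p i \<noteq> 0) * q j * w i j / T0 - p i * w i j + p i * ln T0 * w i j"
    if ij: "i < n" "j < n" for i j
  proof (cases "0 < p i \<and> 0 < w i j")
    case True
    then have qj: "0 < q j" using q[OF ij(2)] zero[OF ij] by (cases "q j = 0") auto
    \<comment> \<open>This is the tangent of the logarithm at the mean. After weighting and summing,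
      \<open>T0 / T0\<close> cancels against the total mass 1 and only \<open>ln T0\<close>
      remains.\<close>
    have "ln (q j / p i / T0) \<le> q j / p i / T0 - 1"
      using True qj T0 by (intro ln_le_minus_one) auto
    then have "ln (q j) - ln (p i) \<le> q j / p i / T0 - 1 + ln T0"
      using True qj T0 by (simp add: ln_div ln_mult)
    then have "(p i * w i j) * (ln (q j) - ln (p i)) \<le> (p i * w i j) * (q j / p i / T0 - 1 + ln T0)"
      using True by (intro mult_left_mono) auto
    also have "\<dots> = of_bool (p i \<noteq> 0) * q j * w i j / T0 - p i * w i j + p i * ln T0 * w i j"
      using True T0 by (simp add: field_simps)
    finally show ?thesis by (simp add: algebra_simps)
  next
    case False
    then have "p i = 0 \<or> w i j = 0" using p(1)[OF ij(1)] w(1)[of i j] by auto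
    then show ?thesis by auto
  qed
  have pw: "(\<Sum>j<n. c * w i j) = c" if "i < n" for i c
    using w(2)[OF that] by (simp flip: sum_distrib_left)
  have "(\<Sum>i<n. \<Sum>j<n. p i * ln (q j) * w i j) - (\<Sum>i<n. p i * ln (p i))
      = (\<Sum>i<n. \<Sum>j<n. p i * ln (q j) * w i j - p i * ln (p i) * w i j)"
    by (simp add: sum_subtractf pw)
  also have "\<dots> \<le> (\<Sum>i<n. \<Sum>j<n. of_bool (p i \<noteq> 0) * q j * w i j / T0 - p i * w i j + p i * ln T0 * w i j)"
    using gap by (intro sum_mono) auto
  also have "\<dots> = T0 / T0 - (\<Sum>i<n. p i) + (\<Sum>i<n. p i) * ln T0"
    by (simp add: sum.distrib sum_subtractf pw T0_def flip: sum_divide_distrib sum_distrib_right)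
  also have "\<dots> \<le> ln T" using T0 T p(2) by (simp flip: T0_def)
  finally have "((\<Sum>i<n. \<Sum>j<n. p i * ln (q j) * w i j) - (\<Sum>i<n. p i * ln (p i))) / ln 2 \<le> ln T / ln 2"
    by (intro divide_right_mono) auto
  then show "(\<Sum>i<n. \<Sum>j<n. p i * log 2 (q j) * w i j) - (\<Sum>i<n. p i * log 2 (p i)) \<le> log 2 T"
    by (simp add: log_def sum_divide_distrib diff_divide_distrib)
qed

text \<open>In the two eigenbases all traces become sums weighted by squared overlaps, to which
  \<open>gibbs_inequality\<close> applies. Asking only for \<open>P * \<rho> = \<rho>\<close> admits
  the tensor power of a support projection. The first conclusion keeps the logarithm away from the
  argument 0, where its value is 0 by convention.\<close>

lemma rel_entropy_projection_bound:
  assumes \<rho>: "state n \<rho>" and \<sigma>: "psd n \<sigma>" and supp: "supp \<rho> \<subseteq> supp \<sigma>"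
    and P: "projection n P" "P * \<rho> = \<rho>"
  shows "0 < Re (mtrace (P * \<sigma>))"
    and "- log 2 (Re (mtrace (P * \<sigma>)))
      \<le> Re (mtrace (\<rho> * spec_fun (log 2) \<rho> - \<rho> * spec_fun (log 2) \<sigma>))"
proof -
  have \<rho>psd: "psd n \<rho>" and tr: "mtrace \<rho> = 1" using \<rho> by (auto simp: state_def)
  obtain U and p :: "nat \<Rightarrow> real" where U: "unitary n U" and p: "\<forall>i<n. 0 \<le> p i"
    and \<rho>U: "\<rho> = U * mat_diag n (\<lambda>i. complex_of_real (p i)) * mat_adjoint U"
    using psd_spectral[OF \<rho>psd] by blast
  obtain V and q :: "nat \<Rightarrow> real" where V: "unitary n V" and q: "\<forall>j<n. 0 \<le> q j"
    and \<sigma>V: "\<sigma> = V * mat_diag n (\<lambda>j. complex_of_real (q j)) * mat_adjoint V"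
    using psd_spectral[OF \<sigma>] by blast
  note Uc = unitaryD[OF U] and Vc = unitaryD[OF V]
  define W where "W = mat_adjoint U * V"
  have W: "unitary n W"
    using Uc Vc by (auto simp: W_def unitary_def intro!: unitary_mult[unfolded unitary_def])
  have Wc: "W \<in> carrier_mat n n" by (rule unitaryD(1)[OF W])
  define w where "w i j = (cmod (W $$ (i, j)))\<^sup>2" for i j
  define P0 where "P0 = U * mat_diag n (\<lambda>i. complex_of_real (of_bool (p i \<noteq> 0))) * mat_adjoint U"
  note P0 = supp_proj_unitary_conj[OF U \<rho>U, folded P0_def]
  have p_sum: "(\<Sum>i<n. p i) = 1"
    using tr unitary_conj_mtrace[OF U, of "\<lambda>i. complex_of_real (p i)"] by (simp add: \<rho>U flip: of_real_sum)
  \<comment> \<open>The support projection of \<sigma> fixes \<rho>. Read in the two eigenbases,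
    this says that eigenvectors of \<rho> with positive eigenvalue do not overlap with the kernel of
    \<sigma>.\<close>
  have zero: "w i j = 0" if ij: "i < n" "j < n" and pi: "0 < p i" and qj: "q j = 0" for i j
  proof -
    let ?Q = "V * mat_diag n (\<lambda>j. complex_of_real (of_bool (q j \<noteq> 0))) * mat_adjoint V"
    let ?D = "mat_diag n (\<lambda>j. complex_of_real (of_bool (q j \<noteq> 0)))"
    let ?E = "mat_diag n (\<lambda>i. complex_of_real (p i))"
    have W': "mat_adjoint W \<in> carrier_mat n n" using Wc by auto
    have "?Q * \<rho> = \<rho>"
      using supp_proj_unitary_conj(2,3)[OF V \<sigma>V] supp psd_carrier[OF \<rho>psd]
      by (subst idempotent_mult_absorb[where n = n]) (auto simp: projection_def)
    then have "mat_adjoint V * (?Q * \<rho>) * U = mat_adjoint V * \<rho> * U" by simp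
    moreover have "mat_adjoint V * (?Q * \<rho>) * U = (mat_adjoint V * V) * ?D * mat_adjoint W * ?E * (mat_adjoint U * U)"
      using Uc(1) Vc(1) by (simp add: \<rho>U W_def square_mat[where n = n])
    moreover have "mat_adjoint V * \<rho> * U = mat_adjoint W * ?E * (mat_adjoint U * U)"
      using Uc(1) Vc(1) by (simp add: \<rho>U W_def square_mat[where n = n])
    ultimately have "?D * (mat_adjoint W * ?E) = mat_adjoint W * ?E"
      using W' Uc(2) Vc(2) by (simp add: square_mat[where n = n])
    then have "(?D * (mat_adjoint W * ?E)) $$ (j, i) = (mat_adjoint W * ?E) $$ (j, i)" by simp
    then have "cnj (W $$ (i, j)) * complex_of_real (p i) = 0"
      using W' Wc ij qj by (simp add: mat_diag_mult_right[OF W'] mat_diag_mult_left[of _ n n])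
    then show ?thesis using pi by (simp add: w_def)
  qed
  \<comment> \<open>The Gibbs bound involves the spectral projection \<open>P0\<close> of \<rho>;
    replacing it by \<open>P\<close> can only increase the overlap with \<sigma>.\<close>
  have T: "(\<Sum>i<n. \<Sum>j<n. of_bool (p i \<noteq> 0) * q j * w i j) \<le> Re (mtrace (P * \<sigma>))"
  proof -
    have Pc: "P \<in> carrier_mat n n" "P * P = P" "mat_adjoint P = P"
      and P0c: "P0 \<in> carrier_mat n n" "P0 * P0 = P0" "mat_adjoint P0 = P0"
      using P(1) P0(2) by (auto simp: projection_def hermitian_def)
    have "supp P0 \<subseteq> supp P"
      using P0(3) supp_mult_subset[OF Pc(1) psd_carrier[OF \<rho>psd]] P(2) by simp
    then have PP0: "P * P0 = P0" by (rule idempotent_mult_absorb[OF Pc(1,2) P0c(1)])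
    have "P0 * P = mat_adjoint (P * P0)" using mat_adjoint_mult[OF Pc(1) P0c(1)] Pc P0c by simp
    then have P0P: "P0 * P = P0" using PP0 P0c by simp
    \<comment> \<open>\<open>P0\<close> lies below \<open>P\<close> because \<open>P - P0\<close>
      equals (1 - P0) P (1 - P0).\<close>
    have "psd n (mat_adjoint (1\<^sub>m n - P0) * P * (1\<^sub>m n - P0))"
      using psd_conj[OF projection_psd(1)[OF P(1)], of "mat_adjoint (1\<^sub>m n - P0)" n]
        minus_carrier_mat[OF P0c(1)] by simp
    moreover have "mat_adjoint (1\<^sub>m n - P0) = 1\<^sub>m n - P0"
      using hermitian_if_psd[OF projection_psd(2)[OF P0(2)]] by (simp add: hermitian_def)
    moreover have "(1\<^sub>m n - P0) * P = P - P0"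
      using Pc P0c P0P by (subst minus_mult_distrib_mat[of _ n n _ _ n]) auto
    moreover have "(P - P0) * (1\<^sub>m n - P0) = P - P0"
    proof -
      have "(P - P0) * (1\<^sub>m n - P0) = (P - P0) * 1\<^sub>m n - (P - P0) * P0"
        using Pc P0c by (intro mult_minus_distrib_mat[of _ n n _ n]) auto
      also have "(P - P0) * P0 = P * P0 - P0 * P0"
        using Pc P0c by (intro minus_mult_distrib_mat[of _ n n _ _ n]) auto
      also have "(P - P0) * 1\<^sub>m n - (P * P0 - P0 * P0) = P - P0"
        using Pc(1) P0c(1,2) PP0 by (intro eq_matI) auto
      finally show ?thesis .
    qed
    ultimately have "psd n (P - P0)" by simp
    then have "0 \<le> mtrace ((P - P0) * \<sigma>)" using \<sigma> by (rule psd_mtrace_mult_nonneg)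
    then have "Re (mtrace (P0 * \<sigma>)) \<le> Re (mtrace (P * \<sigma>))"
      using Pc P0c psd_carrier[OF \<sigma>] by (simp add: mtrace_mult_minus_left[of _ n] less_eq_complex_def)
    then show ?thesis
      unfolding P0_def \<sigma>V mtrace_unitary_conj_mult[OF U V] by (simp add: w_def W_def)
  qed
  have S: "Re (mtrace (\<rho> * spec_fun (log 2) \<rho> - \<rho> * spec_fun (log 2) \<sigma>))
      = (\<Sum>i<n. p i * log 2 (p i)) - (\<Sum>i<n. \<Sum>j<n. p i * log 2 (q j) * w i j)"
  proof -
    have "\<rho> * spec_fun (log 2) \<rho> = U * mat_diag n (\<lambda>i. complex_of_real (p i * log 2 (p i))) * mat_adjoint U"
      unfolding \<rho>U spec_fun_unitary_conj[OF U] unitary_conj_mult[OF U] by simp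
    moreover have "mtrace \<dots> = complex_of_real (\<Sum>i<n. p i * log 2 (p i))"
      unfolding unitary_conj_mtrace[OF U] by simp
    moreover have "mtrace (\<rho> * spec_fun (log 2) \<sigma>) = complex_of_real (\<Sum>i<n. \<Sum>j<n. p i * log 2 (q j) * w i j)"
      unfolding \<rho>U \<sigma>V spec_fun_unitary_conj[OF V] mtrace_unitary_conj_mult[OF U V] by (simp add: w_def W_def)
    moreover have "\<rho> * spec_fun (log 2) \<rho> \<in> carrier_mat n n" "\<rho> * spec_fun (log 2) \<sigma> \<in> carrier_mat n n"
      unfolding \<rho>U \<sigma>V spec_fun_unitary_conj[OF U] spec_fun_unitary_conj[OF V]
      by (rule mult_carrier_mat[OF unitary_conj_carrier[OF U]] unitary_conj_carrier U V)+
    ultimately show ?thesis by (subst mtrace_minus[of _ n]) simp_all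
  qed
  have w: "0 \<le> w i j" for i j by (simp add: w_def)
  have w1: "(\<Sum>j<n. w i j) = 1" if "i < n" for i
    unfolding w_def by (rule unitary_row_norm[OF W that])
  note gibbs = gibbs_inequality[of n p q w, OF _ p_sum _ w w1 zero T]
  show "0 < Re (mtrace (P * \<sigma>))" using gibbs(1) p q by blast
  have "(\<Sum>i<n. \<Sum>j<n. p i * log 2 (q j) * w i j) - (\<Sum>i<n. p i * log 2 (p i)) \<le> log 2 (Re (mtrace (P * \<sigma>)))"
    using gibbs(2) p q by blast
  then show "- log 2 (Re (mtrace (P * \<sigma>)))
      \<le> Re (mtrace (\<rho> * spec_fun (log 2) \<rho> - \<rho> * spec_fun (log 2) \<sigma>))"
    unfolding S by linarith
qed

section \<open>Completely positive maps and local operations\<close>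

lemma sum_div_mod: "(\<Sum>s<a * b. f s) = (\<Sum>p<a. \<Sum>j<b. f (p * b + j))" for a b :: nat
  unfolding sum.cartesian_product
  by (rule sum.reindex_bij_witness[of _ "\<lambda>(p, j). p * b + j" "\<lambda>s. (s div b, s mod b)"])
    (auto simp: mult_add_less div_mod_less)

lemma conj_index:
  assumes "M \<in> carrier_mat n m" "X \<in> carrier_mat m m" "r < n" "c < n"
  shows "(M * X * mat_adjoint M) $$ (r, c) = (\<Sum>s<m. \<Sum>t<m. M $$ (r, s) * X $$ (s, t) * cnj (M $$ (c, t)))"
proof -
  have "(M * X * mat_adjoint M) $$ (r, c) = (\<Sum>t<m. (M * X) $$ (r, t) * mat_adjoint M $$ (t, c))"
    using assms by (intro mult_index_sum[of _ n m]) auto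
  also have "\<dots> = (\<Sum>t<m. \<Sum>s<m. M $$ (r, s) * X $$ (s, t) * cnj (M $$ (c, t)))"
    using assms by (intro sum.cong)
      (auto simp: mult_index_sum[of M n m X m] sum_distrib_right simp del: index_mult_mat(1))
  finally show ?thesis by (subst sum.swap)
qed

lemma kron_dim [simp]:
  "dim_row (kron A B) = dim_row A * dim_row B" "dim_col (kron A B) = dim_col A * dim_col B"
  by (simp_all add: kron_def)

lemma kron_carrier [intro]:
  "A \<in> carrier_mat n m \<Longrightarrow> B \<in> carrier_mat n' m' \<Longrightarrow> kron A B \<in> carrier_mat (n * n') (m * m')"
  by auto

text \<open>The identity factor fixes Bob's index on both sides, which collapses two of the four
  sums. In this form the effect of a partial transpose can be read off from the indices.\<close>

lemma kron_one_right_conj_index: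
  assumes K: "K \<in> carrier_mat e a" and X: "X \<in> carrier_mat (a * b) (a * b)" and rc: "r < e * b" "c < e * b"
  shows "(kron K (1\<^sub>m b) * X * mat_adjoint (kron K (1\<^sub>m b))) $$ (r, c)
    = (\<Sum>p<a. \<Sum>q<a. K $$ (r div b, p) * X $$ (p * b + r mod b, q * b + c mod b) * cnj (K $$ (c div b, q)))"
proof -
  let ?M = "kron K (1\<^sub>m b)"
  have M: "?M \<in> carrier_mat (e * b) (a * b)" using K by auto
  have entry: "?M $$ (r, p * b + j) = (if j = r mod b then K $$ (r div b, p) else 0)"
    if "r < e * b" "p < a" "j < b" for r p j
    using that K mult_add_less[OF that(2,3)] div_mod_less[OF that(1)] by (simp add: kron_def)
  have "(?M * X * mat_adjoint ?M) $$ (r, c)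
      = (\<Sum>p<a. \<Sum>j<b. \<Sum>q<a. \<Sum>l<b. ?M $$ (r, p * b + j) * X $$ (p * b + j, q * b + l) * cnj (?M $$ (c, q * b + l)))"
    unfolding conj_index[OF M X rc] sum_div_mod ..
  also have "\<dots> = (\<Sum>p<a. \<Sum>j<b. \<Sum>q<a. \<Sum>l<b. if l = c mod b then if j = r mod b then
      K $$ (r div b, p) * X $$ (p * b + j, q * b + l) * cnj (K $$ (c div b, q)) else 0 else 0)"
    using rc by (intro sum.cong refl) (auto simp: entry)
  also have "\<dots> = (\<Sum>p<a. \<Sum>j<b. if j = r mod b then
      \<Sum>q<a. K $$ (r div b, p) * X $$ (p * b + j, q * b + c mod b) * cnj (K $$ (c div b, q)) else 0)"
    using div_mod_less[OF rc(2)] by (intro sum.cong refl) (auto intro!: sum.neutral)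
  also have "\<dots> = (\<Sum>p<a. \<Sum>q<a. K $$ (r div b, p) * X $$ (p * b + r mod b, q * b + c mod b) * cnj (K $$ (c div b, q)))"
    using div_mod_less[OF rc(1)] by simp
  finally show ?thesis .
qed

text \<open>Besides Bob's measurements this covers complete positivity: with \<open>a\<close> as the
  dimension of the ancilla, \<open>kron (1\<^sub>m a) K\<close> is the Kraus operator of an
  ampliated conjugation.\<close>

lemma kron_one_left_conj_index:
  assumes K: "K \<in> carrier_mat e b" and X: "X \<in> carrier_mat (a * b) (a * b)" and rc: "r < a * e" "c < a * e"
  shows "(kron (1\<^sub>m a) K * X * mat_adjoint (kron (1\<^sub>m a) K)) $$ (r, c)
    = (\<Sum>p<b. \<Sum>q<b. K $$ (r mod e, p) * X $$ (r div e * b + p, c div e * b + q) * cnj (K $$ (c mod e, q)))"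
proof -
  let ?M = "kron (1\<^sub>m a) K"
  have M: "?M \<in> carrier_mat (a * e) (a * b)" using K by auto
  have entry: "?M $$ (r, i * b + p) = (if i = r div e then K $$ (r mod e, p) else 0)"
    if "r < a * e" "i < a" "p < b" for r i p
    using that K mult_add_less[OF that(2,3)] div_mod_less[OF that(1)] by (simp add: kron_def)
  have "(?M * X * mat_adjoint ?M) $$ (r, c)
      = (\<Sum>i<a. \<Sum>p<b. \<Sum>k<a. \<Sum>q<b. ?M $$ (r, i * b + p) * X $$ (i * b + p, k * b + q) * cnj (?M $$ (c, k * b + q)))"
    unfolding conj_index[OF M X rc] sum_div_mod ..
  also have "\<dots> = (\<Sum>i<a. \<Sum>p<b. \<Sum>k<a. \<Sum>q<b. if k = c div e then if i = r div e then
      K $$ (r mod e, p) * X $$ (i * b + p, k * b + q) * cnj (K $$ (c mod e, q)) else 0 else 0)"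
    using rc by (intro sum.cong refl) (auto simp: entry)
  also have "\<dots> = (\<Sum>i<a. \<Sum>p<b. \<Sum>k<a. if k = c div e then \<Sum>q<b. if i = r div e then
      K $$ (r mod e, p) * X $$ (i * b + p, k * b + q) * cnj (K $$ (c mod e, q)) else 0 else 0)"
    by (intro sum.cong refl) auto
  also have "\<dots> = (\<Sum>i<a. \<Sum>p<b. \<Sum>q<b. if i = r div e then
      K $$ (r mod e, p) * X $$ (i * b + p, c div e * b + q) * cnj (K $$ (c mod e, q)) else 0)"
    using div_mod_less[OF rc(2)] by simp
  also have "\<dots> = (\<Sum>i<a. if i = r div e then \<Sum>p<b. \<Sum>q<b.
      K $$ (r mod e, p) * X $$ (i * b + p, c div e * b + q) * cnj (K $$ (c mod e, q)) else 0)"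
    by (intro sum.cong refl) auto
  also have "\<dots> = (\<Sum>p<b. \<Sum>q<b. K $$ (r mod e, p) * X $$ (r div e * b + p, c div e * b + q) * cnj (K $$ (c mod e, q)))"
    using div_mod_less[OF rc(1)] div_mod_less[OF rc(2)] by simp
  finally show ?thesis .
qed

section \<open>Closure properties of completely positive maps\<close>

lemma linear_map_carrier: "linear_map m n \<Lambda> \<Longrightarrow> X \<in> carrier_mat m m \<Longrightarrow> \<Lambda> X \<in> carrier_mat n n"
  by (simp add: linear_map_def)

lemma completely_positive_psd:
  assumes "completely_positive m n \<Lambda>" "psd m X" shows "psd n (\<Lambda> X)"
proof -
  have X: "X \<in> carrier_mat m m" using assms(2) by (rule psd_carrier)
  have "psd (1 * n) (ampliation 1 m n \<Lambda> X)"
    using assms unfolding completely_positive_def by (metis mult_1)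
  moreover have "ampliation 1 m n \<Lambda> X = \<Lambda> X"
  proof -
    have "mat m m (\<lambda>(i, j). X $$ (i, j)) = X" using X by (intro eq_matI) auto
    moreover have "\<Lambda> X \<in> carrier_mat n n"
      using assms(1) X by (auto simp: completely_positive_def linear_map_def)
    ultimately show ?thesis by (intro eq_matI) (auto simp: ampliation_def)
  qed
  ultimately show ?thesis by simp
qed

text \<open>Maps are functions on all matrices, whereas identities such as the involutivity of the
  partial transpose hold only for matrices of the right size. Ampliation feeds only m by m blocks to
  the map, so agreement there is enough.\<close>

lemma completely_positive_cong:
  assumes "completely_positive m n \<Lambda>" "\<And>X. X \<in> carrier_mat m m \<Longrightarrow> \<Gamma> X = \<Lambda> X"
  shows "completely_positive m n \<Gamma>"
proof -
  have "ampliation k m n \<Gamma> X = ampliation k m n \<Lambda> X" for k X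
    unfolding ampliation_def by (simp add: assms(2))
  then show ?thesis using assms by (simp add: completely_positive_def linear_map_def)
qed

lemma completely_positive_id: "completely_positive m m (\<lambda>X. X)"
proof -
  have "ampliation k m m (\<lambda>X. X) X = X" if "X \<in> carrier_mat (k * m) (k * m)" for k X
    using that by (intro eq_matI) (auto simp: ampliation_def div_mod_less)
  then show ?thesis by (auto simp: completely_positive_def linear_map_def psd_carrier)
qed

text \<open>Ampliation respects composition: the blocks of the ampliated intermediate matrix are the
  images of the original blocks.\<close>

lemma completely_positive_comp:
  assumes "completely_positive m n \<Lambda>" "completely_positive n l \<Gamma>"
  shows "completely_positive m l (\<lambda>X. \<Gamma> (\<Lambda> X))"
proof -
  have "ampliation k m l (\<lambda>X. \<Gamma> (\<Lambda> X)) X = ampliation k n l \<Gamma> (ampliation k m n \<Lambda> X)" (is "?L = ?R") for k X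
  proof (rule eq_matI)
    fix r c assume "r < dim_row ?R" "c < dim_col ?R"
    then have rc: "r < k * l" "c < k * l" by (auto simp: ampliation_def)
    define B where "B u v = mat m m (\<lambda>(i, j). X $$ (u * m + i, v * m + j))" for u v
    have B: "\<Lambda> (B u v) \<in> carrier_mat n n" for u v
      using assms(1) by (auto simp: completely_positive_def linear_map_def B_def)
    have "mat n n (\<lambda>(i, j). ampliation k m n \<Lambda> X $$ (r div l * n + i, c div l * n + j)) = \<Lambda> (B (r div l) (c div l))"
      using B[of "r div l" "c div l"] div_mod_less[OF rc(1)] div_mod_less[OF rc(2)]
      by (intro eq_matI) (auto simp: ampliation_def mult_add_less B_def)
    then show "?L $$ (r, c) = ?R $$ (r, c)"
      using rc by (simp add: ampliation_def[of k m l] ampliation_def[of k n l] B_def)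
  qed (auto simp: ampliation_def)
  moreover have "linear_map m l (\<lambda>X. \<Gamma> (\<Lambda> X))"
    using assms by (auto simp: completely_positive_def linear_map_def)
  ultimately show ?thesis using assms by (simp add: completely_positive_def)
qed

text \<open>Ampliating a conjugation gives the conjugation by \<open>kron (1\<^sub>m k) M\<close>,
  which preserves positivity.\<close>

lemma completely_positive_conj:
  assumes M: "M \<in> carrier_mat n m"
  shows "completely_positive m n (\<lambda>X. M * X * mat_adjoint M)"
proof -
  have M': "mat_adjoint M \<in> carrier_mat m n" using M by auto
  have "linear_map m n (\<lambda>X. M * X * mat_adjoint M)"
    unfolding linear_map_def
  proof (intro conjI ballI allI)
    fix X Y :: "complex mat" assume X: "X \<in> carrier_mat m m" and Y: "Y \<in> carrier_mat m m"
    show "M * (X + Y) * mat_adjoint M = M * X * mat_adjoint M + M * Y * mat_adjoint M"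
      using M M' X Y by (simp add: mult_add_distrib_mat[of _ n m _ m] add_mult_distrib_mat[of _ n m _ _ n])
  next
    fix c and X :: "complex mat" assume X: "X \<in> carrier_mat m m"
    show "M * (c \<cdot>\<^sub>m X) * mat_adjoint M = c \<cdot>\<^sub>m (M * X * mat_adjoint M)"
      using M M' X by (simp add: mult_smult_distrib[of _ n m _ m] mult_smult_assoc_mat[of _ n m _ n])
  qed (use M M' in auto)
  moreover have "psd (k * n) (ampliation k m n (\<lambda>X. M * X * mat_adjoint M) X)" if X: "psd (k * m) X" for k X
  proof -
    have Xc: "X \<in> carrier_mat (k * m) (k * m)" using X by (rule psd_carrier)
    have "ampliation k m n (\<lambda>X. M * X * mat_adjoint M) X
        = kron (1\<^sub>m k) M * X * mat_adjoint (kron (1\<^sub>m k) M)" (is "?L = ?R")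
    proof (rule eq_matI)
      fix r c assume "r < dim_row ?R" "c < dim_col ?R"
      then have rc: "r < k * n" "c < k * n" using M by auto
      define B where "B = mat m m (\<lambda>(i, j). X $$ (r div n * m + i, c div n * m + j))"
      have "?L $$ (r, c) = (M * B * mat_adjoint M) $$ (r mod n, c mod n)"
        using rc by (simp add: ampliation_def B_def)
      also have "\<dots> = (\<Sum>p<m. \<Sum>q<m. M $$ (r mod n, p) * B $$ (p, q) * cnj (M $$ (c mod n, q)))"
        using div_mod_less[OF rc(1)] div_mod_less[OF rc(2)]
        by (intro conj_index[OF M]) (auto simp: B_def)
      also have "\<dots> = ?R $$ (r, c)"
        unfolding kron_one_left_conj_index[OF M Xc rc] by (intro sum.cong) (auto simp: B_def)
      finally show "?L $$ (r, c) = ?R $$ (r, c)" .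
    qed (use M in \<open>auto simp: ampliation_def\<close>)
    then show ?thesis using psd_conj[OF X kron_carrier[OF one_carrier_mat M]] by simp
  qed
  ultimately show ?thesis by (simp add: completely_positive_def)
qed

lemma msum_carrier [simp]: "msum n m F N \<in> carrier_mat n m"
  by (simp add: msum_def)

lemma completely_positive_msum:
  assumes cp: "\<And>t. t < N \<Longrightarrow> completely_positive m n (F t)"
  shows "completely_positive m n (\<lambda>X. msum n n (\<lambda>t. F t X) N)"
proof -
  have lin: "linear_map m n (F t)" if "t < N" for t
    using cp[OF that] by (simp add: completely_positive_def)
  have "linear_map m n (\<lambda>X. msum n n (\<lambda>t. F t X) N)"
    unfolding linear_map_def
  proof (intro conjI ballI allI)
    fix X Y :: "complex mat" assume XY: "X \<in> carrier_mat m m" "Y \<in> carrier_mat m m"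
    show "msum n n (\<lambda>t. F t (X + Y)) N = msum n n (\<lambda>t. F t X) N + msum n n (\<lambda>t. F t Y) N"
    proof (rule eq_matI)
      fix i j assume "i < dim_row (msum n n (\<lambda>t. F t X) N + msum n n (\<lambda>t. F t Y) N)"
        and "j < dim_col (msum n n (\<lambda>t. F t X) N + msum n n (\<lambda>t. F t Y) N)"
      then have ij: "i < n" "j < n" by (auto simp: msum_def)
      have "F t (X + Y) $$ (i, j) = F t X $$ (i, j) + F t Y $$ (i, j)" if "t < N" for t
        using lin[OF that] linear_map_carrier[OF lin[OF that] XY(2)] XY ij by (auto simp: linear_map_def)
      then show "msum n n (\<lambda>t. F t (X + Y)) N $$ (i, j)
          = (msum n n (\<lambda>t. F t X) N + msum n n (\<lambda>t. F t Y) N) $$ (i, j)"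
        using ij by (simp add: msum_def sum.distrib)
    qed (auto simp: msum_def)
  next
    fix c and X :: "complex mat" assume X: "X \<in> carrier_mat m m"
    show "msum n n (\<lambda>t. F t (c \<cdot>\<^sub>m X)) N = c \<cdot>\<^sub>m msum n n (\<lambda>t. F t X) N"
    proof (rule eq_matI)
      fix i j assume "i < dim_row (c \<cdot>\<^sub>m msum n n (\<lambda>t. F t X) N)"
        and "j < dim_col (c \<cdot>\<^sub>m msum n n (\<lambda>t. F t X) N)"
      then have ij: "i < n" "j < n" by (auto simp: msum_def)
      have "F t (c \<cdot>\<^sub>m X) $$ (i, j) = c * F t X $$ (i, j)" if "t < N" for t
        using lin[OF that] linear_map_carrier[OF lin[OF that] X] X ij by (auto simp: linear_map_def)
      then show "msum n n (\<lambda>t. F t (c \<cdot>\<^sub>m X)) N $$ (i, j) = (c \<cdot>\<^sub>m msum n n (\<lambda>t. F t X) N) $$ (i, j)"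
        using ij by (simp add: msum_def sum_distrib_left)
    qed (auto simp: msum_def)
  qed simp
  moreover have "psd (k * n) (ampliation k m n (\<lambda>X. msum n n (\<lambda>t. F t X) N) X)" if "psd (k * m) X" for k X
  proof -
    have "ampliation k m n (\<lambda>X. msum n n (\<lambda>t. F t X) N) X
        = msum (k * n) (k * n) (\<lambda>t. ampliation k m n (F t) X) N"
      by (intro eq_matI) (auto simp: ampliation_def msum_def div_mod_less)
    moreover have "psd (k * n) (ampliation k m n (F t) X)" if "t < N" for t
      using cp[OF that] \<open>psd (k * m) X\<close> by (simp add: completely_positive_def)
    ultimately show ?thesis by (simp add: psd_msum)
  qed
  ultimately show ?thesis by (simp add: completely_positive_def)
qed

lemma mtrace_msum:
  assumes "\<And>t. t < N \<Longrightarrow> F t \<in> carrier_mat n n"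
  shows "mtrace (msum n n F N) = (\<Sum>t<N. mtrace (F t))"
proof -
  have "mtrace (msum n n F N) = (\<Sum>i<n. \<Sum>t<N. F t $$ (i, i))"
    by (subst mtrace_eq[OF msum_carrier]) (simp add: msum_def)
  also have "\<dots> = (\<Sum>t<N. mtrace (F t))"
    by (subst sum.swap) (use assms in \<open>auto simp: mtrace_eq[of _ n n] intro!: sum.cong\<close>)
  finally show ?thesis .
qed

lemma ptrans_msum:
  "ptrans a b (msum (a * b) (a * b) F N) = msum (a * b) (a * b) (\<lambda>t. ptrans a b (F t)) N"
  by (rule eq_matI) (auto simp: msum_def pt_index_less)

lemma PPT_op_id: "PPT_op a b a b (\<lambda>X. X)"
  by (auto simp: PPT_op_def cptp_def completely_positive_id
      intro: completely_positive_cong[OF completely_positive_id])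

text \<open>
  One round of a protocol: the Kraus operators \<open>M t\<close> act on one side only, so that the partial
  transpose turns them into Kraus operators \<open>M' t\<close>.
\<close>

lemma PPT_op_round:
  assumes L: "\<And>t. t < N \<Longrightarrow> PPT_op (e t) (f t) a' b' (L t)"
    and M: "\<And>t. t < N \<Longrightarrow> M t \<in> carrier_mat (e t * f t) (a * b)"
    and M': "\<And>t. t < N \<Longrightarrow> M' t \<in> carrier_mat (e t * f t) (a * b)"
    and pt: "\<And>t X. t < N \<Longrightarrow> X \<in> carrier_mat (a * b) (a * b) \<Longrightarrow>
      ptrans (e t) (f t) (M t * X * mat_adjoint (M t)) = M' t * ptrans a b X * mat_adjoint (M' t)"
    and tr: "\<And>X. X \<in> carrier_mat (a * b) (a * b) \<Longrightarrow>
      (\<Sum>t<N. mtrace (M t * X * mat_adjoint (M t))) = mtrace X"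
  shows "PPT_op a b a' b' (\<lambda>X. msum (a' * b') (a' * b') (\<lambda>t. L t (M t * X * mat_adjoint (M t))) N)"
    (is "PPT_op a b a' b' ?\<Lambda>")
proof -
  have Mc: "M t * X * mat_adjoint (M t) \<in> carrier_mat (e t * f t) (e t * f t)"
    if "t < N" "X \<in> carrier_mat (a * b) (a * b)" for t X
    using M[OF that(1)] that(2) by auto
  have Lc: "L t Z \<in> carrier_mat (a' * b') (a' * b')" if "t < N" "Z \<in> carrier_mat (e t * f t) (e t * f t)" for t Z
    using L[OF that(1)] that(2) by (auto simp: PPT_op_def cptp_def completely_positive_def linear_map_def)
  have "completely_positive (a * b) (a' * b') ?\<Lambda>"
  proof (rule completely_positive_msum)
    fix t assume t: "t < N"
    show "completely_positive (a * b) (a' * b') (\<lambda>X. L t (M t * X * mat_adjoint (M t)))"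
      using L[OF t] by (intro completely_positive_comp[OF completely_positive_conj[OF M[OF t]]])
        (simp add: PPT_op_def cptp_def)
  qed
  moreover have "mtrace (?\<Lambda> X) = mtrace X" if X: "X \<in> carrier_mat (a * b) (a * b)" for X
  proof -
    have "mtrace (?\<Lambda> X) = (\<Sum>t<N. mtrace (L t (M t * X * mat_adjoint (M t))))"
      using Lc Mc X by (intro mtrace_msum) auto
    also have "\<dots> = (\<Sum>t<N. mtrace (M t * X * mat_adjoint (M t)))"
      using L Mc[OF _ X] by (intro sum.cong) (auto simp: PPT_op_def cptp_def)
    finally show ?thesis using tr[OF X] by simp
  qed
  moreover have "completely_positive (a * b) (a' * b') (\<lambda>X. ptrans a' b' (?\<Lambda> (ptrans a b X)))"
  proof (rule completely_positive_cong)
    let ?L' = "\<lambda>t X. ptrans a' b' (L t (ptrans (e t) (f t) X))"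
    show "completely_positive (a * b) (a' * b')
        (\<lambda>X. msum (a' * b') (a' * b') (\<lambda>t. ?L' t (M' t * X * mat_adjoint (M' t))) N)"
    proof (rule completely_positive_msum)
      fix t assume t: "t < N"
      show "completely_positive (a * b) (a' * b') (\<lambda>X. ?L' t (M' t * X * mat_adjoint (M' t)))"
        using L[OF t] by (intro completely_positive_comp[OF completely_positive_conj[OF M'[OF t]]])
          (simp add: PPT_op_def)
    qed
    fix X :: "complex mat" assume X: "X \<in> carrier_mat (a * b) (a * b)"
    \<comment> \<open>\<open>pt\<close> is used at the partial transpose of \<open>X\<close>; as the
      transpose is an involution, the result can be solved for the conjugation by
      \<open>M t\<close>.\<close>
    have "M t * ptrans a b X * mat_adjoint (M t) = ptrans (e t) (f t) (M' t * X * mat_adjoint (M' t))"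
      if t: "t < N" for t
      using pt[OF t ptrans_carrier, of X] ptrans_ptrans[OF Mc[OF t ptrans_carrier], of X] X by simp
    then have "L t (M t * ptrans a b X * mat_adjoint (M t)) = L t (ptrans (e t) (f t) (M' t * X * mat_adjoint (M' t)))"
      if "t < N" for t using that by simp
    then show "ptrans a' b' (?\<Lambda> (ptrans a b X))
        = msum (a' * b') (a' * b') (\<lambda>t. ?L' t (M' t * X * mat_adjoint (M' t))) N"
      unfolding ptrans_msum by (intro eq_matI) (auto simp: msum_def)
  qed
  ultimately show ?thesis by (simp add: PPT_op_def cptp_def)
qed

section \<open>Trace and partial transpose under local measurements\<close>

lemma measurement_completeness:
  assumes "measurement d N e K" "p < d" "q < d"
  shows "(\<Sum>t<N. \<Sum>i<e t. cnj (K t $$ (i, q)) * K t $$ (i, p)) = (if p = q then 1 else 0)"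
proof -
  have "(if p = q then 1 else 0) = msum d d (\<lambda>t. mat_adjoint (K t) * K t) N $$ (q, p)"
    using assms by (auto simp: measurement_def)
  also have "\<dots> = (\<Sum>t<N. (mat_adjoint (K t) * K t) $$ (q, p))"
    using assms(2,3) by (simp add: msum_def)
  also have "\<dots> = (\<Sum>t<N. \<Sum>i<e t. cnj (K t $$ (i, q)) * K t $$ (i, p))"
  proof (intro sum.cong refl)
    fix t assume "t \<in> {..<N}"
    then have K: "K t \<in> carrier_mat (e t) d" using assms(1) by (auto simp: measurement_def)
    show "(mat_adjoint (K t) * K t) $$ (q, p) = (\<Sum>i<e t. cnj (K t $$ (i, q)) * K t $$ (i, p))"
      using K assms(2,3) by (subst mult_index_sum[of _ d "e t" _ d]) auto
  qed
  finally show ?thesis by simp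
qed

lemma sum_swap2:
  "(\<Sum>x\<in>A. \<Sum>p\<in>B. \<Sum>q\<in>C. g x p q) = (\<Sum>p\<in>B. \<Sum>q\<in>C. \<Sum>x\<in>A. g x p q)"
  by (subst sum.swap) (intro sum.cong refl sum.swap)

text \<open>The free \<open>f\<close> stands for the entries of an operator with the other party's
  indices held fixed, so that one consequence of completeness serves both Alice and Bob.\<close>

lemma measurement_trace:
  assumes "measurement d N e K"
  shows "(\<Sum>t<N. \<Sum>i<e t. \<Sum>p<d. \<Sum>q<d. K t $$ (i, p) * f p q * cnj (K t $$ (i, q))) = (\<Sum>p<d. f p p)"
proof -
  have "(\<Sum>t<N. \<Sum>i<e t. \<Sum>p<d. \<Sum>q<d. K t $$ (i, p) * f p q * cnj (K t $$ (i, q)))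
      = (\<Sum>t<N. \<Sum>p<d. \<Sum>q<d. \<Sum>i<e t. K t $$ (i, p) * f p q * cnj (K t $$ (i, q)))"
    by (rule sum.cong[OF refl sum_swap2])
  also have "\<dots> = (\<Sum>p<d. \<Sum>q<d. \<Sum>t<N. \<Sum>i<e t. K t $$ (i, p) * f p q * cnj (K t $$ (i, q)))"
    by (rule sum_swap2)
  also have "\<dots> = (\<Sum>p<d. \<Sum>q<d. f p q * (\<Sum>t<N. \<Sum>i<e t. cnj (K t $$ (i, q)) * K t $$ (i, p)))"
    by (simp add: sum_distrib_left ac_simps)
  also have "\<dots> = (\<Sum>p<d. \<Sum>q<d. if p = q then f p p else 0)"
    by (intro sum.cong refl) (auto simp: measurement_completeness[OF assms])
  finally show ?thesis by simp
qed

lemma mtrace_measurement_left: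
  assumes K: "measurement a N e K" and X: "X \<in> carrier_mat (a * b) (a * b)"
  shows "(\<Sum>t<N. mtrace (kron (K t) (1\<^sub>m b) * X * mat_adjoint (kron (K t) (1\<^sub>m b)))) = mtrace X"
proof -
  have tr: "mtrace (kron (K t) (1\<^sub>m b) * X * mat_adjoint (kron (K t) (1\<^sub>m b)))
      = (\<Sum>j<b. \<Sum>i<e t. \<Sum>p<a. \<Sum>q<a. K t $$ (i, p) * X $$ (p * b + j, q * b + j) * cnj (K t $$ (i, q)))"
    if t: "t < N" for t
  proof -
    have Kt: "K t \<in> carrier_mat (e t) a" using K t by (simp add: measurement_def)
    let ?M = "kron (K t) (1\<^sub>m b)"
    have MX: "?M * X * mat_adjoint ?M \<in> carrier_mat (e t * b) (e t * b)" using Kt X by auto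
    have "mtrace (?M * X * mat_adjoint ?M) = (\<Sum>i<e t. \<Sum>j<b. (?M * X * mat_adjoint ?M) $$ (i * b + j, i * b + j))"
      unfolding mtrace_eq[OF MX] sum_div_mod ..
    also have "\<dots> = (\<Sum>i<e t. \<Sum>j<b. \<Sum>p<a. \<Sum>q<a. K t $$ (i, p) * X $$ (p * b + j, q * b + j) * cnj (K t $$ (i, q)))"
      by (intro sum.cong refl, subst kron_one_right_conj_index[OF Kt X]) (auto simp: mult_add_less)
    finally show ?thesis by (subst sum.swap)
  qed
  have "(\<Sum>t<N. mtrace (kron (K t) (1\<^sub>m b) * X * mat_adjoint (kron (K t) (1\<^sub>m b))))
      = (\<Sum>j<b. \<Sum>t<N. \<Sum>i<e t. \<Sum>p<a. \<Sum>q<a. K t $$ (i, p) * X $$ (p * b + j, q * b + j) * cnj (K t $$ (i, q)))"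
    by (subst sum.swap) (simp add: tr)
  also have "\<dots> = (\<Sum>p<a. \<Sum>j<b. X $$ (p * b + j, p * b + j))"
    unfolding measurement_trace[OF K] by (rule sum.swap)
  also have "\<dots> = mtrace X"
    unfolding mtrace_eq[OF X] sum_div_mod ..
  finally show ?thesis .
qed

lemma mtrace_measurement_right:
  assumes K: "measurement b N e K" and X: "X \<in> carrier_mat (a * b) (a * b)"
  shows "(\<Sum>t<N. mtrace (kron (1\<^sub>m a) (K t) * X * mat_adjoint (kron (1\<^sub>m a) (K t)))) = mtrace X"
proof -
  have tr: "mtrace (kron (1\<^sub>m a) (K t) * X * mat_adjoint (kron (1\<^sub>m a) (K t)))
      = (\<Sum>j<a. \<Sum>i<e t. \<Sum>p<b. \<Sum>q<b. K t $$ (i, p) * X $$ (j * b + p, j * b + q) * cnj (K t $$ (i, q)))"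
    if t: "t < N" for t
  proof -
    have Kt: "K t \<in> carrier_mat (e t) b" using K t by (simp add: measurement_def)
    let ?M = "kron (1\<^sub>m a) (K t)"
    have MX: "?M * X * mat_adjoint ?M \<in> carrier_mat (a * e t) (a * e t)" using Kt X by auto
    have "mtrace (?M * X * mat_adjoint ?M) = (\<Sum>j<a. \<Sum>i<e t. (?M * X * mat_adjoint ?M) $$ (j * e t + i, j * e t + i))"
      unfolding mtrace_eq[OF MX] sum_div_mod ..
    also have "\<dots> = (\<Sum>j<a. \<Sum>i<e t. \<Sum>p<b. \<Sum>q<b. K t $$ (i, p) * X $$ (j * b + p, j * b + q) * cnj (K t $$ (i, q)))"
      by (intro sum.cong refl, subst kron_one_left_conj_index[OF Kt X]) (auto simp: mult_add_less)
    finally show ?thesis .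
  qed
  have "(\<Sum>t<N. mtrace (kron (1\<^sub>m a) (K t) * X * mat_adjoint (kron (1\<^sub>m a) (K t))))
      = (\<Sum>j<a. \<Sum>t<N. \<Sum>i<e t. \<Sum>p<b. \<Sum>q<b. K t $$ (i, p) * X $$ (j * b + p, j * b + q) * cnj (K t $$ (i, q)))"
    by (subst sum.swap) (simp add: tr)
  also have "\<dots> = (\<Sum>j<a. \<Sum>p<b. X $$ (j * b + p, j * b + p))"
    unfolding measurement_trace[OF K] ..
  also have "\<dots> = mtrace X"
    unfolding mtrace_eq[OF X] sum_div_mod ..
  finally show ?thesis .
qed

text \<open>Only Bob's indices are exchanged while \<open>K\<close> acts on Alice's, so the Kraus
  operator stays the same.\<close>

lemma ptrans_kron_left:
  assumes K: "K \<in> carrier_mat e a" and X: "X \<in> carrier_mat (a * b) (a * b)"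
  shows "ptrans e b (kron K (1\<^sub>m b) * X * mat_adjoint (kron K (1\<^sub>m b)))
    = kron K (1\<^sub>m b) * ptrans a b X * mat_adjoint (kron K (1\<^sub>m b))" (is "?L = ?R")
proof (rule eq_matI)
  fix r c assume "r < dim_row ?R" "c < dim_col ?R"
  then have rc: "r < e * b" "c < e * b" using K by auto
  note l = div_mod_less[OF rc(1)] div_mod_less[OF rc(2)]
  show "?L $$ (r, c) = ?R $$ (r, c)"
    unfolding ptrans_index[OF rc] kron_one_right_conj_index[OF K ptrans_carrier rc]
      kron_one_right_conj_index[OF K X pt_index_less[OF rc] pt_index_less[OF rc(2,1)]]
    using l by (intro sum.cong refl) (auto simp: mult_add_less)
qed (use K in auto)

text \<open>Exchanging Bob's row and column index exchanges the sides on which \<open>K\<close> and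
  its adjoint act. This replaces the Kraus operator by its entrywise conjugate.\<close>

lemma ptrans_kron_right:
  assumes K: "K \<in> carrier_mat e b" and X: "X \<in> carrier_mat (a * b) (a * b)"
  shows "ptrans a e (kron (1\<^sub>m a) K * X * mat_adjoint (kron (1\<^sub>m a) K))
    = kron (1\<^sub>m a) (map_mat cnj K) * ptrans a b X * mat_adjoint (kron (1\<^sub>m a) (map_mat cnj K))" (is "?L = ?R")
proof (rule eq_matI)
  fix r c assume "r < dim_row ?R" "c < dim_col ?R"
  then have rc: "r < a * e" "c < a * e" using K by auto
  have K': "map_mat cnj K \<in> carrier_mat e b" using K by auto
  note l = div_mod_less[OF rc(1)] div_mod_less[OF rc(2)]
  have "?L $$ (r, c) = (\<Sum>p<b. \<Sum>q<b. K $$ (c mod e, p) * X $$ (r div e * b + p, c div e * b + q) * cnj (K $$ (r mod e, q)))"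
    unfolding ptrans_index[OF rc] kron_one_left_conj_index[OF K X pt_index_less[OF rc] pt_index_less[OF rc(2,1)]]
    using l by simp
  also have "\<dots> = (\<Sum>q<b. \<Sum>p<b. K $$ (c mod e, p) * X $$ (r div e * b + p, c div e * b + q) * cnj (K $$ (r mod e, q)))"
    by (rule sum.swap)
  also have "\<dots> = ?R $$ (r, c)"
    unfolding kron_one_left_conj_index[OF K' ptrans_carrier rc]
    using l K by (intro sum.cong refl) (auto simp: mult_add_less)
  finally show "?L $$ (r, c) = ?R $$ (r, c)" .
qed (use K in auto)

text \<open>The partial transpose keeps Alice's Kraus operators and conjugates Bob's entrywise, so a
  transposed round is again given by Kraus operators, and the rest of the protocol is PPT by
  induction.\<close>

theorem LOCC_op_PPT_op: "LOCC_op a b a' b' \<Lambda> \<Longrightarrow> PPT_op a b a' b' \<Lambda>"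
proof (induction rule: LOCC_op.induct)
  case (finish a b)
  show ?case by (rule PPT_op_id)
next
  case (alice a N e K b a' b' L)
  have K: "K t \<in> carrier_mat (e t) a" if "t < N" for t
    using alice(1) that by (simp add: measurement_def)
  show ?case
  proof (rule PPT_op_round[where M' = "\<lambda>t. kron (K t) (1\<^sub>m b)"])
    show "PPT_op (e t) b a' b' (L t)" if "t < N" for t using alice(2) that by blast
    show "ptrans (e t) b (kron (K t) (1\<^sub>m b) * X * mat_adjoint (kron (K t) (1\<^sub>m b)))
        = kron (K t) (1\<^sub>m b) * ptrans a b X * mat_adjoint (kron (K t) (1\<^sub>m b))"
      if "t < N" "X \<in> carrier_mat (a * b) (a * b)" for t X
      using ptrans_kron_left[OF K] that by blast
  qed (use K mtrace_measurement_left[OF alice(1)] in auto)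
next
  case (bob b N e K a a' b' L)
  have K: "K t \<in> carrier_mat (e t) b" if "t < N" for t
    using bob(1) that by (simp add: measurement_def)
  show ?case
  proof (rule PPT_op_round[where M' = "\<lambda>t. kron (1\<^sub>m a) (map_mat cnj (K t))"])
    show "PPT_op a (e t) a' b' (L t)" if "t < N" for t using bob(2) that by blast
    show "ptrans a (e t) (kron (1\<^sub>m a) (K t) * X * mat_adjoint (kron (1\<^sub>m a) (K t)))
        = kron (1\<^sub>m a) (map_mat cnj (K t)) * ptrans a b X * mat_adjoint (kron (1\<^sub>m a) (map_mat cnj (K t)))"
      if "t < N" "X \<in> carrier_mat (a * b) (a * b)" for t X
      using ptrans_kron_right[OF K] that by blast
  qed (use K mtrace_measurement_right[OF bob(1)] in auto)
qed

section \<open>Entanglement cost and relative entropy of entanglement\<close>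

text \<open>By \<open>sq\<close>, the difference of the scaled identity and \<open>A * A\<close> is
  the zero matrix. It is positive and diagonal in the eigenbasis of \<open>A\<close>, which bounds
  every eigenvalue by \<open>c\<close> in absolute value.\<close>

lemma sandwich_if_square:
  assumes A: "A \<in> carrier_mat n n" "hermitian A" and c: "0 \<le> c"
    and sq: "A * A = complex_of_real (c * c) \<cdot>\<^sub>m 1\<^sub>m n"
  shows "sandwich n A (complex_of_real c \<cdot>\<^sub>m 1\<^sub>m n)"
proof -
  obtain U and d :: "nat \<Rightarrow> real" where U: "unitary n U"
    and AU: "A = U * mat_diag n (\<lambda>i. complex_of_real (d i)) * mat_adjoint U"
    using hermitian_spectral[OF A] by blast
  have d: "\<bar>d i\<bar> \<le> c" if i: "i < n" for i
  proof -
    have "U * mat_diag n (\<lambda>i. complex_of_real (c * c - d i * d i)) * mat_adjoint U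
        = complex_of_real (c * c) \<cdot>\<^sub>m 1\<^sub>m n - A * A"
      unfolding unitary_conj_smult_one[OF U, symmetric] AU unitary_conj_mult[OF U] unitary_conj_linear[OF U]
      by simp
    also have "\<dots> = 0\<^sub>m n n" unfolding sq by (intro eq_matI) auto
    finally have "psd n (U * mat_diag n (\<lambda>i. complex_of_real (c * c - d i * d i)) * mat_adjoint U)"
      by (simp only: psd_zero)
    then have "0 \<le> c * c - d i * d i" using U i by (rule psd_eigenvalue_nonneg)
    then show ?thesis using c abs_le_square_iff[of "d i" c] by (simp add: power2_eq_square)
  qed
  have "psd n (U * mat_diag n (\<lambda>i. complex_of_real (c - d i)) * mat_adjoint U)"
    "psd n (U * mat_diag n (\<lambda>i. complex_of_real (c + d i)) * mat_adjoint U)"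
    using d by (force intro!: unitary_conj_psd[OF U])+
  then show ?thesis
    using A(1) AU unitary_conj_carrier[OF U]
    by (simp add: sandwich_def unitary_conj_linear[OF U] flip: unitary_conj_smult_one[OF U])
qed

section \<open>The maximally entangled state under PPT operations\<close>

lemma Phi_carrier [simp]: "Phi \<in> carrier_mat (2 * 2) (2 * 2)"
  by (simp add: Phi_def)

lemma Phi_psd: "psd (2 * 2) Phi"
proof -
  define B where "B = mat 1 (2 * 2) (\<lambda>(i, j). cnj (phi_vec $ j))"
  have B: "B \<in> carrier_mat 1 (2 * 2)" by (simp add: B_def)
  have "mat_adjoint B * B = Phi"
  proof (rule eq_matI)
    fix i j assume "i < dim_row Phi" "j < dim_col Phi"
    then have ij: "i < 2 * 2" "j < 2 * 2" by (auto simp: Phi_def)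
    then show "(mat_adjoint B * B) $$ (i, j) = Phi $$ (i, j)"
      using B by (subst mult_index_sum[of _ "2 * 2" 1 _ "2 * 2"]) (auto simp: Phi_def B_def)
  qed (auto simp: B_def Phi_def)
  then show ?thesis using psd_adjoint_mult[OF B] by simp
qed

text \<open>\<open>2 Phi\<^sup>T\<close> is the swap operator.\<close>

lemma ptrans_Phi: "ptrans 2 2 Phi
  = mat (2 * 2) (2 * 2) (\<lambda>(r, c). if c = r mod 2 * 2 + r div 2 then 1/2 else 0)"
proof (rule eq_matI)
  fix r c assume "r < dim_row (mat (2 * 2) (2 * 2) (\<lambda>(r, c). if c = r mod 2 * 2 + r div 2 then 1/2 else (0 :: complex)))"
    and "c < dim_col (mat (2 * 2) (2 * 2) (\<lambda>(r, c). if c = r mod 2 * 2 + r div 2 then 1/2 else (0 :: complex)))"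
  then have "r = 0 \<or> r = 1 \<or> r = 2 \<or> r = 3" "c = 0 \<or> c = 1 \<or> c = 2 \<or> c = 3" by auto
  moreover have "1 / complex_of_real (sqrt 2) * (1 / complex_of_real (sqrt 2)) = 1/2"
    by (simp flip: of_real_mult)
  ultimately show "ptrans 2 2 Phi $$ (r, c)
      = mat (2 * 2) (2 * 2) (\<lambda>(r, c). if c = r mod 2 * 2 + r div 2 then 1/2 else (0 :: complex)) $$ (r, c)"
    by (elim disjE) (simp_all add: Phi_def phi_vec_def)
qed auto

text \<open>Half of an involution squares to 1/4 of the identity, so its eigenvalues are at most 1/2
  in absolute value.\<close>

lemma sandwich_ptrans_Phi: "sandwich (2 * 2) (ptrans 2 2 Phi) (complex_of_real (1/2) \<cdot>\<^sub>m 1\<^sub>m (2 * 2))"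
proof (rule sandwich_if_square)
  show "hermitian (ptrans 2 2 Phi)"
    using hermitian_if_psd[OF Phi_psd] unfolding hermitian_def ptrans_adjoint[OF Phi_carrier] by simp
  show "ptrans 2 2 Phi * ptrans 2 2 Phi = complex_of_real (1/2 * (1/2)) \<cdot>\<^sub>m 1\<^sub>m (2 * 2)"
  proof (rule eq_matI)
    fix r c assume "r < dim_row (complex_of_real (1/2 * (1/2)) \<cdot>\<^sub>m 1\<^sub>m (2 * 2))"
      and "c < dim_col (complex_of_real (1/2 * (1/2)) \<cdot>\<^sub>m 1\<^sub>m (2 * 2))"
    then have rc: "r < 2 * 2" "c < 2 * 2" by auto
    \<comment> \<open>\<open>s\<close> exchanges the two binary digits of the index. Being an
      involution, it leaves only the summand \<open>l = s r\<close>, which is nonzero just for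
      \<open>c = r\<close>.\<close>
    define s where "s r = r mod 2 * 2 + r div 2" for r :: nat
    have s: "s r < 2 * 2" "s (s r) = r"
    proof -
      have "r = 0 \<or> r = 1 \<or> r = 2 \<or> r = 3" using rc by auto
      then show "s r < 2 * 2" "s (s r) = r" by (auto simp: s_def)
    qed
    have "(ptrans 2 2 Phi * ptrans 2 2 Phi) $$ (r, c) = (\<Sum>l<2 * 2. ptrans 2 2 Phi $$ (r, l) * ptrans 2 2 Phi $$ (l, c))"
      by (rule mult_index_sum[OF ptrans_carrier ptrans_carrier rc])
    also have "\<dots> = (\<Sum>l<2 * 2. if l = s r then if c = r then 1/4 else 0 else 0)"
      unfolding ptrans_Phi using rc s by (intro sum.cong refl) (simp flip: s_def)
    also have "\<dots> = (complex_of_real (1/2 * (1/2)) \<cdot>\<^sub>m 1\<^sub>m (2 * 2)) $$ (r, c)"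
      using rc s by simp
    finally show "(ptrans 2 2 Phi * ptrans 2 2 Phi) $$ (r, c) = (complex_of_real (1/2 * (1/2)) \<cdot>\<^sub>m 1\<^sub>m (2 * 2)) $$ (r, c)" .
  qed auto
qed auto

lemma completely_positive_sandwich:
  assumes cp: "completely_positive m n \<Lambda>" and XY: "sandwich m X Y"
  shows "sandwich n (\<Lambda> X) (\<Lambda> Y)"
proof -
  have lin: "linear_map m n \<Lambda>" using cp by (simp add: completely_positive_def)
  have c: "X \<in> carrier_mat m m" "Y \<in> carrier_mat m m" using XY by (auto simp: sandwich_def)
  note \<Lambda>c = linear_map_carrier[OF lin c(1)] linear_map_carrier[OF lin c(2)]
  \<comment> \<open>\<open>linear_map\<close> speaks of sums and scalar multiples, so the difference
    is expressed through the factor -1.\<close>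
  have "Y - X = Y + (-1) \<cdot>\<^sub>m X" using c by (intro eq_matI) auto
  then have "\<Lambda> (Y - X) = \<Lambda> Y + (-1) \<cdot>\<^sub>m \<Lambda> X" using lin c by (simp add: linear_map_def)
  also have "\<dots> = \<Lambda> Y - \<Lambda> X" using \<Lambda>c by (intro eq_matI) auto
  finally have "\<Lambda> (Y - X) = \<Lambda> Y - \<Lambda> X" .
  moreover have "\<Lambda> (Y + X) = \<Lambda> Y + \<Lambda> X" using lin c by (simp add: linear_map_def)
  ultimately show ?thesis
    using completely_positive_psd[OF cp, of "Y - X"] completely_positive_psd[OF cp, of "Y + X"] XY \<Lambda>c
    by (simp add: sandwich_def)
qed

text \<open>The two parts of the PPT condition are used separately: complete positivity of the
  transposed map \<Lambda>' carries the two-sided bound from input to output, and complete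
  positivity of \<Lambda> makes the partial transpose of \<open>\<Lambda>' I\<close> positive. Trace
  preservation then determines the trace of \<open>\<Lambda>' I\<close>.\<close>

lemma PPT_op_overlap_bound:
  assumes \<Lambda>: "PPT_op (2 ^ m) (2 ^ m) a b \<Lambda>" and P: "P \<in> carrier_mat (a * b) (a * b)"
    and PY: "sandwich (a * b) (ptrans a b P) Y"
    and Y: "sandwich (a * b) (ptrans a b Y) (complex_of_real y \<cdot>\<^sub>m 1\<^sub>m (a * b))"
  shows "Re (mtrace (P * \<Lambda> (tensor_pow 2 2 Phi m))) \<le> y * 2 ^ m"
proof -
  let ?d = "2 ^ m * 2 ^ m :: nat"
  define \<Phi> where "\<Phi> = tensor_pow 2 2 Phi m"
  define I where "I = complex_of_real ((1/2) ^ m) \<cdot>\<^sub>m 1\<^sub>m ?d"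
  define \<Lambda>' where "\<Lambda>' X = ptrans a b (\<Lambda> (ptrans (2 ^ m) (2 ^ m) X))" for X
  have tr: "mtrace (\<Lambda> X) = mtrace X" if "X \<in> carrier_mat ?d ?d" for X
    using \<Lambda> that by (simp add: PPT_op_def cptp_def)
  have cp': "completely_positive ?d (a * b) \<Lambda>'"
    using \<Lambda> by (simp add: PPT_op_def \<Lambda>'_def[abs_def])
  have lin: "linear_map ?d (a * b) \<Lambda>" using \<Lambda> by (simp add: PPT_op_def cptp_def completely_positive_def)
  have \<Phi>: "\<Phi> \<in> carrier_mat ?d ?d" by (simp add: \<Phi>_def)
  have "psd ?d I" unfolding I_def by (rule psd_smult[OF psd_one]) (simp add: less_eq_complex_def)
  moreover have "ptrans (2 ^ m) (2 ^ m) I = I"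
    unfolding I_def ptrans_smult[OF one_carrier_mat] ptrans_one ..
  ultimately have I: "I \<in> carrier_mat ?d ?d" "ptrans (2 ^ m) (2 ^ m) I = I" "psd ?d I"
    by (auto simp: psd_carrier)
  have "sandwich ?d (ptrans (2 ^ m) (2 ^ m) \<Phi>) I"
    using tensor_pow_sandwich[OF sandwich_ptrans_Phi, of m]
    by (simp only: \<Phi>_def I_def ptrans_tensor_pow tensor_pow_smult_one of_real_power)
  then have "sandwich (a * b) (\<Lambda>' (ptrans (2 ^ m) (2 ^ m) \<Phi>)) (\<Lambda>' I)"
    by (rule completely_positive_sandwich[OF cp'])
  moreover have "\<Lambda>' (ptrans (2 ^ m) (2 ^ m) \<Phi>) = ptrans a b (\<Lambda> \<Phi>)" using \<Phi> by (simp add: \<Lambda>'_def)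
  moreover have \<Lambda>I: "\<Lambda>' I = ptrans a b (\<Lambda> I)" using I by (simp add: \<Lambda>'_def)
  ultimately have "sandwich (a * b) (ptrans a b (\<Lambda> \<Phi>)) (\<Lambda>' I)" by simp
  moreover have "psd (a * b) (ptrans a b (\<Lambda>' I))"
    unfolding \<Lambda>I ptrans_ptrans[OF linear_map_carrier[OF lin I(1)]]
    using \<Lambda> by (intro completely_positive_psd[OF _ I(3)]) (simp add: PPT_op_def cptp_def)
  ultimately have "Re (mtrace (P * \<Lambda> \<Phi>)) \<le> y * Re (mtrace (\<Lambda>' I))"
    by (rule overlap_bound[OF P linear_map_carrier[OF lin \<Phi>] PY Y])
  also have "mtrace (\<Lambda>' I) = mtrace I"
    using tr[OF I(1)] linear_map_carrier[OF lin I(1)] by (simp add: \<Lambda>I mtrace_ptrans)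
  \<comment> \<open>The identity acts on dimension 4^m, so its multiple by 2^(-m) has trace
    2^m.\<close>
  also have "mtrace I = complex_of_real ((1/2) ^ m * (2 ^ m * 2 ^ m))"
    unfolding I_def by (subst mtrace_smult[OF one_carrier_mat]) simp
  also have "(1/2) ^ m * (2 ^ m * 2 ^ m) = (2 :: real) ^ m"
    by (simp add: power_one_over)
  finally show ?thesis unfolding \<Phi>_def Re_complex_of_real .
qed

section \<open>Lower bounds from a single feasible operator\<close>

lemma tensor_pow_support:
  assumes \<rho>: "state (a * b) \<rho>"
  defines "P \<equiv> supp_proj \<rho>"
  shows "state (a ^ n * b ^ n) (tensor_pow a b \<rho> n)"
    and "projection (a ^ n * b ^ n) (tensor_pow a b P n)"
    and "tensor_pow a b P n * tensor_pow a b \<rho> n = tensor_pow a b \<rho> n"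
proof -
  have psd: "psd (a * b) \<rho>" using \<rho> by (simp add: state_def)
  note c = psd_carrier[OF psd]
  have P: "P \<in> carrier_mat (a * b) (a * b)" "mat_adjoint P = P" "P * P = P" "P * \<rho> = \<rho>"
    using supp_proj_psd[OF psd] by (auto simp: P_def projection_def hermitian_def)
  show "state (a ^ n * b ^ n) (tensor_pow a b \<rho> n)"
    using \<rho> tensor_pow_psd[OF psd] by (simp add: state_def mtrace_tensor_pow[OF c])
  show "projection (a ^ n * b ^ n) (tensor_pow a b P n)"
    by (simp add: projection_def hermitian_def tensor_pow_adjoint[OF P(1)] tensor_pow_mult[OF P(1,1)] P(2,3))
  show "tensor_pow a b P n * tensor_pow a b \<rho> n = tensor_pow a b \<rho> n"
    by (simp add: tensor_pow_mult[OF P(1) c] P(4))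
qed

text \<open>A feasible point of the optimization in \<open>E_eta\<close>, with \<open>y\<close> any
  bound on the operator norm of the partial transpose of \<open>Y\<close>. Stating the bound as a
  \<open>sandwich\<close> makes it pass to tensor powers, with \<open>y ^ n\<close> in place of
  \<open>y\<close>.\<close>

locale eta_feasible =
  fixes a b :: nat and \<rho> Y :: "complex mat" and y :: real
  assumes state: "state (a * b) \<rho>"
    and sandwich_supp: "sandwich (a * b) (ptrans a b (supp_proj \<rho>)) Y"
    and sandwich_Y: "sandwich (a * b) (ptrans a b Y) (complex_of_real y \<cdot>\<^sub>m 1\<^sub>m (a * b))"
begin

abbreviation "P n \<equiv> tensor_pow a b (supp_proj \<rho>) n"

lemma sandwich_pow:
  "sandwich (a ^ n * b ^ n) (ptrans (a ^ n) (b ^ n) (P n)) (tensor_pow a b Y n)"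
  "sandwich (a ^ n * b ^ n) (ptrans (a ^ n) (b ^ n) (tensor_pow a b Y n))
     (complex_of_real (y ^ n) \<cdot>\<^sub>m 1\<^sub>m (a ^ n * b ^ n))"
  using tensor_pow_sandwich[OF sandwich_supp, of n] tensor_pow_sandwich[OF sandwich_Y, of n]
  by (simp_all add: ptrans_tensor_pow tensor_pow_smult_one)

text \<open>The logarithm of 0 is 0 by convention, so positivity of \<open>y\<close> is essential
  for the bound -log y. With \<sigma> = Z = 1 the overlap estimate reads Tr P \<le> y Tr 1, and Tr P
  > 0 follows from comparing \<rho> with the identity in the entropy bound.\<close>

lemma pos: "0 < y"
proof -
  have psd: "psd (a * b) \<rho>" using state by (simp add: state_def)
  note c = psd_carrier[OF psd] and P = supp_proj_psd[OF psd]
  have Pc: "supp_proj \<rho> \<in> carrier_mat (a * b) (a * b)" using P(1) by (simp add: projection_def)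
  have "supp \<rho> \<subseteq> supp (1\<^sub>m (a * b))"
    using supp_mult_subset[OF one_carrier_mat c] c by simp
  then have "0 < Re (mtrace (supp_proj \<rho> * 1\<^sub>m (a * b)))"
    using rel_entropy_projection_bound(1)[OF state psd_one] P by blast
  also have "\<dots> \<le> y * Re (mtrace (1\<^sub>m (a * b)))"
  proof (rule overlap_bound[OF Pc one_carrier_mat sandwich_supp sandwich_Y])
    have "1\<^sub>m (a * b) - 1\<^sub>m (a * b) = (0\<^sub>m (a * b) (a * b) :: complex mat)" by (intro eq_matI) auto
    then have "psd (a * b) (1\<^sub>m (a * b) - 1\<^sub>m (a * b))" by (simp only: psd_zero)
    then show "sandwich (a * b) (ptrans a b (1\<^sub>m (a * b))) (1\<^sub>m (a * b))"
      by (auto simp: sandwich_def intro: psd_add)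
  qed simp
  finally show ?thesis by (auto simp: zero_less_mult_iff mult_less_0_iff)
qed

lemma E_R_tensor_pow: "ereal (- log 2 (y ^ n)) \<le> E_R (a ^ n) (b ^ n) (tensor_pow a b \<rho> n)"
  unfolding E_R_def
proof (rule INF_greatest)
  let ?\<rho> = "tensor_pow a b \<rho> n"
  fix \<sigma> assume "\<sigma> \<in> {\<sigma>. psd (a ^ n * b ^ n) \<sigma> \<and> psd (a ^ n * b ^ n) (ptrans (a ^ n) (b ^ n) \<sigma>) \<and> mtrace \<sigma> = 1}"
  then have \<sigma>: "psd (a ^ n * b ^ n) \<sigma>" "psd (a ^ n * b ^ n) (ptrans (a ^ n) (b ^ n) \<sigma>)" "mtrace \<sigma> = 1" by auto
  note c = psd_carrier[OF \<sigma>(1)] and supp = tensor_pow_support[OF state, of n]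
  have "Re (mtrace (P n * \<sigma>)) \<le> y ^ n * Re (mtrace (ptrans (a ^ n) (b ^ n) \<sigma>))"
  proof (rule overlap_bound[OF _ c sandwich_pow])
    let ?S = "ptrans (a ^ n) (b ^ n) \<sigma>"
    have "?S - ?S = 0\<^sub>m (a ^ n * b ^ n) (a ^ n * b ^ n)" by (intro eq_matI) auto
    then have "psd (a ^ n * b ^ n) (?S - ?S)" by (simp only: psd_zero)
    then show "sandwich (a ^ n * b ^ n) ?S ?S"
      using \<sigma>(2) by (auto simp: sandwich_def intro: psd_add)
  qed (use c \<sigma>(1) in auto)
  then have le: "Re (mtrace (P n * \<sigma>)) \<le> y ^ n" using c \<sigma>(3) by (simp add: mtrace_ptrans)
  show "ereal (- log 2 (y ^ n)) \<le> rel_entropy ?\<rho> \<sigma>"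
  proof (cases "supp ?\<rho> \<subseteq> supp \<sigma>")
    case True
    note bound = rel_entropy_projection_bound[OF supp(1) \<sigma>(1) True supp(2,3)]
    \<comment> \<open>Monotonicity of the logarithm requires the overlap to be positive, which is
      \<open>bound(1)\<close>.\<close>
    have "- log 2 (y ^ n) \<le> - log 2 (Re (mtrace (P n * \<sigma>)))"
      using le bound(1) by simp
    with bound(2) True show ?thesis unfolding rel_entropy_def by (simp del: log_pow_cancel)
  qed (simp add: rel_entropy_def)
qed

lemma le_E_R_inf: "ereal (- log 2 y) \<le> E_R_inf a b \<rho>"
  unfolding E_R_inf_def
proof (rule INF_greatest)
  fix n :: nat assume "n \<in> {1..}"
  then have n: "0 < real n" by simp
  have "ereal (- log 2 y) = ereal (- log 2 (y ^ n)) / ereal (real n)"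
    using n pos by (simp add: log_nat_power)
  also have "\<dots> \<le> E_R (a ^ n) (b ^ n) (tensor_pow a b \<rho> n) / ereal (real n)"
    using n by (intro ereal_divide_right_mono E_R_tensor_pow) simp
  finally show "ereal (- log 2 y) \<le> E_R (a ^ n) (b ^ n) (tensor_pow a b \<rho> n) / ereal (real n)" .
qed

text \<open>The projection \<open>P n\<close> serves as a test: it accepts the tensor power of
  \<rho> with certainty and the image of the entangled pairs with probability at most
  \<open>y ^ n * 2 ^ m\<close>.\<close>

lemma trace_norm_PPT_op:
  assumes \<Lambda>: "PPT_op (2 ^ m) (2 ^ m) (a ^ n) (b ^ n) \<Lambda>"
  shows "1 - y ^ n * 2 ^ m \<le> trace_norm (tensor_pow a b \<rho> n - \<Lambda> (tensor_pow 2 2 Phi m))"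
proof -
  let ?N = "a ^ n * b ^ n" and ?\<rho> = "tensor_pow a b \<rho> n" and ?\<sigma> = "\<Lambda> (tensor_pow 2 2 Phi m)"
  note supp = tensor_pow_support[OF state, of n]
  have \<rho>: "psd ?N ?\<rho>" "mtrace ?\<rho> = 1" using supp(1) by (auto simp: state_def)
  have \<sigma>: "psd ?N ?\<sigma>"
    using \<Lambda> tensor_pow_psd[OF Phi_psd] by (auto simp: PPT_op_def cptp_def intro: completely_positive_psd)
  note c = psd_carrier[OF \<rho>(1)] psd_carrier[OF \<sigma>]
  have "hermitian (?\<rho> - ?\<sigma>)"
    unfolding hermitian_def
    using hermitian_index[OF hermitian_if_psd[OF \<rho>(1)] c(1)] hermitian_index[OF hermitian_if_psd[OF \<sigma>] c(2)] c
    by (intro eq_matI) auto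
  then have "Re (mtrace (P n * (?\<rho> - ?\<sigma>))) \<le> trace_norm (?\<rho> - ?\<sigma>)"
    using c supp(2) by (intro mtrace_projection_le_trace_norm) auto
  moreover have "mtrace (P n * (?\<rho> - ?\<sigma>)) = 1 - mtrace (P n * ?\<sigma>)"
    using c supp(3) \<rho>(2) by (simp add: mtrace_mult_minus_right[of _ ?N])
  moreover have "Re (mtrace (P n * ?\<sigma>)) \<le> y ^ n * 2 ^ m"
    by (rule PPT_op_overlap_bound[OF \<Lambda> tensor_pow_carrier sandwich_pow])
  ultimately show ?thesis by simp
qed

lemma le_E_C: "ereal (- log 2 y) \<le> E_C a b \<rho>"
  unfolding E_C_def ent_cost_def
proof (rule Inf_greatest, safe)
  fix r :: real
  let ?m = "\<lambda>n :: nat. nat \<lfloor>r * real n\<rfloor>"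
  let ?D = "\<lambda>n. INF \<Lambda> \<in> {\<Lambda>. PPT_op (2 ^ ?m n) (2 ^ ?m n) (a ^ n) (b ^ n) \<Lambda>}.
    ereal (trace_norm (tensor_pow a b \<rho> n - \<Lambda> (tensor_pow 2 2 Phi (?m n))))"
  assume r: "0 \<le> r" and "(\<lambda>n. let m = nat \<lfloor>r * real n\<rfloor> in
    INF \<Lambda> \<in> {\<Lambda>. PPT_op (2 ^ m) (2 ^ m) (a ^ n) (b ^ n) \<Lambda>}.
      ereal (trace_norm (tensor_pow a b \<rho> n - \<Lambda> (tensor_pow 2 2 Phi m)))) \<longlonglongrightarrow> 0"
  then have lim: "?D \<longlonglongrightarrow> 0" by (simp add: Let_def)
  \<comment> \<open>\<open>c\<close> is chosen so that \<open>c ^ n\<close> dominates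
    \<open>y ^ n * 2 ^ ?m n\<close>. Rounding down in \<open>?m\<close> only helps, and
    \<open>1 \<le> c\<close> is equivalent to the desired bound on \<open>r\<close>.\<close>
  define c where "c = y * 2 powr r"
  have D: "ereal (1 - c ^ n) \<le> ?D n" for n
  proof (rule INF_greatest)
    fix \<Lambda> assume "\<Lambda> \<in> {\<Lambda>. PPT_op (2 ^ ?m n) (2 ^ ?m n) (a ^ n) (b ^ n) \<Lambda>}"
    then have "1 - y ^ n * 2 ^ ?m n \<le> trace_norm (tensor_pow a b \<rho> n - \<Lambda> (tensor_pow 2 2 Phi (?m n)))"
      by (intro trace_norm_PPT_op) auto
    moreover have "2 ^ ?m n \<le> (2 powr r) ^ n"
    proof -
      have "(2 :: real) ^ ?m n = 2 powr real (?m n)" by (simp add: powr_realpow)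
      also have "\<dots> \<le> 2 powr (r * real n)"
        using r by (intro powr_mono) (auto simp: of_nat_nat)
      also have "\<dots> = (2 powr r) ^ n" by (simp add: powr_powr flip: powr_realpow)
      finally show ?thesis .
    qed
    then have "y ^ n * 2 ^ ?m n \<le> c ^ n"
      unfolding c_def power_mult_distrib using pos by (intro mult_left_mono) auto
    ultimately show "ereal (1 - c ^ n) \<le> ereal (trace_norm (tensor_pow a b \<rho> n - \<Lambda> (tensor_pow 2 2 Phi (?m n))))"
      by simp
  qed
  \<comment> \<open>For \<open>c < 1\<close> the lower bounds \<open>1 - c ^ n\<close> tend to 1,
    while the approximation errors above them tend to 0.\<close>
  have "1 \<le> c"
  proof (rule ccontr)
    assume "\<not> 1 \<le> c"
    then have "(\<lambda>n. 1 - c ^ n) \<longlonglongrightarrow> 1 - 0"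
      using pos by (intro tendsto_diff tendsto_const LIMSEQ_power_zero) (auto simp: c_def)
    then have "(\<lambda>n. ereal (1 - c ^ n)) \<longlonglongrightarrow> ereal 1" by simp
    then have "ereal 1 \<le> 0" by (rule LIMSEQ_le[OF _ lim]) (use D in auto)
    then show False by simp
  qed
  then have "0 \<le> log 2 c" by simp
  also have "log 2 c = log 2 y + r" using pos by (simp add: c_def log_mult)
  finally show "ereal (- log 2 y) \<le> ereal r" by simp
qed

end

text \<open>A supremum is bounded by bounding every feasible \<open>Y\<close>, with the operator
  norm itself as \<open>y\<close>. The bound \<open>B\<close> is arbitrary so that the regularized
  relative entropy and the cost share this step.\<close>

lemma E_eta_le:
  assumes \<rho>: "state (a * b) \<rho>" and B: "\<And>Y y. eta_feasible a b \<rho> Y y \<Longrightarrow> ereal (- log 2 y) \<le> B"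
  shows "E_eta a b \<rho> \<le> B"
  unfolding E_eta_def
proof (rule SUP_least)
  fix Y assume "Y \<in> {Y. Y \<in> carrier_mat (a * b) (a * b) \<and> hermitian Y \<and>
    loewner_le (a * b) (- Y) (ptrans a b (supp_proj \<rho>)) \<and> loewner_le (a * b) (ptrans a b (supp_proj \<rho>)) Y}"
  then have Y: "Y \<in> carrier_mat (a * b) (a * b)" "mat_adjoint Y = Y"
    and psd: "psd (a * b) (ptrans a b (supp_proj \<rho>) - (- Y))" "psd (a * b) (Y - ptrans a b (supp_proj \<rho>))"
    by (auto simp: hermitian_def loewner_le_def)
  have "ptrans a b (supp_proj \<rho>) - (- Y) = Y + ptrans a b (supp_proj \<rho>)"
    using Y by (intro eq_matI) auto
  then have "sandwich (a * b) (ptrans a b (supp_proj \<rho>)) Y" using Y psd by (simp add: sandwich_def)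
  moreover have "sandwich (a * b) (ptrans a b Y) (complex_of_real (op_norm (ptrans a b Y)) \<cdot>\<^sub>m 1\<^sub>m (a * b))"
    using Y by (intro sandwich_op_norm) (auto simp: hermitian_def ptrans_adjoint)
  ultimately show "ereal (- log 2 (op_norm (ptrans a b Y))) \<le> B"
    using \<rho> by (intro B) (simp add: eta_feasible_def)
qed

text \<open>Enlarging the class of operations lowers the minimal error, which nonnegativity of the
  trace norm squeezes to 0. Every rate achievable with the smaller class is then achievable with the
  larger one.\<close>

lemma ent_cost_mono:
  assumes sub: "\<And>a b a' b' \<Lambda>. \<Omega> a b a' b' \<Lambda> \<Longrightarrow> \<Omega>' a b a' b' \<Lambda>"
    and nonneg: "\<And>m n \<Lambda>. \<Omega>' (2 ^ m) (2 ^ m) (a ^ n) (b ^ n) \<Lambda> \<Longrightarrow>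
      0 \<le> trace_norm (tensor_pow a b \<rho> n - \<Lambda> (tensor_pow 2 2 Phi m))"
  shows "ent_cost \<Omega>' a b \<rho> \<le> ent_cost \<Omega> a b \<rho>"
  unfolding ent_cost_def Let_def
proof (rule Inf_superset_mono, safe)
  fix r :: real
  let ?m = "\<lambda>n :: nat. nat \<lfloor>r * real n\<rfloor>"
  let ?D = "\<lambda>\<Omega> n. INF \<Lambda> \<in> {\<Lambda>. \<Omega> (2 ^ ?m n) (2 ^ ?m n) (a ^ n) (b ^ n) \<Lambda>}.
    ereal (trace_norm (tensor_pow a b \<rho> n - \<Lambda> (tensor_pow 2 2 Phi (?m n))))"
  assume r: "0 \<le> r" and lim: "?D \<Omega> \<longlonglongrightarrow> 0"
  have "0 \<le> ?D \<Omega>' n" for n using nonneg by (intro INF_greatest) simp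
  moreover have "?D \<Omega>' n \<le> ?D \<Omega> n" for n using sub by (intro INF_superset_mono) auto
  ultimately have "?D \<Omega>' \<longlonglongrightarrow> 0"
    by (intro tendsto_sandwich[OF _ _ tendsto_const lim]) auto
  then show "\<exists>r'. ereal r = ereal r' \<and> 0 \<le> r' \<and> (\<lambda>n. INF \<Lambda> \<in> {\<Lambda>. \<Omega>' (2 ^ nat \<lfloor>r' * real n\<rfloor>) (2 ^ nat \<lfloor>r' * real n\<rfloor>) (a ^ n) (b ^ n) \<Lambda>}.
      ereal (trace_norm (tensor_pow a b \<rho> n - \<Lambda> (tensor_pow 2 2 Phi (nat \<lfloor>r' * real n\<rfloor>))))) \<longlonglongrightarrow> 0"
    using r by blast
qed

theorem proposition1:
  fixes a b :: nat and \<rho> :: "complex mat"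
  assumes "state (a * b) \<rho>"
  shows "E_R_inf a b \<rho> \<ge> E_eta a b \<rho> \<and>
         E_C_LOCC a b \<rho> \<ge> E_C a b \<rho> \<and>
         E_C a b \<rho> \<ge> E_eta a b \<rho>"
proof (intro conjI)
  show "E_eta a b \<rho> \<le> E_R_inf a b \<rho>"
    using assms eta_feasible.le_E_R_inf by (rule E_eta_le)
  show "E_eta a b \<rho> \<le> E_C a b \<rho>"
    using assms eta_feasible.le_E_C by (rule E_eta_le)
  show "E_C a b \<rho> \<le> E_C_LOCC a b \<rho>"
    unfolding E_C_def E_C_LOCC_def
  proof (rule ent_cost_mono)
    fix m n \<Lambda> assume "PPT_op (2 ^ m) (2 ^ m) (a ^ n) (b ^ n) \<Lambda>"
    then have "\<Lambda> (tensor_pow 2 2 Phi m) \<in> carrier_mat (a ^ n * b ^ n) (a ^ n * b ^ n)"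
      by (auto simp: PPT_op_def cptp_def completely_positive_def intro: linear_map_carrier)
    then show "0 \<le> trace_norm (tensor_pow a b \<rho> n - \<Lambda> (tensor_pow 2 2 Phi m))"
      by (intro trace_norm_nonneg[OF minus_carrier_mat])
  qed (rule LOCC_op_PPT_op)
qed

end
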